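(* Let $\Sigma$ be a finite set, $P=(p(x,y))$ an irreducible transition matrix on $\Sigma$ with invariant distribution $\pi$ and mixing time $T$, $\nu$ a probability distribution on $\Sigma$, and $\mu$ a measure on $\Sigma$ with full support. There exists a probability space $(\Omega,\mathcal F,\mathbb Q)$ on which one can construct a Markov chain $(Z_i)_{i\ge0}$ with transition matrix $P$ and initial distribution $\nu$ and an i.i.d. sequence $(U_i)_{i\ge0}$ with marginal $\pi$ such that for every $\varepsilon$ satisfying $$0<\varepsilon\le\frac12\wedge\min_{z\in\Sigma}\frac{\mathrm{Var}_\pi\rho_z}{2\|\rho_z\|_\infty g(z)}$$ and every $n\ge 2k(\varepsilon)T$, $$\mathbb Q[\mathcal G(n,\varepsilon)^c]\le C\sum_{z\in\Sigma}\Big(e^{-cn\varepsilon^2}+e^{-cn\varepsilon\frac{\pi(z)}{\nu(z)}}+\exp\Big\{-\frac{c\,\varepsilon^2g(z)^2}{\mathrm{Var}_\pi\rho_z}\,\frac{n}{k(\varepsilon)T}\Big\}\Big),$$ where $c,C\in(0,\infty)$ are absolute constants, $$\mathcal G(n,\varepsilon)=\big\{\{U_i\}_{i=0}^{n(1-\varepsilon)}\subset\{Z_i\}_{i=0}^n\subset\{U_i\}_{i=0}^{n(1+\varepsilon)}\big\},$$ and $k(\varepsilon)=-\min_{z\in\Sigma}\log_2\frac{\pi_\star\varepsilon^2g(z)^2}{6\,\mathrm{Var}_\pi(\rho_z)}$.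
   Context: The mixing time is $T=\min\{n\ge0:\max_{x\in\Sigma}\|P^n(x,\cdot)-\pi\|_{TV}\le 1/4\}$ with $\|\nu-\nu'\|_{TV}=\frac12\sum_x|\nu(x)-\nu'(x)|$. $\pi_\star=\min_{z\in\Sigma}\pi(z)$. $g(x)=\pi(x)/\mu(x)$, $\rho(x,y)=p(x,y)/\mu(y)$, and $\rho_y$ denotes the function $x\mapsto\rho(x,y)$. For $f:\Sigma\to\mathbb R$, $\pi(f)=\sum_x\pi(x)f(x)$ and $\mathrm{Var}_\pi f=\pi((f-\pi(f))^2)$. Upper indices of sets like $\{U_i\}_{i=0}^{n(1\pm\varepsilon)}$ are understood as integer parts. *)

theory Defs
  imports "HOL-Probability.Probability"
begin

text \<open>Finite state space is an explicit finite carrier set S; functions outside S are irrelevant.\<close>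

definition stochastic :: "'a set \<Rightarrow> ('a \<Rightarrow> 'a \<Rightarrow> real) \<Rightarrow> bool" where
  "stochastic S p \<longleftrightarrow> (\<forall>x\<in>S. (\<forall>y\<in>S. p x y \<ge> 0) \<and> (\<Sum>y\<in>S. p x y) = 1)"

definition prob_dist :: "'a set \<Rightarrow> ('a \<Rightarrow> real) \<Rightarrow> bool" where
  "prob_dist S \<nu> \<longleftrightarrow> (\<forall>x\<in>S. \<nu> x \<ge> 0) \<and> (\<Sum>x\<in>S. \<nu> x) = 1"

fun mpow :: "'a set \<Rightarrow> ('a \<Rightarrow> 'a \<Rightarrow> real) \<Rightarrow> nat \<Rightarrow> 'a \<Rightarrow> 'a \<Rightarrow> real" where
  "mpow S p 0 x y = (if x = y then 1 else 0)"
| "mpow S p (Suc n) x y = (\<Sum>z\<in>S. mpow S p n x z * p z y)"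

definition irreducible_chain :: "'a set \<Rightarrow> ('a \<Rightarrow> 'a \<Rightarrow> real) \<Rightarrow> bool" where
  "irreducible_chain S p \<longleftrightarrow> (\<forall>x\<in>S. \<forall>y\<in>S. \<exists>n. mpow S p n x y > 0)"

definition invariant_dist :: "'a set \<Rightarrow> ('a \<Rightarrow> 'a \<Rightarrow> real) \<Rightarrow> ('a \<Rightarrow> real) \<Rightarrow> bool" where
  "invariant_dist S p \<pi> \<longleftrightarrow> prob_dist S \<pi> \<and> (\<forall>y\<in>S. (\<Sum>x\<in>S. \<pi> x * p x y) = \<pi> y)"

definition tv_dist :: "'a set \<Rightarrow> ('a \<Rightarrow> real) \<Rightarrow> ('a \<Rightarrow> real) \<Rightarrow> real" where
  "tv_dist S \<nu> \<nu>' = (1/2) * (\<Sum>x\<in>S. \<bar>\<nu> x - \<nu>' x\<bar>)"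

definition mixes_at :: "'a set \<Rightarrow> ('a \<Rightarrow> 'a \<Rightarrow> real) \<Rightarrow> ('a \<Rightarrow> real) \<Rightarrow> nat \<Rightarrow> bool" where
  "mixes_at S p \<pi> n \<longleftrightarrow> (\<forall>x\<in>S. tv_dist S (mpow S p n x) \<pi> \<le> 1/4)"

text \<open>Mixing time; only meaningful when some n satisfies mixes_at (otherwise T = infinity
  in the paper, and the statement guards on existence).\<close>
definition mixing_time :: "'a set \<Rightarrow> ('a \<Rightarrow> 'a \<Rightarrow> real) \<Rightarrow> ('a \<Rightarrow> real) \<Rightarrow> nat" where
  "mixing_time S p \<pi> = (LEAST n. mixes_at S p \<pi> n)"

definition pi_star :: "'a set \<Rightarrow> ('a \<Rightarrow> real) \<Rightarrow> real" where
  "pi_star S \<pi> = Min (\<pi> ` S)"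

definition gfun :: "('a \<Rightarrow> real) \<Rightarrow> ('a \<Rightarrow> real) \<Rightarrow> 'a \<Rightarrow> real" where
  "gfun \<pi> \<mu> x = \<pi> x / \<mu> x"

definition rho :: "('a \<Rightarrow> 'a \<Rightarrow> real) \<Rightarrow> ('a \<Rightarrow> real) \<Rightarrow> 'a \<Rightarrow> 'a \<Rightarrow> real" where
  "rho p \<mu> y x = p x y / \<mu> y"  \<comment> \<open>rho p mu y is the function x |-> rho(x,y)\<close>

definition pi_exp :: "'a set \<Rightarrow> ('a \<Rightarrow> real) \<Rightarrow> ('a \<Rightarrow> real) \<Rightarrow> real" where
  "pi_exp S \<pi> f = (\<Sum>x\<in>S. \<pi> x * f x)"

definition var_pi :: "'a set \<Rightarrow> ('a \<Rightarrow> real) \<Rightarrow> ('a \<Rightarrow> real) \<Rightarrow> real" where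
  "var_pi S \<pi> f = pi_exp S \<pi> (\<lambda>x. (f x - pi_exp S \<pi> f)^2)"

definition sup_norm :: "'a set \<Rightarrow> ('a \<Rightarrow> real) \<Rightarrow> real" where
  "sup_norm S f = Max ((\<lambda>x. \<bar>f x\<bar>) ` S)"

definition k_eps :: "'a set \<Rightarrow> ('a \<Rightarrow> 'a \<Rightarrow> real) \<Rightarrow> ('a \<Rightarrow> real) \<Rightarrow> ('a \<Rightarrow> real) \<Rightarrow> real \<Rightarrow> real" where
  "k_eps S p \<pi> \<mu> \<epsilon> = - Min ((\<lambda>z. log 2 (pi_star S \<pi> * \<epsilon>^2 * (gfun \<pi> \<mu> z)^2
                                         / (6 * var_pi S \<pi> (rho p \<mu> z)))) ` S)"

definition markov_chain :: "'w measure \<Rightarrow> 'a set \<Rightarrow> ('a \<Rightarrow> 'a \<Rightarrow> real) \<Rightarrow> ('a \<Rightarrow> real)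
    \<Rightarrow> (nat \<Rightarrow> 'w \<Rightarrow> 'a) \<Rightarrow> bool" where
  "markov_chain M S p \<nu> Z \<longleftrightarrow>
     (\<forall>i. Z i \<in> measurable M (count_space UNIV)) \<and>
     (\<forall>i. \<forall>\<omega>\<in>space M. Z i \<omega> \<in> S) \<and>
     (\<forall>n xs. (\<forall>i\<le>n. xs i \<in> S) \<longrightarrow>
        measure M {\<omega>\<in>space M. \<forall>i\<le>n. Z i \<omega> = xs i}
          = \<nu> (xs 0) * (\<Prod>i<n. p (xs i) (xs (Suc i))))"

definition iid_marginal :: "'w measure \<Rightarrow> 'a set \<Rightarrow> ('a \<Rightarrow> real) \<Rightarrow> (nat \<Rightarrow> 'w \<Rightarrow> 'a) \<Rightarrow> bool" where
  "iid_marginal M S \<pi> U \<longleftrightarrow>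
     prob_space.indep_vars M (\<lambda>_. count_space UNIV) U UNIV \<and>
     (\<forall>i. \<forall>\<omega>\<in>space M. U i \<omega> \<in> S) \<and>
     (\<forall>i. \<forall>x\<in>S. measure M {\<omega>\<in>space M. U i \<omega> = x} = \<pi> x)"

definition good_event :: "nat \<Rightarrow> real \<Rightarrow> (nat \<Rightarrow> 'w \<Rightarrow> 'a) \<Rightarrow> (nat \<Rightarrow> 'w \<Rightarrow> 'a) \<Rightarrow> 'w \<Rightarrow> bool" where
  "good_event n \<epsilon> Z U \<omega> \<longleftrightarrow>
     (\<lambda>i. U i \<omega>) ` {0..nat \<lfloor>real n * (1 - \<epsilon>)\<rfloor>} \<subseteq> (\<lambda>i. Z i \<omega>) ` {0..n} \<and>
     (\<lambda>i. Z i \<omega>) ` {0..n} \<subseteq> (\<lambda>i. U i \<omega>) ` {0..nat \<lfloor>real n * (1 + \<epsilon>)\<rfloor>}"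

end

theory Submission
  imports Defs
begin

text \<open>
  Soft local times, run with residual clocks. Each state z carries an independent Exp(1) clock. A
  chain whose current transition vector is w lets the clocks run, clock z at rate w z: the first
  clock to ring is the next state, it rings after an Exp(1) time, and by lack of memory the residual
  clocks of the other states, together with a fresh clock for the winner, are again independent
  Exp(1) variables. A state has been visited by time n precisely when the accumulated load of the
  state (the sum of gap times rate) has passed the initial clock of the state. The Markov chain and
  the i.i.d. sequence share the initial clocks and use separate fresh ones, so the two ranges can
  only fail to be nested if one of the loads deviates from its mean.

  The load of the i.i.d. sequence is a sum of exponential variables. For the Markov chain, Jensen's
  inequality over the residue classes modulo l reduces the exponential moment of the load to that of
  a chain with l-step transitions. If l is a multiple of k T, these are within a factor close to 1
  of the stationary distribution, and the exponential moment is that of an independent sample. If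
  the variance at z is small compared with the squared mean, the randomness of the exponential
  variables dominates that of the chain; taking l at least the ratio of the two makes both of the
  same order and produces the term with n times epsilon squared.
\<close>

section \<open>Exponential clocks\<close>

text \<open>The first step of the chain runs at the rates \<open>\<nu>\<close>, which may be large
  compared with \<open>\<pi>\<close>. Its load is split off and bounded through its exponential gap
  alone; this is the origin of the term with \<pi>(z)/\<nu>(z). The margin \<epsilon> is spent in
  halves: the levels n (1 - \<epsilon>/2) \<pi>(z) and n (1 + \<epsilon>/2) \<pi>(z) separate the
  loads, and the half of the chain is divided again between the first step and the n later ones.

  The measure \<mu> cancels. If v(z) is the variance of the column p(., z) under \<pi>, then g(z)^2
  / Var \<rho>_z = \<pi>(z)^2 / v(z), and the condition on \<epsilon> reads 2 \<epsilon> B(z)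
  \<pi>(z) \<le> v(z) with B(z) the maximum of the column. It keeps the best Chernoff parameter, a
  multiple of \<epsilon> \<pi>(z) / v(z), in the range where a quadratic bound of the exponential
  holds.

  Mixing gives an additive error, whereas the exponential moments need a multiple of \<pi>. The
  factor \<open>pi_star\<close> inside k turns one into the other; the rest of k makes the relative
  error small against \<epsilon>^2 \<pi>(z)^2 / v(z), the gain per l steps up to a constant.\<close>

definition expo :: "real measure" where
  "expo = density lborel (\<lambda>t. ennreal (exponential_density 1 t))"

lemma sets_expo [measurable_cong, simp]: "sets expo = sets borel"
  by (simp add: expo_def)

lemma space_expo [simp]: "space expo = UNIV"
  by (simp add: expo_def)

lemma prob_space_expo: "prob_space expo"
  unfolding expo_def by (rule prob_space_exponential_density) simp

interpretation expo: prob_space expo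
  by (rule prob_space_expo)

lemma nn_integral_expo:
  assumes [measurable]: "f \<in> borel_measurable borel"
  shows "(\<integral>\<^sup>+ x. f x \<partial>expo) = (\<integral>\<^sup>+ x. ennreal (exp (- x)) * indicator {0..} x * f x \<partial>lborel)"
proof -
  have "(\<integral>\<^sup>+ x. f x \<partial>expo) = (\<integral>\<^sup>+ x. ennreal (exponential_density 1 x) * f x \<partial>lborel)"
    unfolding expo_def by (subst nn_integral_density) auto
  also have "\<dots> = (\<integral>\<^sup>+ x. ennreal (exp (- x)) * indicator {0..} x * f x \<partial>lborel)"
    by (intro nn_integral_cong) (auto simp: exponential_density_def indicator_def)
  finally show ?thesis .
qed

lemma AE_expo_nonneg: "AE x in expo. 0 \<le> x"
  unfolding expo_def by (subst AE_density) (auto simp: exponential_density_def)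

text \<open>Tilting the density by \<open>exp (b * x)\<close> gives the density of rate
  \<open>1 - b\<close> up to the factor \<open>1 / (1 - b)\<close>, so that only its total mass is
  needed.\<close>

lemma nn_integral_expo_exp:
  assumes "b < 1"
  shows "(\<integral>\<^sup>+ x. ennreal (exp (b * x)) \<partial>expo) = ennreal (1 / (1 - b))"
proof -
  have b: "0 < 1 - b" using assms by simp
  interpret P: prob_space "density lborel (\<lambda>t. ennreal (exponential_density (1 - b) t))"
    using prob_space_exponential_density[OF b] by simp
  have "(\<integral>\<^sup>+ x. ennreal (exp (b * x)) \<partial>expo)
      = (\<integral>\<^sup>+ x. ennreal (exp (- x)) * indicator {0..} x * ennreal (exp (b * x)) \<partial>lborel)"
    by (rule nn_integral_expo) simp
  also have "\<dots> = (\<integral>\<^sup>+ x. ennreal (1 / (1 - b)) * ennreal (exponential_density (1 - b) x) \<partial>lborel)"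
  proof (intro nn_integral_cong)
    fix x :: real
    have "exp (- x) * exp (b * x) = 1 / (1 - b) * ((1 - b) * exp (- x * (1 - b)))"
      using b by (simp flip: exp_add) (simp add: algebra_simps)
    then show "ennreal (exp (- x)) * indicator {0..} x * ennreal (exp (b * x))
      = ennreal (1 / (1 - b)) * ennreal (exponential_density (1 - b) x)"
      using b by (auto simp: exponential_density_def indicator_def simp flip: ennreal_mult'')
  qed
  also have "\<dots> = ennreal (1 / (1 - b)) * (\<integral>\<^sup>+ x. ennreal (exponential_density (1 - b) x) \<partial>lborel)"
    by (rule nn_integral_cmult) simp
  also have "(\<integral>\<^sup>+ x. ennreal (exponential_density (1 - b) x) \<partial>lborel) = 1"
    using P.emeasure_space_1 by (simp add: emeasure_density)
  finally show ?thesis by simp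
qed

text \<open>The set \<open>D\<close> is left free between the open and the closed half-line at
  \<open>c\<close>, which differ by a null set. One identity then serves strict and weak comparisons
  of clocks.\<close>

lemma expo_memoryless:
  assumes [measurable]: "K \<in> borel_measurable borel" "D \<in> sets borel"
    and c: "0 \<le> c" and D: "{c<..} \<subseteq> D" "D \<subseteq> {c..}"
  shows "(\<integral>\<^sup>+ x. indicator D x * K (x - c) \<partial>expo) = ennreal (exp (- c)) * (\<integral>\<^sup>+ x. K x \<partial>expo)"
proof -
  have "(\<integral>\<^sup>+ x. indicator D x * K (x - c) \<partial>expo)
     = (\<integral>\<^sup>+ x. ennreal (exp (- x)) * indicator {0..} x * (indicator D x * K (x - c)) \<partial>lborel)"
    by (rule nn_integral_expo) simp
  also have "\<dots> = (\<integral>\<^sup>+ x. ennreal (exp (- x)) * (indicator {0..} (x - c) * K (x - c)) \<partial>lborel)"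
  proof (rule nn_integral_cong_AE)
    show "AE x in lborel. ennreal (exp (- x)) * indicator {0..} x * (indicator D x * K (x - c))
        = ennreal (exp (- x)) * (indicator {0..} (x - c) * K (x - c))"
      using AE_lborel_singleton[of c]
      by eventually_elim (use c D in \<open>force simp: indicator_def\<close>)
  qed
  also have "\<dots> = (\<integral>\<^sup>+ x. ennreal (exp (- (c + 1 * x))) * (indicator {0..} (c + 1 * x - c) * K (c + 1 * x - c)) \<partial>lborel)"
    by (subst nn_integral_real_affine[where c = 1 and t = c]) auto
  also have "\<dots> = (\<integral>\<^sup>+ x. ennreal (exp (- c)) * (ennreal (exp (- x)) * indicator {0..} x * K x) \<partial>lborel)"
    by (intro nn_integral_cong) (simp add: exp_add exp_minus divide_simps ennreal_mult' mult_ac exp_diff flip: ennreal_mult')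
  also have "\<dots> = ennreal (exp (- c)) * (\<integral>\<^sup>+ x. K x \<partial>expo)"
    by (subst nn_integral_cmult) (auto simp: nn_integral_expo)
  finally show ?thesis .
qed

interpretation expos: product_sigma_finite "\<lambda>_. expo"
  by unfold_locales

text \<open>The shift identity of a coordinate is assumed here because two kinds occur: a clock of
  positive rate contributes the factor \<open>exp (- c i)\<close>, while a clock of rate zero has
  \<open>D i = UNIV\<close>, \<open>c i = 0\<close> and contributes 1.\<close>

lemma prod_memoryless:
  assumes "finite J"
    and "\<And>i. i \<in> J \<Longrightarrow> D i \<in> sets borel"
    and "\<And>i K. i \<in> J \<Longrightarrow> K \<in> borel_measurable borel \<Longrightarrow>
      (\<integral>\<^sup>+ x. indicator (D i) x * K (x - c i) \<partial>expo) = b i * (\<integral>\<^sup>+ x. K x \<partial>expo)"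
    and "K \<in> borel_measurable (PiM J (\<lambda>_. expo))"
  shows "(\<integral>\<^sup>+ r. (\<Prod>i\<in>J. indicator (D i) (r i)) * K (\<lambda>i\<in>J. r i - c i) \<partial>PiM J (\<lambda>_. expo))
    = (\<Prod>i\<in>J. b i) * (\<integral>\<^sup>+ r. K r \<partial>PiM J (\<lambda>_. expo))"
  using assms
proof (induction J arbitrary: K rule: finite_induct)
  case empty
  show ?case
    by (simp add: PiM_empty nn_integral_count_space_finite restrict_def)
next
  case (insert j J)
  have [measurable]: "D i \<in> sets borel" if "i \<in> insert j J" for i
    using insert.prems(1) that by auto
  note [measurable] = insert.prems(3)
  let ?P = "PiM J (\<lambda>_. expo)"
  have meas: "(\<lambda>r. (\<Prod>i\<in>insert j J. indicator (D i) (r i)) * K (\<lambda>i\<in>insert j J. r i - c i))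
      \<in> borel_measurable (PiM (insert j J) (\<lambda>_. expo))"
    by measurable
  have "(\<integral>\<^sup>+ r. (\<Prod>i\<in>insert j J. indicator (D i) (r i)) * K (\<lambda>i\<in>insert j J. r i - c i) \<partial>PiM (insert j J) (\<lambda>_. expo))
    = (\<integral>\<^sup>+ r. \<integral>\<^sup>+ x. (\<Prod>i\<in>insert j J. indicator (D i) ((r(j := x)) i))
          * K (\<lambda>i\<in>insert j J. (r(j := x)) i - c i) \<partial>expo \<partial>?P)"
    using insert.hyps by (rule expos.product_nn_integral_insert) (rule meas)
  also have "\<dots> = (\<integral>\<^sup>+ r. (\<Prod>i\<in>J. indicator (D i) (r i)) *
     (\<integral>\<^sup>+ x. indicator (D j) x * K ((\<lambda>i\<in>J. r i - c i)(j := x - c j)) \<partial>expo) \<partial>?P)"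
  proof (intro nn_integral_cong)
    fix r :: "'a \<Rightarrow> real" assume r: "r \<in> space ?P"
    have eq: "(\<lambda>i\<in>insert j J. (r(j := x)) i - c i) = (\<lambda>i\<in>J. r i - c i)(j := x - c j)" for x
      using insert.hyps by (auto simp: fun_eq_iff restrict_def)
    have pe: "(\<Prod>i\<in>insert j J. indicator (D i) ((r(j := x)) i) :: ennreal)
        = (\<Prod>i\<in>J. indicator (D i) (r i)) * indicator (D j) x" for x
      using insert.hyps by (subst prod.insert) (auto simp: mult.commute intro!: arg_cong2[where f = "(*)"] prod.cong)
    have [measurable]: "(\<lambda>i\<in>J. r i - c i) \<in> space ?P"
      by (auto simp: space_PiM)
    have [measurable]: "(\<lambda>x. K ((\<lambda>i\<in>J. r i - c i)(j := x - c j))) \<in> borel_measurable borel"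
    proof -
      have "(\<lambda>x. (\<lambda>i\<in>J. r i - c i)(j := x - c j)) \<in> measurable borel (PiM (insert j J) (\<lambda>_. expo))"
        by (rule measurable_fun_upd[where J = J]) auto
      from measurable_compose[OF this insert.prems(3)] show ?thesis .
    qed
    show "(\<integral>\<^sup>+ x. (\<Prod>i\<in>insert j J. indicator (D i) ((r(j := x)) i))
          * K (\<lambda>i\<in>insert j J. (r(j := x)) i - c i) \<partial>expo)
       = (\<Prod>i\<in>J. indicator (D i) (r i)) *
     (\<integral>\<^sup>+ x. indicator (D j) x * K ((\<lambda>i\<in>J. r i - c i)(j := x - c j)) \<partial>expo)"
      unfolding eq pe mult.assoc by (rule nn_integral_cmult) measurable
  qed
  also have "\<dots> = (\<integral>\<^sup>+ r. (\<Prod>i\<in>J. indicator (D i) (r i)) *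
     (b j * (\<integral>\<^sup>+ x. K ((\<lambda>i\<in>J. r i - c i)(j := x)) \<partial>expo)) \<partial>?P)"
  proof (intro nn_integral_cong arg_cong2[where f = "(*)"] refl)
    fix r :: "'a \<Rightarrow> real" assume r: "r \<in> space ?P"
    have [measurable]: "(\<lambda>i\<in>J. r i - c i) \<in> space ?P"
      by (auto simp: space_PiM)
    have "(\<lambda>x. (\<lambda>i\<in>J. r i - c i)(j := x)) \<in> measurable borel (PiM (insert j J) (\<lambda>_. expo))"
      by (rule measurable_fun_upd[where J = J]) auto
    from measurable_compose[OF this insert.prems(3)]
    have "(\<lambda>x. K ((\<lambda>i\<in>J. r i - c i)(j := x))) \<in> borel_measurable borel" .
    from insert.prems(2)[OF _ this, of j]
    show "(\<integral>\<^sup>+ x. indicator (D j) x * K ((\<lambda>i\<in>J. r i - c i)(j := x - c j)) \<partial>expo)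
       = b j * (\<integral>\<^sup>+ x. K ((\<lambda>i\<in>J. r i - c i)(j := x)) \<partial>expo)" by simp
  qed
  also have "\<dots> = b j * (\<integral>\<^sup>+ r. (\<Prod>i\<in>J. indicator (D i) (r i)) *
     (\<integral>\<^sup>+ x. K ((\<lambda>i\<in>J. r i - c i)(j := x)) \<partial>expo) \<partial>?P)"
    unfolding mult.left_commute[of _ "b j"]
  proof (rule nn_integral_cmult)
    have [measurable]: "(\<lambda>(r, x). (\<lambda>i\<in>J. r i - c i)(j := x)) \<in> measurable (?P \<Otimes>\<^sub>M expo) (PiM (insert j J) (\<lambda>_. expo))"
      unfolding case_prod_beta by (rule measurable_fun_upd[where J = J]) auto
    show "(\<lambda>r. (\<Prod>i\<in>J. indicator (D i) (r i)) * (\<integral>\<^sup>+ x. K ((\<lambda>i\<in>J. r i - c i)(j := x)) \<partial>expo)) \<in> borel_measurable ?P"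
      by measurable
  qed
  \<comment> \<open>The induction hypothesis is used for \<open>K\<close> with the coordinate
    \<open>j\<close> integrated out.\<close>
  also have "(\<integral>\<^sup>+ r. (\<Prod>i\<in>J. indicator (D i) (r i)) *
     (\<integral>\<^sup>+ x. K ((\<lambda>i\<in>J. r i - c i)(j := x)) \<partial>expo) \<partial>?P)
     = (\<Prod>i\<in>J. b i) * (\<integral>\<^sup>+ r. \<integral>\<^sup>+ x. K (r(j := x)) \<partial>expo \<partial>?P)"
  proof (rule insert.IH)
    have [measurable]: "(\<lambda>(r, x). r(j := x)) \<in> measurable (?P \<Otimes>\<^sub>M expo) (PiM (insert j J) (\<lambda>_. expo))"
      unfolding case_prod_beta by (rule measurable_fun_upd[where J = J]) auto
    show "(\<lambda>r. \<integral>\<^sup>+ x. K (r(j := x)) \<partial>expo) \<in> borel_measurable ?P"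
      by measurable
  qed (use insert.prems in auto)
  also have "(\<integral>\<^sup>+ r. \<integral>\<^sup>+ x. K (r(j := x)) \<partial>expo \<partial>?P) = (\<integral>\<^sup>+ r. K r \<partial>PiM (insert j J) (\<lambda>_. expo))"
    using insert.hyps by (rule expos.product_nn_integral_insert[symmetric]) (rule insert.prems(3))
  finally show ?case
    using insert.hyps by (simp add: mult_ac)
qed

section \<open>The race between residual clocks\<close>

text \<open>States of rate zero are excluded because division by zero would assign them the ringing
  time 0, ahead of all others.\<close>

definition winner :: "'a set \<Rightarrow> ('a \<Rightarrow> real) \<Rightarrow> ('a \<Rightarrow> real) \<Rightarrow> 'a" where
  "winner S w r = arg_min_on (\<lambda>z. r z / w z) {z\<in>S. 0 < w z}"

definition ring_time :: "'a set \<Rightarrow> ('a \<Rightarrow> real) \<Rightarrow> ('a \<Rightarrow> real) \<Rightarrow> real" where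
  "ring_time S w r = r (winner S w r) / w (winner S w r)"

definition next_clocks :: "'a set \<Rightarrow> ('a \<Rightarrow> real) \<Rightarrow> ('a \<Rightarrow> real) \<Rightarrow> real \<Rightarrow> 'a \<Rightarrow> real" where
  "next_clocks S w r a = (\<lambda>z\<in>S. if z = winner S w r then a else r z - ring_time S w r * w z)"

lemma prob_dist_pos:
  assumes "prob_dist S w"
  shows "{z\<in>S. 0 < w z} \<noteq> {}"
proof
  assume "{z\<in>S. 0 < w z} = {}"
  then have "w z = 0" if "z \<in> S" for z
    using assms that unfolding prob_dist_def by force
  then show False using assms by (simp add: prob_dist_def)
qed

lemma winner_in:
  assumes "finite S" "prob_dist S w"
  shows "winner S w r \<in> S" "0 < w (winner S w r)"
proof -
  have "winner S w r \<in> {z\<in>S. 0 < w z}"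
    unfolding winner_def using assms prob_dist_pos by (intro arg_min_if_finite) auto
  then show "winner S w r \<in> S" "0 < w (winner S w r)" by auto
qed

lemma ring_time_le:
  assumes "finite S" "prob_dist S w" "z \<in> S" "0 < w z"
  shows "ring_time S w r \<le> r z / w z"
  unfolding ring_time_def winner_def using assms prob_dist_pos[OF assms(2)] by (intro arg_min_least) auto

lemma winner_eqI:
  assumes "finite S" "prob_dist S w" "y \<in> S" "0 < w y"
    and "\<And>z. z \<in> S - {y} \<Longrightarrow> 0 < w z \<Longrightarrow> r y / w y < r z / w z"
  shows "winner S w r = y"
  using winner_in[OF assms(1,2), of r] ring_time_le[OF assms(1-4), of r] assms(5)[of "winner S w r"]
  unfolding ring_time_def by force

text \<open>The choice inside \<open>arg_min_on\<close> depends on the clocks only through the set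
  \<open>B r\<close> of minimisers. This set takes finitely many values, each on a measurable event,
  and every function on a discrete space is measurable.\<close>

lemma measurable_winner [measurable]:
  assumes S: "finite S"
  shows "winner S w \<in> measurable (PiM S (\<lambda>_. expo)) (count_space UNIV)"
proof -
  define B where "B r = {x \<in> S. 0 < w x \<and> (\<forall>y\<in>S. 0 < w y \<longrightarrow> \<not> r y / w y < r x / w x)}" for r :: "'a \<Rightarrow> real"
  have "B \<in> measurable (PiM S (\<lambda>_. expo)) (count_space (Pow S))"
  proof (subst measurable_count_space_eq2)
    show "finite (Pow S)" using S by simp
    have "{r \<in> space (PiM S (\<lambda>_. expo)). B r = C} \<in> sets (PiM S (\<lambda>_. expo))" if C: "C \<subseteq> S" for C
    proof -
      have "B r = C \<longleftrightarrow> (\<forall>x\<in>S. (x \<in> C) = (0 < w x \<and> (\<forall>y\<in>S. 0 < w y \<longrightarrow> \<not> r y / w y < r x / w x)))" for r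
        using C unfolding B_def by auto
      then have *: "{r \<in> space (PiM S (\<lambda>_. expo)). B r = C} = {r \<in> space (PiM S (\<lambda>_. expo)).
         \<forall>x\<in>S. (x \<in> C) = (0 < w x \<and> (\<forall>y\<in>S. 0 < w y \<longrightarrow> \<not> r y / w y < r x / w x))}"
        by simp
      show ?thesis unfolding * using S by measurable
    qed
    then show "B \<in> space (PiM S (\<lambda>_. expo)) \<rightarrow> Pow S \<and>
       (\<forall>a\<in>Pow S. B -` {a} \<inter> space (PiM S (\<lambda>_. expo)) \<in> sets (PiM S (\<lambda>_. expo)))"
      by (auto simp: B_def vimage_def Int_def conj_commute)
  qed
  then have "(\<lambda>r. SOME x. x \<in> B r) \<in> measurable (PiM S (\<lambda>_. expo)) (count_space UNIV)"
    by (rule measurable_compose) simp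
  also have "(\<lambda>r. SOME x. x \<in> B r) = winner S w"
    by (intro ext arg_cong[of _ _ Eps])
      (auto simp: winner_def arg_min_on_def arg_min_def is_arg_min_def B_def intro!: arg_cong[of _ _ Eps])
  finally show ?thesis .
qed

text \<open>The type of states may be uncountable, so a family indexed by a random state is handled
  through the finite range of that state.\<close>

lemma measurable_compose_finite:
  assumes "finite S" and g: "g \<in> measurable M (count_space UNIV)" and gS: "\<And>x. x \<in> space M \<Longrightarrow> g x \<in> S"
    and f: "\<And>y. y \<in> S \<Longrightarrow> f y \<in> measurable M N"
  shows "(\<lambda>x. f (g x) x) \<in> measurable M N"
proof (rule measurable_compose_countable'[where I = S])
  show "g \<in> measurable M (count_space S)"
  proof (rule measurableI)
    fix A assume "A \<in> sets (count_space S)"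
    show "g -` A \<inter> space M \<in> sets M"
      using g by (rule measurable_sets) simp
  qed (use gS in auto)
qed (use assms countable_finite in auto)

lemma measurable_ring_time [measurable]:
  assumes S: "finite S" and w: "prob_dist S w"
  shows "ring_time S w \<in> borel_measurable (PiM S (\<lambda>_. expo))"
  unfolding ring_time_def
  by (rule measurable_compose_finite[where S = S and f = "\<lambda>y r. r y / w y", OF S measurable_winner[OF S]])
    (use winner_in[OF S w] in auto)

lemma measurable_next_clocks:
  assumes S: "finite S" and w: "prob_dist S w"
  shows "(\<lambda>x. next_clocks S w (fst x) (snd x)) \<in> measurable (PiM S (\<lambda>_. expo) \<Otimes>\<^sub>M expo) (PiM S (\<lambda>_. expo))"
proof -
  note [measurable] = measurable_ring_time[OF S w] measurable_winner[OF S]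
  show ?thesis unfolding next_clocks_def
  proof (rule measurable_restrict)
    fix z assume z: "z \<in> S"
    have [measurable]: "Measurable.pred (PiM S (\<lambda>_. expo) \<Otimes>\<^sub>M expo) (\<lambda>x. z = winner S w (fst x))"
      by measurable
    show "(\<lambda>x. if z = winner S w (fst x) then snd x else fst x z - ring_time S w (fst x) * w z)
      \<in> measurable (PiM S (\<lambda>_. expo) \<Otimes>\<^sub>M expo) expo"
      using z by measurable
  qed
qed

lemma measurable_insert_upd:
  assumes "S = insert y J" "f \<in> measurable N (PiM J (\<lambda>_. expo))" "g \<in> borel_measurable N"
  shows "(\<lambda>x. (f x)(y := g x)) \<in> measurable N (PiM S (\<lambda>_. expo))"
  unfolding assms(1) by (rule measurable_fun_upd[where J = J]) (use assms in auto)

text \<open>Suppose \<open>y\<close> rings at time t. Every other clock has to survive the load t *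
  w z, which costs exp (- t * w z) and leaves an Exp(1) residual. Together this is exp (- t * (1 - w
  y)), and the clock of \<open>y\<close> contributes exp (- t * w y). The product exp (- t) does not
  depend on \<open>y\<close>: the ringing time is Exp(1) and independent of the winner, and the
  Jacobian \<open>w y\<close> is the probability of winning.\<close>

lemma winner_integral:
  fixes H :: "real \<Rightarrow> ('a \<Rightarrow> real) \<Rightarrow> ennreal"
  assumes S: "finite S" and w: "prob_dist S w" and y: "y \<in> S" "0 < w y"
    and D: "D = atLeast \<or> D = greaterThan"
    and H: "case_prod H \<in> borel_measurable (borel \<Otimes>\<^sub>M PiM S (\<lambda>_. expo))"
  shows "(\<integral>\<^sup>+ a. \<integral>\<^sup>+ r. (\<Prod>z\<in>S - {y}. if 0 < w z then indicator (D (r y / w y * w z)) (r z) else 1)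
      * H (r y / w y) (\<lambda>z\<in>S. if z = y then a else r z - r y / w y * w z) \<partial>PiM S (\<lambda>_. expo) \<partial>expo)
    = ennreal (w y) * (\<integral>\<^sup>+ t. \<integral>\<^sup>+ r. H t r \<partial>PiM S (\<lambda>_. expo) \<partial>expo)"
proof -
  define J where "J = S - {y}"
  have SJ: "S = insert y J" "finite J" "y \<notin> J"
    using S y by (auto simp: J_def)
  let ?P = "PiM J (\<lambda>_. expo)" and ?R = "PiM S (\<lambda>_. expo)"
  note [measurable] = H
  have [measurable]: "(\<lambda>r. r z) \<in> borel_measurable ?R" if "z \<in> S" for z
    using that by measurable
  have [measurable]: "Measurable.pred ?R (\<lambda>r. r z \<in> D (r y / w y * w z))" if z: "z \<in> S" for z
  proof -
    have [measurable]: "(\<lambda>r. r z) \<in> borel_measurable ?R" "(\<lambda>r. r y) \<in> borel_measurable ?R"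
      using z y(1) by measurable
    have [measurable]: "(\<lambda>r. r y / w y * w z) \<in> borel_measurable ?R"
      by measurable
    have "Measurable.pred ?R (\<lambda>r. r y / w y * w z \<le> r z)"
      unfolding Measurable.pred_def by (rule borel_measurable_le) fact+
    moreover have "Measurable.pred ?R (\<lambda>r. r y / w y * w z < r z)"
      by (rule borel_measurable_pred_less) fact+
    ultimately show ?thesis using D by auto
  qed
  define E where "E z x = (if 0 < w z then D (x / w y * w z) else UNIV)" for z and x :: real
  have E: "(if 0 < w z then indicator (D (r y / w y * w z)) (r z) else 1) = (indicator (E z (r y)) (r z) :: ennreal)"
    for r z unfolding E_def by auto
  have w0: "0 \<le> w z" if "z \<in> S" for z
    using w that by (auto simp: prob_dist_def)
  have wsum: "(\<Sum>z\<in>J. w z) = 1 - w y"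
    using w SJ by (simp add: prob_dist_def)
  note [measurable (raw)] = measurable_insert_upd[OF SJ(1)]
  interpret P: prob_space ?P by (intro prob_space_PiM prob_space_expo)
  interpret R: prob_space ?R by (intro prob_space_PiM prob_space_expo)
  \<comment> \<open>The value \<open>x\<close> of the winning clock and its replacement
    \<open>a\<close> are held fixed; the average is over the residual clocks of the others.\<close>
  define G where "G a x = (\<integral>\<^sup>+ r. H (x / w y) (r(y := a)) \<partial>?P)" for a x
  have [measurable]: "(\<lambda>(a, x). G a x) \<in> borel_measurable (expo \<Otimes>\<^sub>M expo)"
    unfolding G_def by measurable
  have inner: "(\<integral>\<^sup>+ r. (\<Prod>z\<in>J. indicator (E z (r y)) (r z))
      * H (r y / w y) (\<lambda>z\<in>S. if z = y then a else r z - r y / w y * w z) \<partial>?R)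
    = (\<integral>\<^sup>+ x. ennreal (exp (- (x / w y) * (1 - w y))) * G a x \<partial>expo)" for a
  proof -
    have "(\<integral>\<^sup>+ r. (\<Prod>z\<in>J. indicator (E z (r y)) (r z))
      * H (r y / w y) (\<lambda>z\<in>S. if z = y then a else r z - r y / w y * w z) \<partial>?R)
     = (\<integral>\<^sup>+ x. \<integral>\<^sup>+ r. (\<Prod>z\<in>J. indicator (E z ((r(y := x)) y)) ((r(y := x)) z))
      * H ((r(y := x)) y / w y) (\<lambda>z\<in>S. if z = y then a else (r(y := x)) z - (r(y := x)) y / w y * w z) \<partial>?P \<partial>expo)"
      unfolding SJ(1)
    proof (rule expos.product_nn_integral_insert_rev[OF SJ(2,3)], fold SJ(1))
      have [measurable]: "(\<lambda>r. \<lambda>z\<in>S. if z = y then a else r z - r y / w y * w z) \<in> measurable ?R ?R"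
        using y by (intro measurable_restrict) auto
      have JS: "z \<in> S" if "z \<in> J" for z using that by (simp add: SJ)
      have [measurable]: "(\<lambda>r. if 0 < w z then indicator (D (r y / w y * w z)) (r z) else 1 :: ennreal) \<in> borel_measurable ?R"
        if "z \<in> J" for z
      proof (cases "0 < w z")
        case True
        have "z \<in> S" using that by (rule JS)
        then show ?thesis unfolding if_P[OF True] by measurable
      qed simp
      show "(\<lambda>r. (\<Prod>z\<in>J. indicator (E z (r y)) (r z))
        * H (r y / w y) (\<lambda>z\<in>S. if z = y then a else r z - r y / w y * w z)) \<in> borel_measurable ?R"
        unfolding E[symmetric] using y by measurable
    qed
    also have "\<dots> = (\<integral>\<^sup>+ x. ennreal (exp (- (x / w y) * (1 - w y))) * G a x \<partial>expo)"
    proof (rule nn_integral_cong_AE)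
      show "AE x in expo. (\<integral>\<^sup>+ r. (\<Prod>z\<in>J. indicator (E z ((r(y := x)) y)) ((r(y := x)) z))
          * H ((r(y := x)) y / w y) (\<lambda>z\<in>S. if z = y then a else (r(y := x)) z - (r(y := x)) y / w y * w z) \<partial>?P)
        = ennreal (exp (- (x / w y) * (1 - w y))) * G a x"
        using AE_expo_nonneg
      proof eventually_elim
        case (elim x)
        define c where "c z = x / w y * w z" for z
        have c0: "0 \<le> c z" if "z \<in> S" for z
          using elim y w0[OF that] by (simp add: c_def)
        have eq: "(\<lambda>z\<in>S. if z = y then a else (r(y := x)) z - (r(y := x)) y / w y * w z)
            = (\<lambda>z\<in>J. r z - c z)(y := a)" for r :: "'a \<Rightarrow> real"
          using SJ by (auto simp: fun_eq_iff restrict_def c_def)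
        have "(\<integral>\<^sup>+ r. (\<Prod>z\<in>J. indicator (E z ((r(y := x)) y)) ((r(y := x)) z))
          * H ((r(y := x)) y / w y) (\<lambda>z\<in>S. if z = y then a else (r(y := x)) z - (r(y := x)) y / w y * w z) \<partial>?P)
          = (\<integral>\<^sup>+ r. (\<Prod>z\<in>J. indicator (E z x) (r z)) * H (x / w y) ((\<lambda>z\<in>J. r z - c z)(y := a)) \<partial>?P)"
          unfolding eq using SJ by (intro nn_integral_cong arg_cong2[where f = "(*)"] prod.cong) auto
        also have "\<dots> = (\<Prod>z\<in>J. ennreal (exp (- c z))) * (\<integral>\<^sup>+ r. H (x / w y) (r(y := a)) \<partial>?P)"
        proof (rule prod_memoryless[OF SJ(2)])
          fix z assume z: "z \<in> J"
          then show Em: "E z x \<in> sets borel" using D by (auto simp: E_def)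
          fix K :: "real \<Rightarrow> ennreal" assume K: "K \<in> borel_measurable borel"
          show "(\<integral>\<^sup>+ u. indicator (E z x) u * K (u - c z) \<partial>expo) = ennreal (exp (- c z)) * integral\<^sup>N expo K"
          proof (cases "0 < w z")
            case True
            show ?thesis
              using z c0[of z] SJ D True by (intro expo_memoryless K Em) (auto simp: E_def c_def)
          next
            case False
            then have "w z = 0" using w0[of z] z SJ by auto
            then show ?thesis by (simp add: E_def c_def)
          qed
        next
          show "(\<lambda>r. H (x / w y) (r(y := a))) \<in> borel_measurable ?P"
            by measurable
        qed
        also have "(\<Prod>z\<in>J. ennreal (exp (- c z))) = ennreal (exp (- (x / w y) * (1 - w y)))"
          by (simp add: prod_ennreal exp_sum[OF SJ(2), symmetric] sum_negf c_def sum_distrib_left sum_divide_distrib flip: wsum)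
        finally show ?case unfolding G_def .
      qed
    qed
    finally show ?thesis .
  qed
  define F where "F t = (\<integral>\<^sup>+ r. H t r \<partial>?R)" for t
  have [measurable]: "F \<in> borel_measurable borel"
    unfolding F_def by measurable
  \<comment> \<open>The replacement \<open>a\<close> and the residual clocks over \<open>J\<close>
    make up a full vector of independent clocks over \<open>S\<close>.\<close>
  have GF: "(\<integral>\<^sup>+ a. G a x \<partial>expo) = F (x / w y)" for x
    unfolding G_def F_def SJ(1)
    by (rule expos.product_nn_integral_insert_rev[OF SJ(2,3), symmetric], fold SJ(1)) measurable
  have "(\<integral>\<^sup>+ a. \<integral>\<^sup>+ r. (\<Prod>z\<in>J. if 0 < w z then indicator (D (r y / w y * w z)) (r z) else 1)
      * H (r y / w y) (\<lambda>z\<in>S. if z = y then a else r z - r y / w y * w z) \<partial>?R \<partial>expo)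
    = (\<integral>\<^sup>+ a. \<integral>\<^sup>+ x. ennreal (exp (- (x / w y) * (1 - w y))) * G a x \<partial>expo \<partial>expo)"
    unfolding E inner ..
  also have "\<dots> = (\<integral>\<^sup>+ x. \<integral>\<^sup>+ a. ennreal (exp (- (x / w y) * (1 - w y))) * G a x \<partial>expo \<partial>expo)"
    by (rule pair_sigma_finite.Fubini') (auto intro!: pair_sigma_finite.intro expo.sigma_finite_measure_axioms)
  also have "\<dots> = (\<integral>\<^sup>+ x. ennreal (exp (- (x / w y) * (1 - w y))) * F (x / w y) \<partial>expo)"
    by (subst nn_integral_cmult) (auto simp: GF)
  also have "\<dots> = (\<integral>\<^sup>+ x. ennreal (exp (- x)) * indicator {0..} x *
      (ennreal (exp (- (x / w y) * (1 - w y))) * F (x / w y)) \<partial>lborel)"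
    by (rule nn_integral_expo) measurable
  \<comment> \<open>Change of variable from the value of the winning clock to the time at which it
    rings; the latter is the former divided by \<open>w y\<close>.\<close>
  also have "\<dots> = ennreal \<bar>w y\<bar> * (\<integral>\<^sup>+ x. ennreal (exp (- (0 + w y * x))) * indicator {0..} (0 + w y * x) *
      (ennreal (exp (- ((0 + w y * x) / w y) * (1 - w y))) * F ((0 + w y * x) / w y)) \<partial>lborel)"
    using y by (subst nn_integral_real_affine[where c = "w y" and t = 0]) auto
  also have "\<dots> = ennreal (w y) * (\<integral>\<^sup>+ x. ennreal (exp (- x)) * indicator {0..} x * F x \<partial>lborel)"
  proof (rule arg_cong2[where f = "(*)"], use y in simp, rule nn_integral_cong)
    fix x :: real
    have "exp (- (w y * x)) * exp (- x * (1 - w y)) = exp (- x)"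
      by (simp add: algebra_simps flip: exp_add)
    then have "ennreal (exp (- (w y * x))) * ennreal (exp (- x * (1 - w y))) = ennreal (exp (- x))"
      by (simp flip: ennreal_mult'')
    moreover have "indicator {0..} (w y * x) = (indicator {0..} x :: ennreal)"
      using y by (auto simp: indicator_def zero_le_mult_iff)
    ultimately show "ennreal (exp (- (0 + w y * x))) * indicator {0..} (0 + w y * x) *
      (ennreal (exp (- ((0 + w y * x) / w y) * (1 - w y))) * F ((0 + w y * x) / w y))
      = ennreal (exp (- x)) * indicator {0..} x * F x"
      using y by (simp add: mult_ac)
  qed
  also have "\<dots> = ennreal (w y) * (\<integral>\<^sup>+ t. F t \<partial>expo)"
    by (simp add: nn_integral_expo)
  finally show ?thesis by (simp add: F_def J_def)
qed

lemma prod_guarded_indicator: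
  assumes "finite A"
  shows "(\<Prod>z\<in>A. if P z then indicator (B z) (r z) else 1 :: ennreal) = (if \<forall>z\<in>A. P z \<longrightarrow> r z \<in> B z then 1 else 0)"
  using assms by (induction A rule: finite_induct) (auto simp: indicator_def)

text \<open>Ties between clocks are handled by squeezing the event that y wins between the events with
  strict and with weak inequalities, whose integrals agree.\<close>

lemma one_step:
  fixes H :: "real \<Rightarrow> 'a \<Rightarrow> ('a \<Rightarrow> real) \<Rightarrow> ennreal"
  assumes S: "finite S" and w: "prob_dist S w"
    and H: "\<And>y. y \<in> S \<Longrightarrow> (\<lambda>(t, r). H t y r) \<in> borel_measurable (borel \<Otimes>\<^sub>M PiM S (\<lambda>_. expo))"
  shows "(\<integral>\<^sup>+ a. \<integral>\<^sup>+ r. H (ring_time S w r) (winner S w r) (next_clocks S w r a) \<partial>PiM S (\<lambda>_. expo) \<partial>expo)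
    = (\<Sum>y\<in>S. ennreal (w y) * (\<integral>\<^sup>+ t. \<integral>\<^sup>+ r. H t y r \<partial>PiM S (\<lambda>_. expo) \<partial>expo))"
proof -
  let ?R = "PiM S (\<lambda>_. expo)"
  interpret R: prob_space ?R by (intro prob_space_PiM prob_space_expo)
  note [measurable] = measurable_ring_time[OF S w] measurable_winner[OF S] measurable_next_clocks[OF S w]
  define h where "h a r = H (ring_time S w r) (winner S w r) (next_clocks S w r a)" for a r
  define k where "k y D a r = (\<Prod>z\<in>S - {y}. if 0 < w z then indicator (D (r y / w y * w z)) (r z) else 1)
      * H (r y / w y) y (\<lambda>z\<in>S. if z = y then a else r z - r y / w y * w z)"
    for y D a and r :: "'a \<Rightarrow> real"
  have hm: "(\<lambda>(a, r). indicator {y} (winner S w r) * h a r) \<in> borel_measurable (expo \<Otimes>\<^sub>M ?R)" if y: "y \<in> S" for y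
  proof -
    have u: "(\<lambda>x. next_clocks S w (snd x) (fst x)) \<in> measurable (expo \<Otimes>\<^sub>M ?R) ?R"
      using measurable_compose[OF measurable_pair_swap'[of expo ?R] measurable_next_clocks[OF S w]] by (simp add: case_prod_beta)
    have "(\<lambda>x. indicator {y} (winner S w (snd x)) * H (ring_time S w (snd x)) y (next_clocks S w (snd x) (fst x)))
        \<in> borel_measurable (expo \<Otimes>\<^sub>M ?R)"
    proof (rule borel_measurable_times_ennreal)
      show "(\<lambda>x. indicator {y} (winner S w (snd x)) :: ennreal) \<in> borel_measurable (expo \<Otimes>\<^sub>M ?R)"
        by (rule measurable_compose[OF measurable_compose[OF measurable_snd measurable_winner[OF S]]]) simp
      have "(\<lambda>x. ring_time S w (snd x)) \<in> borel_measurable (expo \<Otimes>\<^sub>M ?R)"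
        by (rule measurable_compose[OF measurable_snd measurable_ring_time[OF S w]])
      from measurable_compose[OF measurable_Pair[OF this u] H[OF y]]
      show "(\<lambda>x. H (ring_time S w (snd x)) y (next_clocks S w (snd x) (fst x))) \<in> borel_measurable (expo \<Otimes>\<^sub>M ?R)"
        by simp
    qed
    also have "(\<lambda>x. indicator {y} (winner S w (snd x)) * H (ring_time S w (snd x)) y (next_clocks S w (snd x) (fst x)))
       = (\<lambda>(a, r). indicator {y} (winner S w r) * h a r)"
      by (auto simp: h_def fun_eq_iff indicator_def)
    finally show ?thesis .
  qed
  have win_le: "k y greaterThan a r \<le> indicator {y} (winner S w r) * h a r"
    "indicator {y} (winner S w r) * h a r \<le> k y atLeast a r" if y: "y \<in> S" "0 < w y" for y a r
  proof -
    have eq: "indicator {y} (winner S w r) * h a r = indicator {y} (winner S w r)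
      * H (r y / w y) y (\<lambda>z\<in>S. if z = y then a else r z - r y / w y * w z)"
      unfolding h_def next_clocks_def ring_time_def by (auto simp: indicator_def)
    have g: "(\<Prod>z\<in>S - {y}. if 0 < w z then indicator (D (r y / w y * w z)) (r z) else 1 :: ennreal)
       = (if \<forall>z\<in>S - {y}. 0 < w z \<longrightarrow> r z \<in> D (r y / w y * w z) then 1 else 0)" for D :: "real \<Rightarrow> real set"
      using S by (intro prod_guarded_indicator) simp
    have "winner S w r = y" if "\<forall>z\<in>S - {y}. 0 < w z \<longrightarrow> r z \<in> {r y / w y * w z<..}"
      using that y by (intro winner_eqI S w) (auto simp: pos_less_divide_eq)
    then show "k y greaterThan a r \<le> indicator {y} (winner S w r) * h a r"
      unfolding eq k_def g by (cases "winner S w r = y") auto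
    have "\<forall>z\<in>S - {y}. 0 < w z \<longrightarrow> r z \<in> {r y / w y * w z..}" if "winner S w r = y"
      using that ring_time_le[OF S w, of _ r] by (auto simp: ring_time_def pos_le_divide_eq)
    then show "indicator {y} (winner S w r) * h a r \<le> k y atLeast a r"
      unfolding eq k_def g by (cases "winner S w r = y") auto
  qed
  have one: "(\<integral>\<^sup>+ a. \<integral>\<^sup>+ r. indicator {y} (winner S w r) * h a r \<partial>?R \<partial>expo)
     = ennreal (w y) * (\<integral>\<^sup>+ t. \<integral>\<^sup>+ r. H t y r \<partial>?R \<partial>expo)" if y: "y \<in> S" for y
  proof (cases "0 < w y")
    case True
    have K: "(\<integral>\<^sup>+ a. \<integral>\<^sup>+ r. k y D a r \<partial>?R \<partial>expo) = ennreal (w y) * (\<integral>\<^sup>+ t. \<integral>\<^sup>+ r. H t y r \<partial>?R \<partial>expo)"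
      if "D = atLeast \<or> D = greaterThan" for D
      unfolding k_def using winner_integral[OF S w y True that H[OF y]] by simp
    show ?thesis
    proof (rule antisym)
      show "(\<integral>\<^sup>+ a. \<integral>\<^sup>+ r. indicator {y} (winner S w r) * h a r \<partial>?R \<partial>expo)
        \<le> ennreal (w y) * (\<integral>\<^sup>+ t. \<integral>\<^sup>+ r. H t y r \<partial>?R \<partial>expo)"
        unfolding K[of atLeast, simplified, symmetric] by (intro nn_integral_mono win_le y True)
      show "ennreal (w y) * (\<integral>\<^sup>+ t. \<integral>\<^sup>+ r. H t y r \<partial>?R \<partial>expo)
        \<le> (\<integral>\<^sup>+ a. \<integral>\<^sup>+ r. indicator {y} (winner S w r) * h a r \<partial>?R \<partial>expo)"
        unfolding K[of greaterThan, simplified, symmetric] by (intro nn_integral_mono win_le y True)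
    qed
  next
    case False
    then have "winner S w r \<noteq> y" for r using winner_in[OF S w, of r] by auto
    moreover have "w y = 0" using False w y by (auto simp: prob_dist_def antisym)
    ultimately show ?thesis by simp
  qed
  have "(\<integral>\<^sup>+ a. \<integral>\<^sup>+ r. h a r \<partial>?R \<partial>expo) = (\<integral>\<^sup>+ a. \<integral>\<^sup>+ r. (\<Sum>y\<in>S. indicator {y} (winner S w r) * h a r) \<partial>?R \<partial>expo)"
    using S winner_in[OF S w] by (intro nn_integral_cong) (simp add: indicator_def if_distrib cong: if_cong flip: sum_distrib_right)
  also have "\<dots> = (\<Sum>y\<in>S. \<integral>\<^sup>+ a. \<integral>\<^sup>+ r. indicator {y} (winner S w r) * h a r \<partial>?R \<partial>expo)"
  proof -
    have m1: "(\<lambda>r. indicator {y} (winner S w r) * h a r) \<in> borel_measurable ?R" if "y \<in> S" for y a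
      using measurable_Pair2[OF hm[OF that], of a] by simp
    have m2: "(\<lambda>a. \<integral>\<^sup>+ r. indicator {y} (winner S w r) * h a r \<partial>?R) \<in> borel_measurable expo" if "y \<in> S" for y
      using R.borel_measurable_nn_integral[OF hm[OF that]] .
    show ?thesis
      by (simp add: nn_integral_sum[OF m1] nn_integral_sum[OF m2])
  qed
  also have "\<dots> = (\<Sum>y\<in>S. ennreal (w y) * (\<integral>\<^sup>+ t. \<integral>\<^sup>+ r. H t y r \<partial>?R \<partial>expo))"
    by (intro sum.cong one refl)
  finally show ?thesis by (simp add: h_def)
qed

section \<open>Sequences of independent exponential variables\<close>

interpretation seq: sequence_space expo
  by unfold_locales

lemma nn_integral_seq_Suc:
  assumes [measurable]: "f \<in> borel_measurable (PiM UNIV (\<lambda>_::nat. expo))"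
  shows "(\<integral>\<^sup>+ a. f a \<partial>PiM UNIV (\<lambda>_. expo))
    = (\<integral>\<^sup>+ x. \<integral>\<^sup>+ a. f (case_nat x a) \<partial>PiM UNIV (\<lambda>_. expo) \<partial>expo)"
proof -
  let ?W = "PiM UNIV (\<lambda>_::nat. expo)"
  have m: "(\<lambda>(s, \<omega>). case_nat s \<omega>) \<in> measurable (expo \<Otimes>\<^sub>M ?W) ?W"
    unfolding case_prod_beta by (rule measurable_case_nat') auto
  have "(\<integral>\<^sup>+ a. f a \<partial>?W) = (\<integral>\<^sup>+ a. f a \<partial>distr (expo \<Otimes>\<^sub>M ?W) ?W (\<lambda>(s, \<omega>). case_nat s \<omega>))"
    by (simp add: seq.PiM_iter)
  also have "\<dots> = (\<integral>\<^sup>+ p. f (case_nat (fst p) (snd p)) \<partial>(expo \<Otimes>\<^sub>M ?W))"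
    by (subst nn_integral_distr[OF m]) (auto simp: case_prod_beta)
  also have "\<dots> = (\<integral>\<^sup>+ x. \<integral>\<^sup>+ a. f (case_nat x a) \<partial>?W \<partial>expo)"
    by (subst seq.P.nn_integral_fst[symmetric]) auto
  finally show ?thesis .
qed

section \<open>The chain driven by the race\<close>

text \<open>The recursion peels off the first step and not the last: after one race the row of the
  winner, the updated clocks and the rest of the supply \<open>a\<close> are the data of a chain of
  the same kind, which is what an induction by \<open>one_step\<close> needs.\<close>

fun chain_state :: "'a set \<Rightarrow> ('a \<Rightarrow> 'a \<Rightarrow> real) \<Rightarrow> ('a \<Rightarrow> real) \<Rightarrow> ('a \<Rightarrow> real) \<Rightarrow> (nat \<Rightarrow> real) \<Rightarrow> nat \<Rightarrow> 'a" where
  "chain_state S p w r a 0 = winner S w r"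
| "chain_state S p w r a (Suc n) = chain_state S p (p (winner S w r)) (next_clocks S w r (a 0)) (\<lambda>i. a (Suc i)) n"

fun chain_gap :: "'a set \<Rightarrow> ('a \<Rightarrow> 'a \<Rightarrow> real) \<Rightarrow> ('a \<Rightarrow> real) \<Rightarrow> ('a \<Rightarrow> real) \<Rightarrow> (nat \<Rightarrow> real) \<Rightarrow> nat \<Rightarrow> real" where
  "chain_gap S p w r a 0 = ring_time S w r"
| "chain_gap S p w r a (Suc n) = chain_gap S p (p (winner S w r)) (next_clocks S w r (a 0)) (\<lambda>i. a (Suc i)) n"

text \<open>The vector of rates used in step n, so that index 0 refers to the initial distribution.\<close>

fun chain_rate :: "'a set \<Rightarrow> ('a \<Rightarrow> 'a \<Rightarrow> real) \<Rightarrow> ('a \<Rightarrow> real) \<Rightarrow> ('a \<Rightarrow> real) \<Rightarrow> (nat \<Rightarrow> real) \<Rightarrow> nat \<Rightarrow> 'a \<Rightarrow> real" where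
  "chain_rate S p w r a 0 = w"
| "chain_rate S p w r a (Suc n) = p (chain_state S p w r a n)"

lemma chain_rate_Suc_shift:
  "chain_rate S p w r a (Suc n) = chain_rate S p (p (winner S w r)) (next_clocks S w r (a 0)) (\<lambda>i. a (Suc i)) n"
  by (cases n) simp_all

text \<open>Products with one factor per step are the only test functions needed: indicators of
  states give the law of the chain, exponentials of gaps and loads give the exponential
  moments.\<close>

fun path_weight :: "'a set \<Rightarrow> ('a \<Rightarrow> 'a \<Rightarrow> real) \<Rightarrow> nat \<Rightarrow> (nat \<Rightarrow> ('a \<Rightarrow> real) \<Rightarrow> real \<Rightarrow> 'a \<Rightarrow> ennreal)
    \<Rightarrow> ('a \<Rightarrow> real) \<Rightarrow> ('a \<Rightarrow> real) \<Rightarrow> (nat \<Rightarrow> real) \<Rightarrow> ennreal" where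
  "path_weight S p 0 \<psi> w r a = 1"
| "path_weight S p (Suc n) \<psi> w r a = \<psi> 0 w (ring_time S w r) (winner S w r)
     * path_weight S p n (\<lambda>i. \<psi> (Suc i)) (p (winner S w r)) (next_clocks S w r (a 0)) (\<lambda>i. a (Suc i))"

lemma path_weight_eq: "path_weight S p n \<psi> w r a = (\<Prod>i<n. \<psi> i (chain_rate S p w r a i) (chain_gap S p w r a i) (chain_state S p w r a i))"
proof (induction n arbitrary: \<psi> w r a)
  case (Suc n)
  show ?case
    unfolding prod.lessThan_Suc_shift by (simp add: Suc chain_rate_Suc_shift del: chain_rate.simps(2))
qed simp

text \<open>This is the expectation for a process in which each gap is Exp(1) and independent of
  everything else, while the state is drawn from \<open>w\<close> and its row becomes the next rate
  vector.\<close>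

fun path_expectation :: "'a set \<Rightarrow> ('a \<Rightarrow> 'a \<Rightarrow> real) \<Rightarrow> nat \<Rightarrow> (nat \<Rightarrow> ('a \<Rightarrow> real) \<Rightarrow> real \<Rightarrow> 'a \<Rightarrow> ennreal) \<Rightarrow> ('a \<Rightarrow> real) \<Rightarrow> ennreal" where
  "path_expectation S p 0 \<psi> w = 1"
| "path_expectation S p (Suc n) \<psi> w = (\<Sum>y\<in>S. ennreal (w y) * ((\<integral>\<^sup>+ t. \<psi> 0 w t y \<partial>expo) * path_expectation S p n (\<lambda>i. \<psi> (Suc i)) (p y)))"

lemma stochastic_prob_dist: "stochastic S p \<Longrightarrow> y \<in> S \<Longrightarrow> prob_dist S (p y)"
  by (simp add: stochastic_def prob_dist_def)

abbreviation "clock_space S \<equiv> PiM S (\<lambda>_. expo)"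
abbreviation "clock_seq \<equiv> PiM (UNIV :: nat set) (\<lambda>_. expo)"

lemma measurable_step:
  assumes S: "finite S" and w: "prob_dist S w"
    and g: "\<And>y. y \<in> S \<Longrightarrow> g y \<in> measurable (clock_space S \<Otimes>\<^sub>M clock_seq) N"
  shows "(\<lambda>x. g (winner S w (fst x)) (next_clocks S w (fst x) (snd x 0), \<lambda>i. snd x (Suc i))) \<in> measurable (clock_space S \<Otimes>\<^sub>M clock_seq) N"
proof (rule measurable_compose_finite[where f = "\<lambda>y x. g y (next_clocks S w (fst x) (snd x 0), \<lambda>i. snd x (Suc i))", OF S])
  show "(\<lambda>x. winner S w (fst x)) \<in> measurable (clock_space S \<Otimes>\<^sub>M clock_seq) (count_space UNIV)"
    by (rule measurable_compose[OF measurable_fst measurable_winner[OF S]])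
  show "winner S w (fst x) \<in> S" for x by (rule winner_in[OF S w])
  have a: "(\<lambda>x. (fst x, snd x 0)) \<in> measurable (clock_space S \<Otimes>\<^sub>M clock_seq) (clock_space S \<Otimes>\<^sub>M expo)"
    by (intro measurable_Pair measurable_fst measurable_compose[OF measurable_snd measurable_component_singleton]) simp
  have u: "(\<lambda>x. next_clocks S w (fst x) (snd x 0)) \<in> measurable (clock_space S \<Otimes>\<^sub>M clock_seq) (clock_space S)"
    using measurable_compose[OF a measurable_next_clocks[OF S w]] by simp
  have s: "(\<lambda>x. \<lambda>i. snd x (Suc i)) \<in> measurable (clock_space S \<Otimes>\<^sub>M clock_seq) clock_seq"
    by (intro measurable_PiM_single' measurable_compose[OF measurable_snd measurable_component_singleton]) auto
  show "(\<lambda>x. g y (next_clocks S w (fst x) (snd x 0), \<lambda>i. snd x (Suc i))) \<in> measurable (clock_space S \<Otimes>\<^sub>M clock_seq) N" if "y \<in> S" for y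
    by (rule measurable_compose[OF measurable_Pair[OF u s] g[OF that]])
qed

section \<open>Measurability and joint law of gaps and states\<close>

context
  fixes S :: "'a set" and p
  assumes S: "finite S" and p: "stochastic S p"
begin

lemma chain_state_in: "prob_dist S w \<Longrightarrow> chain_state S p w r a n \<in> S"
proof (induction n arbitrary: w r a)
  case (Suc n)
  then show ?case using stochastic_prob_dist[OF p] winner_in(1)[OF S] by simp
qed (simp add: winner_in[OF S])

lemma prob_dist_chain_rate: "prob_dist S w \<Longrightarrow> prob_dist S (chain_rate S p w r a n)"
  by (cases n) (auto intro: stochastic_prob_dist[OF p] chain_state_in)

lemma measurable_chain_state:
  "prob_dist S w \<Longrightarrow> (\<lambda>x. chain_state S p w (fst x) (snd x) n) \<in> measurable (clock_space S \<Otimes>\<^sub>M clock_seq) (count_space UNIV)"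
proof (induction n arbitrary: w)
  case 0
  show ?case using measurable_compose[OF measurable_fst measurable_winner[OF S]] by simp
next
  case (Suc n)
  from measurable_step[OF S Suc.prems Suc.IH[OF stochastic_prob_dist[OF p]]]
  show ?case by simp
qed

lemma measurable_chain_gap:
  "prob_dist S w \<Longrightarrow> (\<lambda>x. chain_gap S p w (fst x) (snd x) n) \<in> borel_measurable (clock_space S \<Otimes>\<^sub>M clock_seq)"
proof (induction n arbitrary: w)
  case 0
  show ?case using measurable_compose[OF measurable_fst measurable_ring_time[OF S 0]] by simp
next
  case (Suc n)
  from measurable_step[OF S Suc.prems Suc.IH[OF stochastic_prob_dist[OF p]]]
  show ?case by simp
qed

lemma measurable_chain_rate:
  assumes w: "prob_dist S w"
  shows "(\<lambda>x. chain_rate S p w (fst x) (snd x) n z) \<in> borel_measurable (clock_space S \<Otimes>\<^sub>M clock_seq)"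
proof (cases n)
  case (Suc m)
  then show ?thesis using measurable_compose[OF measurable_chain_state[OF w, of m], of "\<lambda>y. p y z" borel] by simp
qed simp

lemma measurable_path_weight:
  assumes "\<And>i w y. prob_dist S w \<Longrightarrow> y \<in> S \<Longrightarrow> (\<lambda>t. \<psi> i w t y) \<in> borel_measurable borel" "prob_dist S w"
  shows "(\<lambda>x. path_weight S p n \<psi> w (fst x) (snd x)) \<in> borel_measurable (clock_space S \<Otimes>\<^sub>M clock_seq)"
  using assms
proof (induction n arbitrary: w \<psi>)
  case (Suc n)
  have "(\<lambda>x. \<psi> 0 w (ring_time S w (fst x)) (winner S w (fst x))) \<in> borel_measurable (clock_space S \<Otimes>\<^sub>M clock_seq)"
  proof (rule measurable_compose_finite[where S = S and f = "\<lambda>y x. \<psi> 0 w (ring_time S w (fst x)) y", OF S])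
    show "(\<lambda>x. winner S w (fst x)) \<in> measurable (clock_space S \<Otimes>\<^sub>M clock_seq) (count_space UNIV)"
      by (rule measurable_compose[OF measurable_fst measurable_winner[OF S]])
    show "(\<lambda>x. \<psi> 0 w (ring_time S w (fst x)) y) \<in> borel_measurable (clock_space S \<Otimes>\<^sub>M clock_seq)" if y: "y \<in> S" for y
      by (rule measurable_compose[OF measurable_compose[OF measurable_fst measurable_ring_time[OF S Suc.prems(2)]] Suc.prems(1)[OF Suc.prems(2) y]])
  qed (use winner_in[OF S Suc.prems(2)] in auto)
  moreover have "(\<lambda>x. path_weight S p n (\<lambda>i. \<psi> (Suc i)) (p y) (fst x) (snd x)) \<in> borel_measurable (clock_space S \<Otimes>\<^sub>M clock_seq)" if "y \<in> S" for y
    using Suc.prems(1) stochastic_prob_dist[OF p that] by (rule Suc.IH)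
  from measurable_step[OF S Suc.prems(2) this]
  have "(\<lambda>x. path_weight S p n (\<lambda>i. \<psi> (Suc i)) (p (winner S w (fst x))) (next_clocks S w (fst x) (snd x 0)) (\<lambda>i. snd x (Suc i)))
    \<in> borel_measurable (clock_space S \<Otimes>\<^sub>M clock_seq)"
    by simp
  ultimately show ?case by simp
qed simp

text \<open>Whatever the first gap and winner were, \<open>one_step\<close> makes the updated clock
  vector distributed like the initial one, so the induction hypothesis applies to the remaining
  chain, started at the row of the winner.\<close>

lemma nn_integral_path_weight:
  assumes "\<And>i w y. prob_dist S w \<Longrightarrow> y \<in> S \<Longrightarrow> (\<lambda>t. \<psi> i w t y) \<in> borel_measurable borel" "prob_dist S w"
  shows "(\<integral>\<^sup>+ r. \<integral>\<^sup>+ a. path_weight S p n \<psi> w r a \<partial>clock_seq \<partial>clock_space S) = path_expectation S p n \<psi> w"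
  using assms
proof (induction n arbitrary: w \<psi>)
  case 0
  interpret R: prob_space "clock_space S" by (intro prob_space_PiM prob_space_expo)
  show ?case using R.emeasure_space_1 seq.P.emeasure_space_1 by simp
next
  case (Suc n)
  interpret R: prob_space "clock_space S" by (intro prob_space_PiM prob_space_expo)
  note w = Suc.prems(2)
  \<comment> \<open>The average is over the fresh clocks after the first one; the first enters
    through the updated clock vector \<open>r\<close>.\<close>
  define H where "H t y r = \<psi> 0 w t y * (\<integral>\<^sup>+ a. path_weight S p n (\<lambda>i. \<psi> (Suc i)) (p y) r a \<partial>clock_seq)" for t y r
  have pm: "(\<lambda>x. path_weight S p n (\<lambda>i. \<psi> (Suc i)) (p y) (fst x) (snd x)) \<in> borel_measurable (clock_space S \<Otimes>\<^sub>M clock_seq)" if "y \<in> S" for y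
    using Suc.prems(1) stochastic_prob_dist[OF p that] by (rule measurable_path_weight)
  have im: "(\<lambda>r. \<integral>\<^sup>+ a. path_weight S p n (\<lambda>i. \<psi> (Suc i)) (p y) r a \<partial>clock_seq) \<in> borel_measurable (clock_space S)" if "y \<in> S" for y
    using pm[OF that] by (intro seq.P.borel_measurable_nn_integral) (simp add: case_prod_beta)
  have \<psi>m: "(\<lambda>t. \<psi> 0 w t y) \<in> borel_measurable borel" if "y \<in> S" for y
    by (rule Suc.prems(1)[OF w that])
  have Hm: "(\<lambda>(t, r). H t y r) \<in> borel_measurable (borel \<Otimes>\<^sub>M clock_space S)" if y: "y \<in> S" for y
    unfolding H_def case_prod_beta
    by (intro borel_measurable_times_ennreal measurable_compose[OF measurable_fst \<psi>m[OF y]]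
        measurable_compose[OF measurable_snd im[OF y]])
  have am: "(\<lambda>a. path_weight S p n (\<lambda>i. \<psi> (Suc i)) (p y) r a) \<in> borel_measurable clock_seq" if "r \<in> space (clock_space S)" "y \<in> S" for r y
    using measurable_Pair2[OF pm[OF that(2)] that(1)] by simp
  have ur: "next_clocks S w r x \<in> space (clock_space S)" for r x
    by (simp add: next_clocks_def space_PiM)
  have "(\<integral>\<^sup>+ r. \<integral>\<^sup>+ a. path_weight S p (Suc n) \<psi> w r a \<partial>clock_seq \<partial>clock_space S)
    = (\<integral>\<^sup>+ r. \<integral>\<^sup>+ x. H (ring_time S w r) (winner S w r) (next_clocks S w r x) \<partial>expo \<partial>clock_space S)"
  proof (rule nn_integral_cong)
    fix r assume r: "r \<in> space (clock_space S)"
    have "(\<lambda>a. path_weight S p (Suc n) \<psi> w r a) \<in> borel_measurable clock_seq"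
      using measurable_Pair2[OF measurable_path_weight[where n = "Suc n", OF Suc.prems] r] by simp
    then have "(\<integral>\<^sup>+ a. path_weight S p (Suc n) \<psi> w r a \<partial>clock_seq)
      = (\<integral>\<^sup>+ x. \<integral>\<^sup>+ a. path_weight S p (Suc n) \<psi> w r (case_nat x a) \<partial>clock_seq \<partial>expo)"
      by (rule nn_integral_seq_Suc)
    also have "\<dots> = (\<integral>\<^sup>+ x. H (ring_time S w r) (winner S w r) (next_clocks S w r x) \<partial>expo)"
      unfolding H_def
      by (intro nn_integral_cong) (simp add: nn_integral_cmult[OF am[OF ur winner_in(1)[OF S w]]])
    finally show "(\<integral>\<^sup>+ a. path_weight S p (Suc n) \<psi> w r a \<partial>clock_seq) = (\<integral>\<^sup>+ x. H (ring_time S w r) (winner S w r) (next_clocks S w r x) \<partial>expo)" .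
  qed
  also have "\<dots> = (\<integral>\<^sup>+ x. \<integral>\<^sup>+ r. H (ring_time S w r) (winner S w r) (next_clocks S w r x) \<partial>clock_space S \<partial>expo)"
  proof (rule pair_sigma_finite.Fubini')
    show "pair_sigma_finite expo (clock_space S)"
      by (intro pair_sigma_finite.intro expo.sigma_finite_measure_axioms R.sigma_finite_measure_axioms)
    have u: "(\<lambda>x. next_clocks S w (snd x) (fst x)) \<in> measurable (expo \<Otimes>\<^sub>M clock_space S) (clock_space S)"
      using measurable_compose[OF measurable_pair_swap'[of expo "clock_space S"] measurable_next_clocks[OF S w]] by (simp add: case_prod_beta)
    have "(\<lambda>x. H (ring_time S w (snd x)) (winner S w (snd x)) (next_clocks S w (snd x) (fst x))) \<in> borel_measurable (expo \<Otimes>\<^sub>M clock_space S)"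
    proof (rule measurable_compose_finite[where S = S and f = "\<lambda>y x. H (ring_time S w (snd x)) y (next_clocks S w (snd x) (fst x))", OF S])
      show "(\<lambda>x. winner S w (snd x)) \<in> measurable (expo \<Otimes>\<^sub>M clock_space S) (count_space UNIV)"
        by (rule measurable_compose[OF measurable_snd measurable_winner[OF S]])
      show "(\<lambda>x. H (ring_time S w (snd x)) y (next_clocks S w (snd x) (fst x))) \<in> borel_measurable (expo \<Otimes>\<^sub>M clock_space S)" if y: "y \<in> S" for y
        using measurable_compose[OF measurable_Pair[OF measurable_compose[OF measurable_snd measurable_ring_time[OF S w]] u] Hm[OF y]]
        by simp
    qed (use winner_in[OF S w] in auto)
    then show "(\<lambda>(x, r). H (ring_time S w r) (winner S w r) (next_clocks S w r x)) \<in> borel_measurable (expo \<Otimes>\<^sub>M clock_space S)"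
      by (simp add: case_prod_beta)
  qed
  also have "\<dots> = (\<Sum>y\<in>S. ennreal (w y) * (\<integral>\<^sup>+ t. \<integral>\<^sup>+ r. H t y r \<partial>clock_space S \<partial>expo))"
    by (rule one_step[OF S w Hm])
  also have "\<dots> = path_expectation S p (Suc n) \<psi> w"
    unfolding path_expectation.simps
  proof (intro sum.cong refl arg_cong[where f = "(*) _"])
    fix y assume y: "y \<in> S"
    have "(\<integral>\<^sup>+ r. \<integral>\<^sup>+ a. path_weight S p n (\<lambda>i. \<psi> (Suc i)) (p y) r a \<partial>clock_seq \<partial>clock_space S) = path_expectation S p n (\<lambda>i. \<psi> (Suc i)) (p y)"
      by (intro Suc.IH Suc.prems(1) stochastic_prob_dist[OF p y])
    then show "(\<integral>\<^sup>+ t. \<integral>\<^sup>+ r. H t y r \<partial>clock_space S \<partial>expo) = (\<integral>\<^sup>+ t. \<psi> 0 w t y \<partial>expo) * path_expectation S p n (\<lambda>i. \<psi> (Suc i)) (p y)"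
      unfolding H_def using im[OF y] \<psi>m[OF y] by (simp add: nn_integral_cmult nn_integral_multc)
  qed
  finally show ?case .
qed

section \<open>The load of a state against its initial clock\<close>

lemma ring_time_mult_le:
  assumes w: "prob_dist S w" and z: "z \<in> S" and r: "0 \<le> r z"
  shows "ring_time S w r * w z \<le> r z"
proof (cases "0 < w z")
  case True
  then show ?thesis using ring_time_le[OF S w z True, of r] by (simp add: pos_le_divide_eq)
next
  case False
  then have "w z = 0" using w z by (auto simp: prob_dist_def antisym)
  then show ?thesis using r by simp
qed

lemma next_clocks_nonneg:
  assumes "prob_dist S w" "z \<in> S" "0 \<le> r z" "0 \<le> a"
  shows "0 \<le> next_clocks S w r a z"
  using ring_time_mult_le[of w z r] assms by (simp add: next_clocks_def)

lemma chain_gap_nonneg: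
  assumes "prob_dist S w" "\<And>z. z \<in> S \<Longrightarrow> 0 \<le> r z" "\<And>i. 0 \<le> a i"
  shows "0 \<le> chain_gap S p w r a n"
  using assms
proof (induction n arbitrary: w r a)
  case 0
  then show ?case using winner_in[OF S 0(1), of r] by (simp add: ring_time_def)
next
  case (Suc n)
  then show ?case
    using stochastic_prob_dist[OF p winner_in(1)[OF S Suc.prems(1)]] by (simp add: Suc.IH next_clocks_nonneg)
qed

text \<open>When \<open>z\<close> wins for the first time, its load equals its initial clock
  exactly. Later terms only increase the load, since gaps and rates are nonnegative.\<close>

lemma visited_imp_le:
  assumes "prob_dist S w" "\<And>z. z \<in> S \<Longrightarrow> 0 \<le> r z" "\<And>i. 0 \<le> a i" "z \<in> chain_state S p w r a ` {..n}"
  shows "r z \<le> (\<Sum>i\<le>n. chain_gap S p w r a i * chain_rate S p w r a i z)"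
  using assms
proof (induction n arbitrary: w r a)
  case 0
  then show ?case using winner_in[OF S 0(1), of r] by (simp add: ring_time_def)
next
  case (Suc n)
  have z: "z \<in> S" using Suc.prems(4) chain_state_in[OF Suc.prems(1)] by auto
  show ?case
  proof (cases "z = winner S w r")
    case True
    have "r z = chain_gap S p w r a 0 * chain_rate S p w r a 0 z"
      using True winner_in[OF S Suc.prems(1), of r] by (simp add: ring_time_def)
    also have "\<dots> \<le> (\<Sum>i\<le>Suc n. chain_gap S p w r a i * chain_rate S p w r a i z)"
      using z chain_gap_nonneg[OF Suc.prems(1-3)] prob_dist_chain_rate[OF Suc.prems(1)]
      by (intro member_le_sum[where f = "\<lambda>i. chain_gap S p w r a i * chain_rate S p w r a i z"] mult_nonneg_nonneg) (auto simp: prob_dist_def)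
    finally show ?thesis .
  next
    case False
    obtain m where m: "m \<le> Suc n" "z = chain_state S p w r a m" using Suc.prems(4) by auto
    with False obtain k where k: "m = Suc k" "k \<le> n" by (cases m) auto
    have "z \<in> chain_state S p (p (winner S w r)) (next_clocks S w r (a 0)) (\<lambda>i. a (Suc i)) ` {..n}"
      using m k by auto
    then have "next_clocks S w r (a 0) z \<le> (\<Sum>i\<le>n. chain_gap S p w r a (Suc i) * chain_rate S p w r a (Suc i) z)"
      unfolding chain_rate_Suc_shift chain_gap.simps using Suc.prems
      by (intro Suc.IH stochastic_prob_dist[OF p winner_in(1)[OF S Suc.prems(1)]] next_clocks_nonneg) auto
    moreover have "next_clocks S w r (a 0) z = r z - ring_time S w r * w z"
      using False z by (simp add: next_clocks_def)
    ultimately show ?thesis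
      unfolding sum.atMost_Suc_shift by simp
  qed
qed

text \<open>As long as \<open>z\<close> has not won, its residual clock is the initial clock minus
  the load, and a race never makes a residual clock negative.\<close>

lemma not_visited_imp_ge:
  assumes "prob_dist S w" "z \<in> S" "0 \<le> r z" "z \<notin> chain_state S p w r a ` {..n}"
  shows "(\<Sum>i\<le>n. chain_gap S p w r a i * chain_rate S p w r a i z) \<le> r z"
  using assms
proof (induction n arbitrary: w r a)
  case 0
  then show ?case using ring_time_mult_le by simp
next
  case (Suc n)
  note w = Suc.prems(1)
  have nw: "z \<noteq> winner S w r" using Suc.prems(4) by (force simp: image_iff)
  have u: "next_clocks S w r (a 0) z = r z - ring_time S w r * w z" using nw Suc.prems(2) by (simp add: next_clocks_def)
  have "0 \<le> next_clocks S w r (a 0) z"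
    using ring_time_mult_le[of w z r] Suc.prems by (simp add: u)
  moreover have "z \<notin> chain_state S p (p (winner S w r)) (next_clocks S w r (a 0)) (\<lambda>i. a (Suc i)) ` {..n}"
    using Suc.prems(4) by (force simp: image_iff Suc_le_mono)
  ultimately have "(\<Sum>i\<le>n. chain_gap S p w r a (Suc i) * chain_rate S p w r a (Suc i) z) \<le> r z - ring_time S w r * w z"
    unfolding chain_rate_Suc_shift chain_gap.simps u[symmetric]
    by (intro Suc.IH stochastic_prob_dist[OF p winner_in(1)[OF S w]] Suc.prems(2))
  then show ?case
    unfolding sum.atMost_Suc_shift by simp
qed

end

section \<open>Realisation on a sequence of exponential variables\<close>

definition initial_clocks :: "'a set \<Rightarrow> ('a \<Rightarrow> nat) \<Rightarrow> (nat \<Rightarrow> real) \<Rightarrow> 'a \<Rightarrow> real" where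
  "initial_clocks S h \<omega> = (\<lambda>z\<in>S. \<omega> (h z))"

text \<open>Coordinates below N hold the initial clocks; the parities b = 0 and b = 1 of the remaining ones
  give two independent supplies of fresh_clocks clocks.\<close>

definition fresh_clocks :: "nat \<Rightarrow> nat \<Rightarrow> (nat \<Rightarrow> real) \<Rightarrow> nat \<Rightarrow> real" where
  "fresh_clocks N b \<omega> = (\<lambda>i. \<omega> (N + 2 * i + b))"

lemma measurable_initial_clocks: "initial_clocks S h \<in> measurable clock_seq (clock_space S)"
  unfolding initial_clocks_def by (intro measurable_restrict measurable_component_singleton) simp

lemma measurable_fresh_clocks: "fresh_clocks N b \<in> measurable clock_seq clock_seq"
  unfolding fresh_clocks_def by (intro measurable_PiM_single' measurable_component_singleton) auto

lemma measurable_initial_fresh_clocks: "(\<lambda>\<omega>. (initial_clocks S h \<omega>, fresh_clocks N b \<omega>)) \<in> measurable clock_seq (clock_space S \<Otimes>\<^sub>M clock_seq)"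
  by (intro measurable_Pair measurable_initial_clocks measurable_fresh_clocks)

text \<open>The two arguments of \<open>G\<close> read disjoint coordinates, \<open>h z < N\<close>
  and \<open>N + 2 * i + b\<close>. The sequence is cut at \<open>N\<close> into two independent
  sequences, and each is reindexed by an injection.\<close>

lemma nn_integral_initial_fresh_clocks:
  assumes h: "inj_on h S" "h ` S \<subseteq> {..<N}"
    and G: "G \<in> borel_measurable (clock_space S \<Otimes>\<^sub>M clock_seq)"
  shows "(\<integral>\<^sup>+ \<omega>. G (initial_clocks S h \<omega>, fresh_clocks N b \<omega>) \<partial>clock_seq) = (\<integral>\<^sup>+ r. \<integral>\<^sup>+ a. G (r, a) \<partial>clock_seq \<partial>clock_space S)"
proof -
  have m: "(\<lambda>(\<omega>, \<omega>'). comb_seq N \<omega> \<omega>') \<in> measurable (clock_seq \<Otimes>\<^sub>M clock_seq) clock_seq"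
    by (rule measurable_comb_seq)
  have Gm: "(\<lambda>\<omega>. G (initial_clocks S h \<omega>, fresh_clocks N b \<omega>)) \<in> borel_measurable clock_seq"
    using measurable_compose[OF measurable_initial_fresh_clocks G] .
  define s where "s \<omega> = (\<lambda>i::nat. \<omega> (2 * i + b) :: real)" for \<omega>
  have sm: "s \<in> measurable clock_seq clock_seq"
    unfolding s_def by (intro measurable_PiM_single' measurable_component_singleton) auto
  have ds: "distr clock_seq clock_seq s = clock_seq"
    using distr_PiM_reindex[of UNIV "\<lambda>_::nat. expo" "\<lambda>i. 2 * i + b" UNIV] prob_space_expo
    by (simp add: s_def[abs_def] inj_on_def restrict_UNIV)
  have dc: "distr clock_seq (clock_space S) (initial_clocks S h) = clock_space S"
    using distr_PiM_reindex[of UNIV "\<lambda>_::nat. expo" h S] prob_space_expo h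
    by (simp add: initial_clocks_def[abs_def])
  have cs: "initial_clocks S h (comb_seq N \<omega> \<omega>') = initial_clocks S h \<omega>" "fresh_clocks N b (comb_seq N \<omega> \<omega>') = s \<omega>'" for \<omega> \<omega>'
  proof -
    show "initial_clocks S h (comb_seq N \<omega> \<omega>') = initial_clocks S h \<omega>"
      unfolding initial_clocks_def by (rule restrict_ext) (use h in \<open>auto simp: comb_seq_def\<close>)
    show "fresh_clocks N b (comb_seq N \<omega> \<omega>') = s \<omega>'"
      by (simp add: fresh_clocks_def s_def comb_seq_def)
  qed
  have GP: "(\<lambda>a. G (r, a)) \<in> borel_measurable clock_seq" if "r \<in> space (clock_space S)" for r
    using measurable_Pair2[OF G that] .
  have "(\<integral>\<^sup>+ \<omega>. G (initial_clocks S h \<omega>, fresh_clocks N b \<omega>) \<partial>clock_seq)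
      = (\<integral>\<^sup>+ \<omega>. G (initial_clocks S h \<omega>, fresh_clocks N b \<omega>) \<partial>distr (clock_seq \<Otimes>\<^sub>M clock_seq) clock_seq (\<lambda>(\<omega>, \<omega>'). comb_seq N \<omega> \<omega>'))"
    by (simp add: seq.PiM_comb_seq)
  also have "\<dots> = (\<integral>\<^sup>+ p. G (initial_clocks S h (fst p), s (snd p)) \<partial>(clock_seq \<Otimes>\<^sub>M clock_seq))"
    by (subst nn_integral_distr[OF m]) (use Gm in \<open>auto simp: case_prod_beta cs\<close>)
  also have "\<dots> = (\<integral>\<^sup>+ \<omega>. \<integral>\<^sup>+ \<omega>'. G (initial_clocks S h \<omega>, s \<omega>') \<partial>clock_seq \<partial>clock_seq)"
  proof (subst seq.P.nn_integral_fst[symmetric])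
    show "(\<lambda>p. G (initial_clocks S h (fst p), s (snd p))) \<in> borel_measurable (clock_seq \<Otimes>\<^sub>M clock_seq)"
      by (rule measurable_compose[OF measurable_Pair[OF measurable_compose[OF measurable_fst measurable_initial_clocks]
            measurable_compose[OF measurable_snd sm]] G])
  qed simp
  also have "\<dots> = (\<integral>\<^sup>+ \<omega>. \<integral>\<^sup>+ a. G (initial_clocks S h \<omega>, a) \<partial>clock_seq \<partial>clock_seq)"
  proof (rule nn_integral_cong)
    fix \<omega> :: "nat \<Rightarrow> real" assume "\<omega> \<in> space clock_seq"
    have c: "initial_clocks S h \<omega> \<in> space (clock_space S)" by (simp add: initial_clocks_def space_PiM)
    have "(\<integral>\<^sup>+ \<omega>'. G (initial_clocks S h \<omega>, s \<omega>') \<partial>clock_seq) = (\<integral>\<^sup>+ a. G (initial_clocks S h \<omega>, a) \<partial>distr clock_seq clock_seq s)"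
      by (subst nn_integral_distr[OF sm]) (use GP[OF c] in auto)
    then show "(\<integral>\<^sup>+ \<omega>'. G (initial_clocks S h \<omega>, s \<omega>') \<partial>clock_seq) = (\<integral>\<^sup>+ a. G (initial_clocks S h \<omega>, a) \<partial>clock_seq)" unfolding ds .
  qed
  also have "\<dots> = (\<integral>\<^sup>+ r. \<integral>\<^sup>+ a. G (r, a) \<partial>clock_seq \<partial>distr clock_seq (clock_space S) (initial_clocks S h))"
  proof (subst nn_integral_distr[OF measurable_initial_clocks])
    show "(\<lambda>r. \<integral>\<^sup>+ a. G (r, a) \<partial>clock_seq) \<in> borel_measurable (distr clock_seq (clock_space S) (initial_clocks S h))"
      using seq.P.borel_measurable_nn_integral_fst[OF G] by simp
  qed simp
  finally show ?thesis unfolding dc .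
qed

lemma AE_seq_nonneg: "AE \<omega> in clock_seq. \<forall>i. 0 \<le> \<omega> i"
  by (subst AE_all_countable) (intro allI AE_PiM_component prob_space_expo AE_expo_nonneg UNIV_I)

text \<open>Both sequences of the coupling are instances: the Markov chain with
  \<open>b = 0\<close>, and the i.i.d. sequence as the chain with constant kernel
  \<open>\<lambda>_. \<pi>\<close>, initial distribution \<open>\<pi>\<close> and
  \<open>b = 1\<close>. They have \<open>h\<close> and \<open>N\<close> in common, hence also the
  initial clocks.\<close>

locale clock_chain =
  fixes S :: "'a set" and p :: "'a \<Rightarrow> 'a \<Rightarrow> real" and \<nu> :: "'a \<Rightarrow> real"
    and h :: "'a \<Rightarrow> nat" and N b :: nat
  assumes S: "finite S" and p: "stochastic S p" and \<nu>: "prob_dist S \<nu>"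
    and h: "inj_on h S" "h ` S \<subseteq> {..<N}"
begin

definition state where "state i \<omega> = chain_state S p \<nu> (initial_clocks S h \<omega>) (fresh_clocks N b \<omega>) i"
definition gap where "gap i \<omega> = chain_gap S p \<nu> (initial_clocks S h \<omega>) (fresh_clocks N b \<omega>) i"
definition rate where "rate i \<omega> = chain_rate S p \<nu> (initial_clocks S h \<omega>) (fresh_clocks N b \<omega>) i"

lemma rate_0: "rate 0 \<omega> = \<nu>" and rate_Suc: "rate (Suc i) \<omega> = p (state i \<omega>)"
  by (simp_all add: rate_def state_def)

lemma state_in: "state i \<omega> \<in> S"
  unfolding state_def by (rule chain_state_in[OF S p \<nu>])

lemma measurable_state: "state i \<in> measurable clock_seq (count_space UNIV)"
  using measurable_compose[OF measurable_initial_fresh_clocks measurable_chain_state[OF S p \<nu>]] by (simp add: state_def[abs_def])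

lemma measurable_gap: "gap i \<in> borel_measurable clock_seq"
  using measurable_compose[OF measurable_initial_fresh_clocks measurable_chain_gap[OF S p \<nu>]] by (simp add: gap_def[abs_def])

lemma measurable_rate: "(\<lambda>\<omega>. rate i \<omega> z) \<in> borel_measurable clock_seq"
  using measurable_compose[OF measurable_initial_fresh_clocks measurable_chain_rate[OF S p \<nu>]] by (simp add: rate_def[abs_def])

lemma expectation_prod:
  assumes "\<And>i w y. prob_dist S w \<Longrightarrow> y \<in> S \<Longrightarrow> (\<lambda>t. \<psi> i w t y) \<in> borel_measurable borel"
  shows "(\<integral>\<^sup>+ \<omega>. (\<Prod>i<n. \<psi> i (rate i \<omega>) (gap i \<omega>) (state i \<omega>)) \<partial>clock_seq) = path_expectation S p n \<psi> \<nu>"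
  unfolding rate_def gap_def state_def path_weight_eq[symmetric]
  using nn_integral_initial_fresh_clocks[OF h measurable_path_weight[where n = n, OF S p assms \<nu>]] nn_integral_path_weight[where n = n, OF S p assms \<nu>] by simp

lemma emeasure_state_in:
  "emeasure clock_seq {\<omega> \<in> space clock_seq. \<forall>i<n. state i \<omega> \<in> A i} = path_expectation S p n (\<lambda>i w t y. indicator (A i) y) \<nu>"
proof -
  have [measurable]: "Measurable.pred clock_seq (\<lambda>\<omega>. state i \<omega> \<in> A i)" for i
    using measurable_compose[OF measurable_state, of "\<lambda>y. y \<in> A i" "count_space UNIV"] by simp
  have "emeasure clock_seq {\<omega> \<in> space clock_seq. \<forall>i<n. state i \<omega> \<in> A i}
    = (\<integral>\<^sup>+ \<omega>. indicator {\<omega> \<in> space clock_seq. \<forall>i<n. state i \<omega> \<in> A i} \<omega> \<partial>clock_seq)"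
    by (rule nn_integral_indicator[symmetric]) measurable
  also have "\<dots> = (\<integral>\<^sup>+ \<omega>. (\<Prod>i<n. indicator (A i) (state i \<omega>)) \<partial>clock_seq)"
    using prod_guarded_indicator[of "{..<n}" "\<lambda>_. True" A]
    by (intro nn_integral_cong) (auto simp: indicator_def)
  also have "\<dots> = path_expectation S p n (\<lambda>i w t y. indicator (A i) y) \<nu>"
    by (rule expectation_prod) simp
  finally show ?thesis .
qed

text \<open>The threshold \<open>\<omega> (h z)\<close> involves neither the kernel nor
  \<open>b\<close>, so it is the same for both sequences; this is where they are coupled.\<close>

lemma visited_threshold:
  assumes "\<forall>i. 0 \<le> \<omega> i" "z \<in> S"
  shows "z \<in> (\<lambda>i. state i \<omega>) ` {0..n} \<Longrightarrow> \<omega> (h z) \<le> (\<Sum>i\<le>n. gap i \<omega> * rate i \<omega> z)"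
    and "z \<notin> (\<lambda>i. state i \<omega>) ` {0..n} \<Longrightarrow> (\<Sum>i\<le>n. gap i \<omega> * rate i \<omega> z) \<le> \<omega> (h z)"
  using visited_imp_le[OF S p \<nu>, of "initial_clocks S h \<omega>" "fresh_clocks N b \<omega>" z n]
    not_visited_imp_ge[OF S p \<nu>, of z "initial_clocks S h \<omega>" "fresh_clocks N b \<omega>" n] assms
  by (simp_all add: state_def gap_def rate_def initial_clocks_def fresh_clocks_def atLeast0AtMost)

lemma path_expectation_path:
  assumes "prob_dist S w" "\<forall>i\<le>n. xs i \<in> S"
  shows "path_expectation S p (Suc n) (\<lambda>i w t y. indicator {xs i} y) w = ennreal (w (xs 0) * (\<Prod>i<n. p (xs i) (xs (Suc i))))"
  using assms
proof (induction n arbitrary: w xs)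
  case 0
  then show ?case
    using S expo.emeasure_space_1 by (simp add: indicator_def if_distrib sum.delta cong: if_cong)
next
  case (Suc n)
  have x0: "xs 0 \<in> S" using Suc.prems by auto
  have "path_expectation S p (Suc (Suc n)) (\<lambda>i w t y. indicator {xs i} y) w
     = (\<Sum>y\<in>S. ennreal (w y) * (indicator {xs 0} y * path_expectation S p (Suc n) (\<lambda>i w t y. indicator {xs (Suc i)} y) (p y)))"
    using expo.emeasure_space_1 by (subst path_expectation.simps) simp
  also have "\<dots> = ennreal (w (xs 0)) * path_expectation S p (Suc n) (\<lambda>i w t y. indicator {xs (Suc i)} y) (p (xs 0))"
    by (subst sum.remove[OF S x0]) (auto intro!: sum.neutral simp: indicator_def simp del: path_expectation.simps)
  also have "path_expectation S p (Suc n) (\<lambda>i w t y. indicator {xs (Suc i)} y) (p (xs 0))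
     = ennreal (p (xs 0) (xs (Suc 0)) * (\<Prod>i<n. p (xs (Suc i)) (xs (Suc (Suc i)))))"
    using Suc.prems by (intro Suc.IH stochastic_prob_dist[OF p x0]) auto
  finally show ?case
    using Suc.prems x0 by (simp add: prod.lessThan_Suc_shift prob_dist_def del: path_expectation.simps prod.lessThan_Suc flip: ennreal_mult')
qed

lemma markov_chain_state: "markov_chain clock_seq S p \<nu> state"
  unfolding markov_chain_def
proof (intro conjI allI impI)
  fix n and xs :: "nat \<Rightarrow> 'a" assume xs: "\<forall>i\<le>n. xs i \<in> S"
  have "0 \<le> \<nu> (xs 0) * (\<Prod>i<n. p (xs i) (xs (Suc i)))"
    using xs \<nu> p by (intro mult_nonneg_nonneg prod_nonneg) (auto simp: prob_dist_def stochastic_def)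
  moreover have "{\<omega> \<in> space clock_seq. \<forall>i\<le>n. state i \<omega> = xs i} = {\<omega> \<in> space clock_seq. \<forall>i<Suc n. state i \<omega> \<in> {xs i}}"
    by (auto simp: less_Suc_eq_le)
  ultimately show "measure clock_seq {\<omega> \<in> space clock_seq. \<forall>i\<le>n. state i \<omega> = xs i} = \<nu> (xs 0) * (\<Prod>i<n. p (xs i) (xs (Suc i)))"
    using emeasure_state_in[of "Suc n" "\<lambda>i. {xs i}"] path_expectation_path[OF \<nu> xs]
    by (simp add: measure_def del: path_expectation.simps)
qed (use measurable_state state_in in auto)

end

section \<open>The constant kernel: an i.i.d. sequence\<close>

lemma path_expectation_iid:
  assumes "finite S" "prob_dist S \<pi>"
  shows "path_expectation S (\<lambda>_. \<pi>) n (\<lambda>i w t y. indicator (A i) y) \<pi> = ennreal (\<Prod>i<n. \<Sum>y\<in>S \<inter> A i. \<pi> y)"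
proof (induction n arbitrary: A)
  case (Suc n)
  have pos: "0 \<le> (\<Sum>y\<in>S \<inter> A i. \<pi> y)" for A :: "nat \<Rightarrow> 'a set" and i
    using assms by (auto simp: prob_dist_def intro!: sum_nonneg)
  have "(\<Sum>y\<in>S. ennreal (\<pi> y) * indicator (A 0) y) = (\<Sum>y\<in>S \<inter> A 0. ennreal (\<pi> y))"
    using assms by (intro sum.mono_neutral_cong_right) (auto simp: indicator_def)
  also have "\<dots> = ennreal (\<Sum>y\<in>S \<inter> A 0. \<pi> y)"
    using assms by (intro sum_ennreal) (auto simp: prob_dist_def)
  finally show ?case
    using expo.emeasure_space_1 pos
    by (simp add: Suc prod.lessThan_Suc_shift ennreal_mult'' prod_nonneg flip: sum_distrib_right mult.assoc del: prod.lessThan_Suc)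
qed simp

lemma iid_marginal_state:
  assumes "clock_chain S (\<lambda>_. \<pi>) \<pi> h N"
  shows "iid_marginal clock_seq S \<pi> (clock_chain.state S (\<lambda>_. \<pi>) \<pi> h N b)"
proof -
  interpret clock_chain S "\<lambda>_. \<pi>" \<pi> h N b by fact
  define q where "q A = (\<Sum>y\<in>S \<inter> A. \<pi> y)" for A
  have q0: "0 \<le> q A" for A
    using \<nu> by (auto simp: q_def prob_dist_def intro!: sum_nonneg)
  have q1: "q UNIV = 1" using \<nu> by (simp add: q_def prob_dist_def)
  have fin: "measure clock_seq {\<omega> \<in> space clock_seq. \<forall>i\<in>J. state i \<omega> \<in> A i} = (\<Prod>i\<in>J. q (A i))" if J: "finite J" for J A
  proof -
    obtain n where n: "J \<subseteq> {..<n}" using J finite_nat_iff_bounded by blast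
    \<comment> \<open>Joint probabilities are available for initial segments of times, so the times
      outside \<open>J\<close> get the condition \<open>UNIV\<close>, of mass 1.\<close>
    define B where "B i = (if i \<in> J then A i else UNIV)" for i
    have "{\<omega> \<in> space clock_seq. \<forall>i\<in>J. state i \<omega> \<in> A i} = {\<omega> \<in> space clock_seq. \<forall>i<n. state i \<omega> \<in> B i}"
      using n by (auto simp: B_def)
    moreover have "(\<Prod>i<n. q (B i)) = (\<Prod>i\<in>J. q (A i))"
      using n q1 by (intro prod.mono_neutral_cong_right) (auto simp: B_def)
    ultimately show ?thesis
      using emeasure_state_in[of n B] path_expectation_iid[OF S \<nu>, of n B] q0 by (simp add: measure_def q_def prod_nonneg)
  qed
  have one: "measure clock_seq {\<omega> \<in> space clock_seq. state j \<omega> \<in> A} = q A" for j A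
    using fin[of "{j}" "\<lambda>_. A"] by simp
  have "seq.P.indep_vars (\<lambda>_. count_space UNIV) state UNIV"
    unfolding seq.P.indep_vars_def2
  proof (intro conjI ballI measurable_state seq.P.indep_setsI)
    fix i
    show "{state i -` A \<inter> space clock_seq |A. A \<in> sets (count_space UNIV)} \<subseteq> sets clock_seq"
      using measurable_state[of i] by (auto intro: measurable_sets)
  next
    fix A J assume J: "J \<noteq> {}" "finite (J :: nat set)" and A: "\<forall>j\<in>J. A j \<in> {state j -` A \<inter> space clock_seq |A. A \<in> sets (count_space UNIV)}"
    then obtain B where B: "\<And>j. j \<in> J \<Longrightarrow> A j = state j -` B j \<inter> space clock_seq" by simp metis
    have "(\<Inter>j\<in>J. A j) = {\<omega> \<in> space clock_seq. \<forall>i\<in>J. state i \<omega> \<in> B i}"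
      using J B by auto
    moreover have "measure clock_seq (A j) = q (B j)" if "j \<in> J" for j
      using one[of j "B j"] B[OF that] by (simp add: vimage_def Int_def conj_commute)
    ultimately show "measure clock_seq (\<Inter>j\<in>J. A j) = (\<Prod>j\<in>J. measure clock_seq (A j))"
      using fin[OF J(2), of B] by simp
  qed
  moreover have "measure clock_seq {\<omega> \<in> space clock_seq. state i \<omega> = x} = \<pi> x" if "x \<in> S" for i x
    using one[of i "{x}"] that by (simp add: q_def)
  ultimately show ?thesis
    unfolding iid_marginal_def using state_in by auto
qed

section \<open>Exponential moments of a mixing chain\<close>

text \<open>What is left of \<open>path_expectation\<close> once the gaps are integrated out: the
  expectation of the product of \<open>\<phi> i\<close> at the state of time i, for i below n, with
  the state of time 0 drawn from \<open>w\<close>.\<close>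

fun chain_expectation :: "'a set \<Rightarrow> ('a \<Rightarrow> 'a \<Rightarrow> real) \<Rightarrow> nat \<Rightarrow> (nat \<Rightarrow> 'a \<Rightarrow> real) \<Rightarrow> ('a \<Rightarrow> real) \<Rightarrow> real" where
  "chain_expectation S p 0 \<phi> w = 1"
| "chain_expectation S p (Suc n) \<phi> w = (\<Sum>y\<in>S. w y * (\<phi> 0 y * chain_expectation S p n (\<lambda>i. \<phi> (Suc i)) (p y)))"

context
  fixes S :: "'a set" and p
  assumes S: "finite S" and p: "stochastic S p"
begin

lemma p_nonneg: "x \<in> S \<Longrightarrow> y \<in> S \<Longrightarrow> 0 \<le> p x y"
  using p by (simp add: stochastic_def)

lemma chain_expectation_nonneg:
  assumes "\<And>y. y \<in> S \<Longrightarrow> 0 \<le> w y" "\<And>i y. y \<in> S \<Longrightarrow> 0 \<le> \<phi> i y"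
  shows "0 \<le> chain_expectation S p n \<phi> w"
  using assms
proof (induction n arbitrary: \<phi> w)
  case (Suc n)
  show ?case unfolding chain_expectation.simps
    by (intro sum_nonneg mult_nonneg_nonneg Suc) (use Suc.prems p_nonneg in auto)
qed simp

lemma chain_expectation_one:
  assumes "prob_dist S w" "\<And>i y. i < n \<Longrightarrow> y \<in> S \<Longrightarrow> \<phi> i y = 1"
  shows "chain_expectation S p n \<phi> w = 1"
  using assms
proof (induction n arbitrary: \<phi> w)
  case (Suc n)
  have "chain_expectation S p n (\<lambda>i. \<phi> (Suc i)) (p y) = 1" if "y \<in> S" for y
    using Suc.prems that by (intro Suc.IH stochastic_prob_dist[OF p]) auto
  then show ?case using Suc.prems by (simp add: prob_dist_def)
qed simp

text \<open>The rates of step \<open>Suc i\<close> are the row of the state reached in step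
  \<open>i\<close>, so integrating out the gap leaves a function of that earlier state. The first
  step runs at the rates \<open>w\<close> and has its own constant \<open>c\<close>; thus
  \<open>Suc n\<close> steps give \<open>n\<close> factors.\<close>

lemma path_expectation_le_chain_expectation:
  assumes "\<And>i x y. x \<in> S \<Longrightarrow> y \<in> S \<Longrightarrow> (\<integral>\<^sup>+ t. \<psi> (Suc i) (p x) t y \<partial>expo) \<le> ennreal (\<phi> i x)"
    and "\<And>i y. y \<in> S \<Longrightarrow> 0 \<le> \<phi> i y"
    and "prob_dist S w" "0 \<le> c" "\<And>y. y \<in> S \<Longrightarrow> (\<integral>\<^sup>+ t. \<psi> 0 w t y \<partial>expo) \<le> ennreal c"
  shows "path_expectation S p (Suc n) \<psi> w \<le> ennreal (c * chain_expectation S p n \<phi> w)"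
  using assms
proof (induction n arbitrary: \<psi> \<phi> w c)
  case 0
  have "path_expectation S p (Suc 0) \<psi> w \<le> (\<Sum>y\<in>S. ennreal (w y) * ennreal c)"
    using 0 by (auto intro!: sum_mono mult_left_mono)
  also have "\<dots> = ennreal c"
    using 0 by (simp add: prob_dist_def sum_ennreal flip: sum_distrib_right)
  finally show ?case by simp
next
  case (Suc n)
  have w0: "0 \<le> w y" if "y \<in> S" for y using Suc.prems(3) that by (simp add: prob_dist_def)
  have q0: "0 \<le> chain_expectation S p n (\<lambda>i. \<phi> (Suc i)) (p y)" if "y \<in> S" for y
    using that Suc.prems(2) p_nonneg by (intro chain_expectation_nonneg) auto
  have "path_expectation S p (Suc (Suc n)) \<psi> w \<le> (\<Sum>y\<in>S. ennreal (w y) * (ennreal c * ennreal (\<phi> 0 y * chain_expectation S p n (\<lambda>i. \<phi> (Suc i)) (p y))))"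
    unfolding path_expectation.simps(2)[of S p "Suc n"]
  proof (intro sum_mono mult_mono order_refl)
    fix y assume y: "y \<in> S"
    show "(\<integral>\<^sup>+ t. \<psi> 0 w t y \<partial>expo) \<le> ennreal c" by (rule Suc.prems(5)[OF y])
    \<comment> \<open>The chain restarted at the row \<open>p y\<close> has the constant
      \<open>\<phi> 0 y\<close> in place of \<open>c\<close>.\<close>
    show "path_expectation S p (Suc n) (\<lambda>i. \<psi> (Suc i)) (p y) \<le> ennreal (\<phi> 0 y * chain_expectation S p n (\<lambda>i. \<phi> (Suc i)) (p y))"
      using y by (intro Suc.IH Suc.prems stochastic_prob_dist[OF p]) auto
  qed auto
  also have "\<dots> = (\<Sum>y\<in>S. ennreal (w y * (c * (\<phi> 0 y * chain_expectation S p n (\<lambda>i. \<phi> (Suc i)) (p y)))))"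
    using w0 q0 Suc.prems by (intro sum.cong refl) (simp add: ennreal_mult)
  also have "\<dots> = ennreal (\<Sum>y\<in>S. w y * (c * (\<phi> 0 y * chain_expectation S p n (\<lambda>i. \<phi> (Suc i)) (p y))))"
    using w0 q0 Suc.prems by (intro sum_ennreal) simp
  also have "\<dots> = ennreal (c * chain_expectation S p (Suc n) \<phi> w)"
    by (simp add: sum_distrib_left mult_ac)
  finally show ?case .
qed

lemma path_expectation_le_power:
  assumes "\<And>i w y. prob_dist S w \<Longrightarrow> y \<in> S \<Longrightarrow> (\<integral>\<^sup>+ t. \<psi> i w t y \<partial>expo) \<le> ennreal c"
    and "prob_dist S w" "0 \<le> c"
  shows "path_expectation S p n \<psi> w \<le> ennreal (c ^ n)"
  using assms
proof (induction n arbitrary: \<psi> w)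
  case (Suc n)
  have "path_expectation S p (Suc n) \<psi> w \<le> (\<Sum>y\<in>S. ennreal (w y) * (ennreal c * ennreal (c ^ n)))"
    unfolding path_expectation.simps
    using Suc.prems by (intro sum_mono mult_mono Suc.IH stochastic_prob_dist[OF p]) auto
  also have "\<dots> = ennreal (\<Sum>y\<in>S. w y) * ennreal (c ^ Suc n)"
    using Suc.prems by (simp add: prob_dist_def sum_ennreal ennreal_mult flip: sum_distrib_right)
  also have "\<dots> = ennreal (c ^ Suc n)" using Suc.prems by (simp add: prob_dist_def)
  finally show ?case .
qed simp

text \<open>An expectation is linear and monotone, so a pointwise inequality between sums of
  products carries over. The coefficients \<open>a\<close> and \<open>c r\<close> are there to
  absorb the first factor of each product in the induction.\<close>

lemma chain_expectation_le_sum: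
  assumes "\<And>x :: nat \<Rightarrow> 'a. (\<forall>i. x i \<in> S) \<Longrightarrow> a * (\<Prod>i<n. \<phi> i (x i)) \<le> (\<Sum>r\<in>R. c r * (\<Prod>i<n. \<eta> r i (x i)))"
    and "prob_dist S w"
  shows "a * chain_expectation S p n \<phi> w \<le> (\<Sum>r\<in>R. c r * chain_expectation S p n (\<eta> r) w)"
  using assms
proof (induction n arbitrary: a c \<phi> \<eta> w)
  case 0
  obtain x where "x \<in> S" using prob_dist_pos[OF 0(2)] by auto
  then show ?case using 0(1)[of "\<lambda>_. x"] by simp
next
  case (Suc n)
  have "a * chain_expectation S p (Suc n) \<phi> w = (\<Sum>y\<in>S. w y * ((a * \<phi> 0 y) * chain_expectation S p n (\<lambda>i. \<phi> (Suc i)) (p y)))"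
    by (simp add: sum_distrib_left mult_ac)
  also have "\<dots> \<le> (\<Sum>y\<in>S. w y * (\<Sum>r\<in>R. (c r * \<eta> r 0 y) * chain_expectation S p n (\<lambda>i. \<eta> r (Suc i)) (p y)))"
  proof (intro sum_mono mult_left_mono Suc.IH stochastic_prob_dist[OF p])
    fix y and x :: "nat \<Rightarrow> 'a" assume y: "y \<in> S" and x: "\<forall>i. x i \<in> S"
    have "\<forall>i. case_nat y x i \<in> S" using x y by (simp split: nat.split)
    from Suc.prems(1)[OF this]
    show "a * \<phi> 0 y * (\<Prod>i<n. \<phi> (Suc i) (x i)) \<le> (\<Sum>r\<in>R. c r * \<eta> r 0 y * (\<Prod>i<n. \<eta> r (Suc i) (x i)))"
      by (simp add: prod.lessThan_Suc_shift mult_ac del: prod.lessThan_Suc)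
  qed (use Suc.prems(2) in \<open>auto simp: prob_dist_def\<close>)
  also have "\<dots> = (\<Sum>r\<in>R. c r * chain_expectation S p (Suc n) (\<eta> r) w)"
    unfolding chain_expectation.simps sum_distrib_left by (subst sum.swap) (simp add: mult_ac)
  finally show ?case .
qed

section \<open>Powers of the transition matrix\<close>

lemma mpow_nonneg: "x \<in> S \<Longrightarrow> y \<in> S \<Longrightarrow> 0 \<le> mpow S p n x y"
  by (induction n arbitrary: y) (auto intro!: sum_nonneg mult_nonneg_nonneg p_nonneg)

lemma mpow_sum: "x \<in> S \<Longrightarrow> (\<Sum>y\<in>S. mpow S p n x y) = 1"
proof (induction n)
  case 0
  then show ?case using S by simp
next
  case (Suc n)
  have "(\<Sum>y\<in>S. mpow S p (Suc n) x y) = (\<Sum>z\<in>S. mpow S p n x z * (\<Sum>y\<in>S. p z y))"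
    by (simp add: sum_distrib_left) (rule sum.swap)
  also have "\<dots> = (\<Sum>z\<in>S. mpow S p n x z)"
    using p by (simp add: stochastic_def)
  finally show ?case using Suc by simp
qed

lemma mpow_add:
  assumes "x \<in> S" "y \<in> S"
  shows "mpow S p (m + n) x y = (\<Sum>z\<in>S. mpow S p m x z * mpow S p n z y)"
  using assms
proof (induction n arbitrary: y)
  case 0
  then show ?case using S by (simp add: if_distrib sum.delta cong: if_cong)
next
  case (Suc n)
  have "mpow S p (m + Suc n) x y = (\<Sum>v\<in>S. (\<Sum>z\<in>S. mpow S p m x z * mpow S p n z v) * p v y)"
    using Suc by simp
  also have "\<dots> = (\<Sum>z\<in>S. mpow S p m x z * (\<Sum>v\<in>S. mpow S p n z v * p v y))"
    by (simp add: sum_distrib_left sum_distrib_right mult.assoc) (rule sum.swap)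
  finally show ?case by simp
qed

lemma mpow_1: "x \<in> S \<Longrightarrow> mpow S p (Suc 0) x y = p x y"
  using S by (simp add: if_distrib[of "\<lambda>u. u * _"] sum.delta cong: if_cong)

lemma mpow_Suc_left:
  assumes "x \<in> S" "y \<in> S"
  shows "mpow S p (Suc n) x y = (\<Sum>z\<in>S. p x z * mpow S p n z y)"
  using mpow_add[OF assms, of "Suc 0" n] mpow_1[OF assms(1)] by simp

text \<open>Factors equal to 1 are summed out, so the first \<open>c\<close> steps collapse into the
  \<open>c\<close>-step transition matrix and the chain is first observed at time
  \<open>c\<close>.\<close>

lemma chain_expectation_skip:
  assumes "c < n" "\<And>i y. i < c \<Longrightarrow> y \<in> S \<Longrightarrow> \<phi> i y = 1"
  shows "chain_expectation S p n \<phi> w = (\<Sum>x\<in>S. w x * (\<Sum>y\<in>S. mpow S p c x y *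
      (\<phi> c y * chain_expectation S p (n - Suc c) (\<lambda>i. \<phi> (i + Suc c)) (p y))))"
  using assms
proof (induction c arbitrary: n \<phi> w)
  case 0
  obtain m where n: "n = Suc m" using 0 by (cases n) auto
  have "(\<Sum>y\<in>S. mpow S p 0 x y * (\<phi> 0 y * chain_expectation S p m (\<lambda>i. \<phi> (Suc i)) (p y)))
     = \<phi> 0 x * chain_expectation S p m (\<lambda>i. \<phi> (Suc i)) (p x)" if "x \<in> S" for x
    using S that by (simp add: if_distrib[of "\<lambda>u. u * _"] sum.delta cong: if_cong)
  then show ?case by (simp add: n del: mpow.simps)
next
  case (Suc c)
  obtain m where n: "n = Suc m" "c < m" using Suc.prems by (cases n) auto
  define g where "g y = \<phi> (Suc c) y * chain_expectation S p (m - Suc c) (\<lambda>i. \<phi> (i + Suc (Suc c))) (p y)" for y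
  have "chain_expectation S p m (\<lambda>i. \<phi> (Suc i)) (p x) = (\<Sum>y\<in>S. mpow S p (Suc c) x y * g y)" if x: "x \<in> S" for x
  proof -
    have "chain_expectation S p m (\<lambda>i. \<phi> (Suc i)) (p x) = (\<Sum>z\<in>S. p x z * (\<Sum>y\<in>S. mpow S p c z y * g y))"
      using Suc.IH[OF n(2), of "\<lambda>i. \<phi> (Suc i)" "p x"] Suc.prems(2) by (simp add: g_def)
    also have "\<dots> = (\<Sum>y\<in>S. (\<Sum>z\<in>S. p x z * mpow S p c z y) * g y)"
      by (simp add: sum_distrib_left sum_distrib_right mult.assoc) (rule sum.swap)
    also have "\<dots> = (\<Sum>y\<in>S. mpow S p (Suc c) x y * g y)"
      using mpow_Suc_left[OF x] by (intro sum.cong refl) simp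
    finally show ?thesis .
  qed
  then show ?case using Suc.prems(2)[of 0] by (simp add: n g_def del: mpow.simps)
qed

section \<open>Factors along one residue class of times\<close>

definition marked :: "nat \<Rightarrow> ('a \<Rightarrow> real) \<Rightarrow> nat \<Rightarrow> nat \<Rightarrow> 'a \<Rightarrow> real" where
  "marked l u c i y = (if i mod l = c then u y else 1)"

text \<open>Right after a mark, the next one is preceded by \<open>l - 1\<close> unmarked times,
  whatever \<open>c\<close> was. The residue \<open>l - 1\<close> is therefore the one that
  reproduces itself.\<close>

lemma marked_shift:
  assumes "c < l"
  shows "marked l u c (i + Suc c) = marked l u (l - 1) i"
proof -
  have "(i + Suc c) mod l = c \<longleftrightarrow> i mod l = l - 1"
  proof -
    have "(i + Suc c) mod l = c \<longleftrightarrow> (i + Suc c) mod l = c mod l" using assms by simp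
    also have "\<dots> \<longleftrightarrow> l dvd (i + Suc c) - c" by (rule mod_eq_dvd_iff_nat) simp
    also have "\<dots> \<longleftrightarrow> Suc i mod l = 0" by (simp add: dvd_eq_mod_eq_0)
    finally show ?thesis using assms by (auto simp: mod_Suc)
  qed
  then show ?thesis by (simp add: marked_def fun_eq_iff)
qed

text \<open>Starting from the row \<open>p x\<close>, the \<open>l - 1\<close> unmarked steps up to
  the first mark complete an \<open>l\<close>-step transition from \<open>x\<close>, which yields
  one factor \<open>m\<close>. The state at the mark is a new start, so every complete block of
  \<open>l\<close> steps costs one factor.\<close>

lemma chain_expectation_mark_last:
  assumes l: "0 < l" and u: "\<And>y. y \<in> S \<Longrightarrow> 0 \<le> u y" and m: "1 \<le> m"
    and um: "\<And>x. x \<in> S \<Longrightarrow> (\<Sum>y\<in>S. mpow S p l x y * u y) \<le> m" and x: "x \<in> S"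
  shows "chain_expectation S p n (marked l u (l - 1)) (p x) \<le> m ^ (n div l)"
  using x
proof (induction n arbitrary: x rule: less_induct)
  case (less n)
  note x = less.prems
  show ?case
  proof (cases "n < l")
    case True
    then have "chain_expectation S p n (marked l u (l - 1)) (p x) = 1"
      by (intro chain_expectation_one stochastic_prob_dist[OF p x]) (auto simp: marked_def)
    then show ?thesis using True by simp
  next
    case False
    then have nl: "l - 1 < n" using l by simp
    let ?g = "\<lambda>y. u y * chain_expectation S p (n - l) (marked l u (l - 1)) (p y)"
    have "chain_expectation S p n (marked l u (l - 1)) (p x) = (\<Sum>z\<in>S. p x z * (\<Sum>y\<in>S. mpow S p (l - 1) z y * ?g y))"
    proof -
      have sh: "(\<lambda>i. marked l u (l - 1) (i + Suc (l - 1))) = marked l u (l - 1)"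
        using marked_shift[of "l - 1" l u] l by (intro ext) simp
      have "marked l u (l - 1) (l - 1) y = u y" for y using l by (simp add: marked_def)
      moreover have "\<And>i y. i < l - 1 \<Longrightarrow> y \<in> S \<Longrightarrow> marked l u (l - 1) i y = 1"
        by (simp add: marked_def)
      ultimately show ?thesis using chain_expectation_skip[of "l - 1" n "marked l u (l - 1)" "p x", OF nl] l
        unfolding sh by simp
    qed
    also have "\<dots> = (\<Sum>y\<in>S. (\<Sum>z\<in>S. p x z * mpow S p (l - 1) z y) * ?g y)"
      by (simp add: sum_distrib_left sum_distrib_right mult.assoc) (rule sum.swap)
    also have "\<dots> = (\<Sum>y\<in>S. mpow S p l x y * ?g y)"
      using mpow_Suc_left[OF x, of _ "l - 1"] l by (intro sum.cong refl) simp
    also have "\<dots> \<le> (\<Sum>y\<in>S. mpow S p l x y * (u y * m ^ ((n - l) div l)))"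
      using l False by (intro sum_mono mult_left_mono less.IH mpow_nonneg x u) auto
    also have "\<dots> = (\<Sum>y\<in>S. mpow S p l x y * u y) * m ^ ((n - l) div l)"
      by (simp add: sum_distrib_right mult.assoc)
    also have "\<dots> \<le> m * m ^ ((n - l) div l)"
      using m by (intro mult_right_mono um x) simp
    also have "\<dots> = m ^ (n div l)"
      using l False by (simp add: le_div_geq)
    finally show ?thesis .
  qed
qed

text \<open>The first mark comes after only \<open>c\<close> steps from an arbitrary distribution,
  too early for the \<open>l\<close>-step bound. It is estimated by the supremum \<open>B\<close>;
  all later marks have \<open>l\<close> steps behind them.\<close>

lemma chain_expectation_mark:
  assumes c: "c < l" and u: "\<And>y. y \<in> S \<Longrightarrow> 0 \<le> u y" and m: "1 \<le> m"
    and um: "\<And>x. x \<in> S \<Longrightarrow> (\<Sum>y\<in>S. mpow S p l x y * u y) \<le> m"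
    and B: "1 \<le> B" "\<And>y. y \<in> S \<Longrightarrow> u y \<le> B" and w: "prob_dist S w"
  shows "chain_expectation S p n (marked l u c) w \<le> B * m ^ (n div l)"
proof (cases "c < n")
  case True
  have sh: "(\<lambda>i. marked l u c (i + Suc c)) = marked l u (l - 1)"
    using marked_shift[OF c] by (intro ext) simp
  have "chain_expectation S p n (marked l u c) w = (\<Sum>x\<in>S. w x * (\<Sum>y\<in>S. mpow S p c x y *
      (u y * chain_expectation S p (n - Suc c) (marked l u (l - 1)) (p y))))"
  proof -
    have "marked l u c c y = u y" for y using c by (simp add: marked_def)
    moreover have "\<And>i y. i < c \<Longrightarrow> y \<in> S \<Longrightarrow> marked l u c i y = 1"
      using c by (simp add: marked_def)
    ultimately show ?thesis using chain_expectation_skip[of c n "marked l u c" w, OF True] unfolding sh by simp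
  qed
  also have "\<dots> \<le> (\<Sum>x\<in>S. w x * (\<Sum>y\<in>S. mpow S p c x y * (B * m ^ (n div l))))"
  proof (intro sum_mono mult_left_mono mult_mono mpow_nonneg B)
    fix y assume y: "y \<in> S"
    have "chain_expectation S p (n - Suc c) (marked l u (l - 1)) (p y) \<le> m ^ ((n - Suc c) div l)"
      using c by (intro chain_expectation_mark_last u m um y) auto
    also have "\<dots> \<le> m ^ (n div l)" using m by (intro power_increasing div_le_mono) auto
    finally show "chain_expectation S p (n - Suc c) (marked l u (l - 1)) (p y) \<le> m ^ (n div l)" .
    show "0 \<le> chain_expectation S p (n - Suc c) (marked l u (l - 1)) (p y)"
      using y p_nonneg u by (intro chain_expectation_nonneg) (auto simp: marked_def)
  qed (use w B in \<open>auto simp: prob_dist_def\<close>)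
  also have "\<dots> = B * m ^ (n div l)"
    using w mpow_sum by (simp add: prob_dist_def flip: sum_distrib_right)
  finally show ?thesis .
next
  case False
  then have "chain_expectation S p n (marked l u c) w = 1"
    using c by (intro chain_expectation_one w) (auto simp: marked_def)
  also have "\<dots> \<le> B * m ^ (n div l)"
    using B(1) one_le_power[OF m] by (metis mult_mono' mult.left_neutral zero_le_one)
  finally show ?thesis .
qed

text \<open>Separating the times by residue class multiplies the exponent by \<open>l\<close>. Since
  \<open>real l * g y \<le> 1\<close>, the first mark of each class is at most \<open>exp 1\<close>,
  which is the constant in front.\<close>

lemma chain_expectation_exp_le:
  assumes l: "0 < l" and m: "1 \<le> m"
    and um: "\<And>x. x \<in> S \<Longrightarrow> (\<Sum>y\<in>S. mpow S p l x y * exp (real l * g y)) \<le> m"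
    and g: "\<And>y. y \<in> S \<Longrightarrow> real l * g y \<le> 1" and w: "prob_dist S w"
  shows "chain_expectation S p n (\<lambda>i y. exp (g y)) w \<le> exp 1 * m ^ (n div l)"
proof -
  define u where "u y = exp (real l * g y)" for y
  have "1 * chain_expectation S p n (\<lambda>i y. exp (g y)) w \<le> (\<Sum>c<l. 1 / real l * chain_expectation S p n (marked l u c) w)"
  proof (rule chain_expectation_le_sum[OF _ w])
    fix x :: "nat \<Rightarrow> 'a"
    define T where "T c = (\<Sum>i<n. if i mod l = c then g (x i) else 0)" for c
    have T: "(\<Sum>c<l. T c) = (\<Sum>i<n. g (x i))"
      unfolding T_def using l by (subst sum.swap) (simp add: sum.delta)
    \<comment> \<open>Convexity with equal weights: the total exponent is the average over the
      residue classes of \<open>real l * T c\<close>.\<close>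
    have "exp (\<Sum>c<l. (1 / real l) *\<^sub>R (real l * T c)) \<le> (\<Sum>c<l. 1 / real l * exp (real l * T c))"
    proof (rule convex_on_sum[where C = UNIV])
      show "convex_on UNIV (exp :: real \<Rightarrow> real)" by (rule exp_convex)
    qed (use l in auto)
    also have "(\<Sum>c<l. (1 / real l) *\<^sub>R (real l * T c)) = (\<Sum>i<n. g (x i))"
      using l T by simp
    finally have "exp (\<Sum>i<n. g (x i)) \<le> (\<Sum>c<l. 1 / real l * exp (real l * T c))" .
    moreover have "exp (real l * T c) = (\<Prod>i<n. marked l u c i (x i))" for c
      unfolding T_def sum_distrib_left by (subst exp_sum) (auto simp: marked_def u_def intro!: prod.cong)
    ultimately show "1 * (\<Prod>i<n. exp (g (x i))) \<le> (\<Sum>c<l. 1 / real l * (\<Prod>i<n. marked l u c i (x i)))"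
      by (simp add: exp_sum)
  qed
  also have "\<dots> \<le> (\<Sum>c<l. 1 / real l * (exp 1 * m ^ (n div l)))"
    using um g by (intro sum_mono mult_left_mono chain_expectation_mark m w) (auto simp: u_def)
  also have "\<dots> = exp 1 * m ^ (n div l)" using l by simp
  finally show ?thesis by simp
qed

section \<open>Contraction of oscillations\<close>

lemma mpow_contract:
  assumes \<pi>: "mixes_at S p \<pi> T" and x: "x \<in> S" "x' \<in> S"
    and D: "\<And>y y'. y \<in> S \<Longrightarrow> y' \<in> S \<Longrightarrow> \<bar>f y - f y'\<bar> \<le> D"
  shows "\<bar>(\<Sum>y\<in>S. mpow S p T x y * f y) - (\<Sum>y\<in>S. mpow S p T x' y * f y)\<bar> \<le> D / 2"
proof -
  \<comment> \<open>Two rows have equal mass, so \<open>f\<close> may be centred at the midpoint of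
    its range, which leaves deviations of at most \<open>D / 2\<close>. Each row is within 1/2 of
    \<open>\<pi>\<close> in the l1 norm, hence two rows are within 1 of each other.\<close>
  define c where "c = (Max (f ` S) + Min (f ` S)) / 2"
  have ne: "f ` S \<noteq> {}" "finite (f ` S)" using x S by auto
  obtain a b where ab: "a \<in> S" "b \<in> S" "f a = Max (f ` S)" "f b = Min (f ` S)"
    using Max_in[OF ne(2,1)] Min_in[OF ne(2,1)] by (metis imageE)
  have c: "\<bar>f y - c\<bar> \<le> D / 2" if "y \<in> S" for y
    using Max_ge[OF ne(2), of "f y"] Min_le[OF ne(2), of "f y"] D[OF ab(1,2)] that
    unfolding c_def ab(3,4)[symmetric] by (auto simp: abs_le_iff field_simps)
  have D0: "0 \<le> D" using D[OF x(1,1)] by simp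
  have tv: "(\<Sum>y\<in>S. \<bar>mpow S p T z y - \<pi> y\<bar>) \<le> 1 / 2" if "z \<in> S" for z
    using \<pi> that by (auto simp: mixes_at_def tv_dist_def)
  have "(\<Sum>y\<in>S. mpow S p T x y * f y) - (\<Sum>y\<in>S. mpow S p T x' y * f y)
      = (\<Sum>y\<in>S. mpow S p T x y * f y) - (\<Sum>y\<in>S. mpow S p T x' y * f y)
        - c * ((\<Sum>y\<in>S. mpow S p T x y) - (\<Sum>y\<in>S. mpow S p T x' y))"
    using mpow_sum x by simp
  also have "\<dots> = (\<Sum>y\<in>S. (mpow S p T x y - mpow S p T x' y) * (f y - c))"
    by (simp add: sum_subtractf sum_distrib_left left_diff_distrib right_diff_distrib mult.commute[of c])
  also have "\<bar>\<dots>\<bar> \<le> (\<Sum>y\<in>S. \<bar>(mpow S p T x y - mpow S p T x' y) * (f y - c)\<bar>)"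
    by (rule sum_abs)
  also have "\<dots> \<le> (\<Sum>y\<in>S. (\<bar>mpow S p T x y - \<pi> y\<bar> + \<bar>mpow S p T x' y - \<pi> y\<bar>) * (D / 2))"
    unfolding abs_mult using c by (intro sum_mono mult_mono) auto
  also have "\<dots> = ((\<Sum>y\<in>S. \<bar>mpow S p T x y - \<pi> y\<bar>) + (\<Sum>y\<in>S. \<bar>mpow S p T x' y - \<pi> y\<bar>)) * (D / 2)"
    unfolding sum_distrib_right[symmetric] sum.distrib ..
  also have "\<dots> \<le> 1 * (D / 2)"
    using tv[OF x(1)] tv[OF x(2)] D0 by (intro mult_right_mono) auto
  finally show ?thesis by simp
qed

text \<open>The contraction is applied to the column of the remaining power as the function
  \<open>f\<close>, so each mixing time halves the oscillation; additional steps beyond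
  \<open>m * T\<close> do no harm.\<close>

lemma mpow_oscillation:
  assumes "mixes_at S p \<pi> T" "x \<in> S" "x' \<in> S" "y \<in> S" "m * T \<le> N"
  shows "\<bar>mpow S p N x y - mpow S p N x' y\<bar> \<le> (1 / 2) ^ m"
  using assms
proof (induction m arbitrary: N x x')
  case 0
  have "mpow S p N z y \<le> 1" if "z \<in> S" for z
    using member_le_sum[of y S "mpow S p N z", OF 0(4)] mpow_nonneg[OF that] mpow_sum[OF that, of N] S by simp
  from this[OF 0(2)] this[OF 0(3)] show ?case
    using mpow_nonneg[OF 0(2,4), of N] mpow_nonneg[OF 0(3,4), of N] by (simp add: abs_le_iff)
next
  case (Suc m)
  define k where "k = N - T"
  have N: "N = T + k" "m * T \<le> k"
    using Suc.prems(5) by (auto simp: k_def)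
  have "\<bar>(\<Sum>z\<in>S. mpow S p T x z * mpow S p k z y) - (\<Sum>z\<in>S. mpow S p T x' z * mpow S p k z y)\<bar> \<le> (1 / 2) ^ m / 2"
    using Suc.prems N(2) by (intro mpow_contract Suc.IH) auto
  then show ?case unfolding N(1) mpow_add[OF Suc.prems(2,4)] mpow_add[OF Suc.prems(3,4)] by simp
qed

lemma invariant_mpow:
  assumes "invariant_dist S p \<pi>" "y \<in> S"
  shows "(\<Sum>x\<in>S. \<pi> x * mpow S p n x y) = \<pi> y"
  using assms(2)
proof (induction n arbitrary: y)
  case 0
  then show ?case using S by (simp add: if_distrib sum.delta' cong: if_cong)
next
  case (Suc n)
  have "(\<Sum>x\<in>S. \<pi> x * mpow S p (Suc n) x y) = (\<Sum>z\<in>S. (\<Sum>x\<in>S. \<pi> x * mpow S p n x z) * p z y)"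
    by (simp add: sum_distrib_left sum_distrib_right mult.assoc) (rule sum.swap)
  also have "\<dots> = \<pi> y" using Suc assms(1) by (simp add: invariant_dist_def)
  finally show ?case .
qed

text \<open>By invariance \<open>\<pi>\<close> is an average of the rows of the
  \<open>N\<close>-step matrix, so a row exceeds it by at most the oscillation of the
  column.\<close>

lemma mpow_near_invariant:
  assumes "mixes_at S p \<pi> T" "invariant_dist S p \<pi>" "x \<in> S" "y \<in> S" "m * T \<le> N"
  shows "mpow S p N x y \<le> \<pi> y + (1 / 2) ^ m"
proof -
  have \<pi>: "(\<Sum>x\<in>S. \<pi> x) = 1" "\<And>x. x \<in> S \<Longrightarrow> 0 \<le> \<pi> x"
    using assms(2) by (auto simp: invariant_dist_def prob_dist_def)
  have "mpow S p N x y = (\<Sum>x'\<in>S. \<pi> x' * mpow S p N x y)"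
    using \<pi> by (simp flip: sum_distrib_right)
  also have "\<dots> \<le> (\<Sum>x'\<in>S. \<pi> x' * (mpow S p N x' y + (1 / 2) ^ m))"
    using mpow_oscillation[OF assms(1,3) _ assms(4,5)] \<pi>(2)
    by (intro sum_mono mult_left_mono) (auto simp: abs_le_iff algebra_simps)
  also have "\<dots> = \<pi> y + (1 / 2) ^ m"
    using \<pi> invariant_mpow[OF assms(2,4)] by (simp add: distrib_left sum.distrib flip: sum_distrib_right)
  finally show ?thesis .
qed

end

section \<open>Tail bounds\<close>

lemma exp_le_quadratic:
  assumes "\<bar>v\<bar> \<le> (1::real)"
  shows "exp v \<le> 1 + v + v\<^sup>2"
proof (cases "0 \<le> v")
  case True
  then show ?thesis using assms by (intro exp_bound) auto
next
  case False
  \<comment> \<open>In terms of \<open>q\<close> the claim says that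
    \<open>exp q * (1 - q + q\<^sup>2)\<close> is at least 1, and the quadratic Taylor polynomial of
    \<open>exp q\<close> is already large enough.\<close>
  define q where "q = - v"
  have q: "0 < q" "v = - q" using False by (auto simp: q_def)
  have "1 \<le> 1 + (q\<^sup>2 + q ^ 3 + q ^ 4) / 2" using q by simp
  also have "\<dots> = (1 + q + q\<^sup>2 / 2) * (1 - q + q\<^sup>2)"
    by (simp add: field_simps power2_eq_square power3_eq_cube power4_eq_xxxx)
  also have "\<dots> \<le> exp q * (1 - q + q\<^sup>2)"
  proof (intro mult_right_mono exp_lower_Taylor_quadratic)
    have "0 \<le> (q - 1/2)\<^sup>2 + 3 / 4" by simp
    then show "0 \<le> 1 - q + q\<^sup>2" by (simp add: power2_eq_square algebra_simps)
  qed (use q in simp)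
  finally have "exp (- q) * 1 \<le> exp (- q) * (exp q * (1 - q + q\<^sup>2))" by (intro mult_left_mono) auto
  then show ?thesis by (simp add: q exp_minus inverse_eq_divide pos_divide_le_eq mult.commute)
qed

text \<open>The left side is the moment generating function of a gap. In exponential form, bounds
  for successive steps multiply, with a linear term that the centring removes on average.\<close>

lemma inverse_one_minus_le_exp:
  assumes "\<bar>u\<bar> \<le> (1 / 2 :: real)"
  shows "1 / (1 - u) \<le> exp (u + 2 * u\<^sup>2)"
proof -
  have "- u - 2 * u\<^sup>2 \<le> ln (1 - u)"
  proof (cases "0 \<le> u")
    case True
    then show ?thesis using assms by (intro ln_one_minus_pos_lower_bound) auto
  next
    case False
    then have "(- u) - (- u)\<^sup>2 \<le> ln (1 + (- u))"
      using assms by (intro ln_one_plus_pos_lower_bound) auto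
    then show ?thesis by (simp add: algebra_simps) (smt (verit) zero_le_power2)
  qed
  then have "exp (- u - 2 * u\<^sup>2) \<le> 1 - u"
    using assms by (subst (asm) exp_le_cancel_iff[symmetric]) (simp add: exp_ln)
  moreover have "exp (u + 2 * u\<^sup>2) * exp (- u - 2 * u\<^sup>2) = 1"
    by (simp flip: exp_add)
  ultimately have "1 \<le> exp (u + 2 * u\<^sup>2) * (1 - u)"
    by (metis exp_ge_zero mult_left_mono)
  then show ?thesis using assms by (simp add: pos_divide_le_eq)
qed

text \<open>Here \<open>f\<close> is a column of the transition matrix, and \<open>G\<close> will be
  \<open>l\<close> times the exponent that bounds one centred and tilted gap, with
  \<open>L = l\<close>. The quadratic part comes from the randomness of the gaps and has mean
  \<open>2 * \<kappa>\<^sup>2 * (v + m\<^sup>2) / L\<close>; the condition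
  \<open>m\<^sup>2 \<le> L * v\<close> brings it down to the order of the variance term.\<close>

lemma exp_moment:
  fixes s \<kappa> L b m v :: real
  assumes S: "finite S" and \<pi>: "prob_dist S \<pi>"
    and f: "\<And>y. y \<in> S \<Longrightarrow> 0 \<le> f y" "\<And>y. y \<in> S \<Longrightarrow> f y \<le> b"
    and m: "m = (\<Sum>y\<in>S. \<pi> y * f y)" and v: "v = (\<Sum>y\<in>S. \<pi> y * (f y - m)\<^sup>2)"
    and s: "\<bar>s\<bar> = 1" and \<kappa>: "0 \<le> \<kappa>" "\<kappa> * b \<le> 1 / 8" and L: "1 \<le> L" "m\<^sup>2 \<le> L * v"
  defines "G \<equiv> \<lambda>y. s * \<kappa> * (f y - m) + 2 * \<kappa>\<^sup>2 * (f y)\<^sup>2 / L"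
  shows "\<And>y. y \<in> S \<Longrightarrow> \<bar>G y\<bar> \<le> 1" and "(\<Sum>y\<in>S. \<pi> y * exp (G y)) \<le> 1 + 8 * \<kappa>\<^sup>2 * v"
proof -
  have \<pi>0: "\<And>y. y \<in> S \<Longrightarrow> 0 \<le> \<pi> y" and \<pi>1: "(\<Sum>y\<in>S. \<pi> y) = 1"
    using \<pi> by (auto simp: prob_dist_def)
  have m0: "0 \<le> m" unfolding m using f \<pi>0 by (intro sum_nonneg) auto
  have "m \<le> (\<Sum>y\<in>S. \<pi> y * b)" unfolding m using f \<pi>0 by (intro sum_mono mult_left_mono) auto
  then have mb: "m \<le> b" using \<pi>1 by (simp flip: sum_distrib_right)
  have v0: "0 \<le> v" unfolding v using \<pi>0 by (intro sum_nonneg) auto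
  have \<kappa>f: "0 \<le> \<kappa> * f y" "\<kappa> * f y \<le> 1 / 8" if "y \<in> S" for y
    using f[OF that] \<kappa> mult_left_mono[of "f y" b \<kappa>] by auto
  have \<kappa>f2: "\<kappa>\<^sup>2 * (f y)\<^sup>2 \<le> 1 / 64" if "y \<in> S" for y
    using power_mono[OF \<kappa>f(2,1)[OF that], of 2] by (simp add: power_mult_distrib power_divide)
  have dev: "\<bar>\<kappa> * (f y - m)\<bar> \<le> 1 / 8" if "y \<in> S" for y
  proof -
    have "\<bar>f y - m\<bar> \<le> b" using f[OF that] m0 mb by auto
    then have "\<kappa> * \<bar>f y - m\<bar> \<le> \<kappa> * b" using \<kappa> by (intro mult_left_mono)
    then show ?thesis using \<kappa> by (simp add: abs_mult)
  qed
  define q where "q y = \<kappa>\<^sup>2 * (f y)\<^sup>2 / L" for y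
  have q: "0 \<le> q y" "q y \<le> 1 / 64" if "y \<in> S" for y
  proof -
    show "0 \<le> q y" using L by (simp add: q_def)
    have "q y \<le> \<kappa>\<^sup>2 * (f y)\<^sup>2 / 1" unfolding q_def using L by (intro divide_left_mono) auto
    then show "q y \<le> 1 / 64" using \<kappa>f2[OF that] by simp
  qed
  have G: "G y = s * (\<kappa> * (f y - m)) + 2 * q y" for y by (simp add: G_def q_def)
  have sd: "\<bar>s * (\<kappa> * (f y - m))\<bar> \<le> 1 / 8" if "y \<in> S" for y
    using dev[OF that] by (simp add: abs_mult s)
  show G1: "\<bar>G y\<bar> \<le> 1" if "y \<in> S" for y
    using sd[OF that] q[OF that] unfolding G by linarith
  \<comment> \<open>The square of a sum is at most twice the sum of the squares, and
    \<open>q y \<le> 1 / 64\<close> makes the square of \<open>2 * q y\<close> at most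
    \<open>q y / 16\<close>.\<close>
  have G2: "(G y)\<^sup>2 \<le> 2 * (\<kappa>\<^sup>2 * (f y - m)\<^sup>2) + q y / 8" if "y \<in> S" for y
  proof -
    have "(G y)\<^sup>2 \<le> 2 * (s * (\<kappa> * (f y - m)))\<^sup>2 + 2 * (2 * q y)\<^sup>2"
      unfolding G using zero_le_power2[of "s * (\<kappa> * (f y - m)) - 2 * q y"]
      by (simp add: power2_sum power2_diff)
    also have "(s * (\<kappa> * (f y - m)))\<^sup>2 = \<kappa>\<^sup>2 * (f y - m)\<^sup>2"
      using s by (simp add: power_mult_distrib flip: power2_abs[of s])
    also have "(2 * q y)\<^sup>2 \<le> q y / 16"
      using mult_left_mono[OF q(2)[OF that] q(1)[OF that]] by (simp add: power2_eq_square)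
    finally show ?thesis by simp
  qed
  have "(\<Sum>y\<in>S. \<pi> y * exp (G y)) \<le> (\<Sum>y\<in>S. \<pi> y * (1 + G y + (2 * (\<kappa>\<^sup>2 * (f y - m)\<^sup>2) + q y / 8)))"
  proof (intro sum_mono mult_left_mono \<pi>0)
    fix y assume "y \<in> S"
    then show "exp (G y) \<le> 1 + G y + (2 * (\<kappa>\<^sup>2 * (f y - m)\<^sup>2) + q y / 8)"
      using exp_le_quadratic[OF G1] G2 by fastforce
  qed
  \<comment> \<open>The linear term vanishes because \<open>m\<close> is the mean. The coefficient
    17/8 collects 2 from \<open>G\<close> itself and 1/8 from the bound on its square.\<close>
  also have "\<dots> = (\<Sum>y\<in>S. \<pi> y) + s * \<kappa> * ((\<Sum>y\<in>S. \<pi> y * f y) - m * (\<Sum>y\<in>S. \<pi> y))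
      + 2 * \<kappa>\<^sup>2 * (\<Sum>y\<in>S. \<pi> y * (f y - m)\<^sup>2) + 17 / 8 * (\<Sum>y\<in>S. \<pi> y * q y)"
    unfolding G by (simp add: distrib_left right_diff_distrib sum.distrib sum_subtractf sum_distrib_left mult_ac)
  also have "\<dots> = 1 + 2 * \<kappa>\<^sup>2 * v + 17 / 8 * (\<Sum>y\<in>S. \<pi> y * q y)"
    using \<pi>1 by (simp add: v flip: m)
  also have "(\<Sum>y\<in>S. \<pi> y * q y) = \<kappa>\<^sup>2 / L * (\<Sum>y\<in>S. \<pi> y * (f y)\<^sup>2)"
    by (simp add: q_def sum_distrib_left mult_ac)
  also have "(\<Sum>y\<in>S. \<pi> y * (f y)\<^sup>2) = v + m\<^sup>2"
  proof -
    have "v = (\<Sum>y\<in>S. \<pi> y * (f y)\<^sup>2 - 2 * m * (\<pi> y * f y) + m\<^sup>2 * \<pi> y)"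
      unfolding v by (intro sum.cong refl) (simp add: power2_eq_square algebra_simps)
    also have "\<dots> = (\<Sum>y\<in>S. \<pi> y * (f y)\<^sup>2) - 2 * m * m + m\<^sup>2"
      using \<pi>1 by (simp add: sum.distrib sum_subtractf m flip: sum_distrib_left)
    finally show ?thesis by (simp add: power2_eq_square)
  qed
  \<comment> \<open>Both \<open>v\<close> and \<open>m\<^sup>2\<close> are at most
    \<open>L * v\<close>.\<close>
  also have "\<kappa>\<^sup>2 / L * (v + m\<^sup>2) \<le> \<kappa>\<^sup>2 * (2 * v)"
  proof -
    have "v \<le> L * v" using L v0 by (simp add: mult_le_cancel_right1)
    then have "(v + m\<^sup>2) / L \<le> 2 * v" using L by (simp add: pos_divide_le_eq mult.commute)
    then have "\<kappa>\<^sup>2 * ((v + m\<^sup>2) / L) \<le> \<kappa>\<^sup>2 * (2 * v)" by (intro mult_left_mono) auto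
    then show ?thesis by simp
  qed
  finally have "(\<Sum>y\<in>S. \<pi> y * exp (G y)) \<le> 1 + 2 * \<kappa>\<^sup>2 * v + 17 / 8 * (\<kappa>\<^sup>2 * (2 * v))" by simp
  also have "\<dots> \<le> 1 + 8 * \<kappa>\<^sup>2 * v"
    using mult_nonneg_nonneg[OF zero_le_power2[of \<kappa>] v0] by (simp add: algebra_simps)
  finally show "(\<Sum>y\<in>S. \<pi> y * exp (G y)) \<le> 1 + 8 * \<kappa>\<^sup>2 * v" .
qed

section \<open>Chernoff bounds for gap sums and loads\<close>

lemma chernoff:
  assumes Y: "Y \<in> borel_measurable clock_seq" and \<theta>: "0 \<le> \<theta>"
    and C: "(\<integral>\<^sup>+ \<omega>. ennreal (exp (\<theta> * Y \<omega>)) \<partial>clock_seq) \<le> ennreal C" "0 \<le> C"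
  shows "measure clock_seq {\<omega> \<in> space clock_seq. a \<le> Y \<omega>} \<le> exp (- \<theta> * a) * C"
proof -
  have "emeasure clock_seq {\<omega> \<in> space clock_seq. a \<le> Y \<omega>} \<le> emeasure clock_seq ({\<omega> \<in> space clock_seq. 1 \<le> ennreal (exp (- \<theta> * a)) * ennreal (exp (\<theta> * Y \<omega>))})"
  proof (rule emeasure_mono)
    show "{\<omega> \<in> space clock_seq. a \<le> Y \<omega>} \<subseteq> {\<omega> \<in> space clock_seq. 1 \<le> ennreal (exp (- \<theta> * a)) * ennreal (exp (\<theta> * Y \<omega>))}"
    proof safe
      fix \<omega> assume "a \<le> Y \<omega>"
      then have "0 \<le> - \<theta> * a + \<theta> * Y \<omega>" using mult_left_mono[OF _ \<theta>] by simp
      then have "1 \<le> exp (- \<theta> * a) * exp (\<theta> * Y \<omega>)" unfolding exp_add[symmetric] by simp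
      then have "ennreal 1 \<le> ennreal (exp (- \<theta> * a) * exp (\<theta> * Y \<omega>))" by (rule ennreal_leI)
      then show "1 \<le> ennreal (exp (- \<theta> * a)) * ennreal (exp (\<theta> * Y \<omega>))"
        by (simp only: ennreal_mult'' ennreal_1 exp_ge_zero)
    qed
    show "{\<omega> \<in> space clock_seq. 1 \<le> ennreal (exp (- \<theta> * a)) * ennreal (exp (\<theta> * Y \<omega>))} \<in> sets clock_seq"
      using Y by measurable
  qed
  also have "\<dots> \<le> ennreal (exp (- \<theta> * a)) * (\<integral>\<^sup>+ \<omega>. ennreal (exp (\<theta> * Y \<omega>)) * indicator (space clock_seq) \<omega> \<partial>clock_seq)"
    using Y nn_integral_Markov_inequality[of "\<lambda>\<omega>. ennreal (exp (\<theta> * Y \<omega>))" "space clock_seq" clock_seq "ennreal (exp (- \<theta> * a))"] by auto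
  also have "\<dots> = ennreal (exp (- \<theta> * a)) * (\<integral>\<^sup>+ \<omega>. ennreal (exp (\<theta> * Y \<omega>)) \<partial>clock_seq)"
    by (intro arg_cong[where f = "(*) _"] nn_integral_cong) simp
  also have "\<dots> \<le> ennreal (exp (- \<theta> * a)) * ennreal C"
    by (intro mult_left_mono C) simp
  also have "\<dots> = ennreal (exp (- \<theta> * a) * C)"
    using C by (simp add: ennreal_mult)
  finally show ?thesis
    using C(2) by (simp add: seq.P.emeasure_eq_measure)
qed

lemma nn_integral_expo_exp_le:
  assumes "\<bar>u\<bar> \<le> 1 / 2"
  shows "(\<integral>\<^sup>+ t. ennreal (exp (u * t)) \<partial>expo) \<le> ennreal (exp (u + 2 * u\<^sup>2))"
proof -
  have "u < 1" using assms by auto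
  then show ?thesis
    using inverse_one_minus_le_exp[OF assms] by (subst nn_integral_expo_exp) (auto intro: ennreal_leI)
qed

context clock_chain
begin

lemma measurable_load: "(\<lambda>\<omega>. gap i \<omega> * rate i \<omega> z) \<in> borel_measurable clock_seq"
  by (intro borel_measurable_times measurable_gap measurable_rate)

lemma clock_sum_tail:
  assumes s: "\<bar>s\<bar> = 1" and \<theta>: "0 \<le> \<theta>" "\<theta> \<le> 1 / 2"
  shows "measure clock_seq {\<omega> \<in> space clock_seq. a \<le> s * (\<Sum>i<n. gap i \<omega>)}
    \<le> exp (- \<theta> * a + real n * (s * \<theta> + 2 * \<theta>\<^sup>2))"
proof -
  have s2: "s\<^sup>2 = 1" using s power2_abs[of s] by simp
  have "(\<integral>\<^sup>+ \<omega>. ennreal (exp (\<theta> * (s * (\<Sum>i<n. gap i \<omega>)))) \<partial>clock_seq)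
    = (\<integral>\<^sup>+ \<omega>. (\<Prod>i<n. ennreal (exp (s * \<theta> * gap i \<omega>))) \<partial>clock_seq)"
    by (intro nn_integral_cong) (simp add: prod_ennreal sum_distrib_left mult_ac flip: exp_sum)
  also have "\<dots> = path_expectation S p n (\<lambda>i w t y. ennreal (exp (s * \<theta> * t))) \<nu>"
    by (rule expectation_prod[of "\<lambda>i w t y. ennreal (exp (s * \<theta> * t))"]) simp
  also have "\<dots> \<le> ennreal (exp (s * \<theta> + 2 * (s * \<theta>)\<^sup>2) ^ n)"
    using \<theta> s by (intro path_expectation_le_power[OF S p] nn_integral_expo_exp_le \<nu>) (auto simp: abs_mult)
  finally have "measure clock_seq {\<omega> \<in> space clock_seq. a \<le> s * (\<Sum>i<n. gap i \<omega>)}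
      \<le> exp (- \<theta> * a) * exp (s * \<theta> + 2 * (s * \<theta>)\<^sup>2) ^ n"
    by (intro chernoff \<theta> borel_measurable_times borel_measurable_const borel_measurable_sum measurable_gap) auto
  also have "\<dots> = exp (- \<theta> * a) * exp (real n * (s * \<theta> + 2 * (s * \<theta>)\<^sup>2))"
    by (simp only: exp_of_nat_mult)
  also have "(s * \<theta>)\<^sup>2 = \<theta>\<^sup>2"
    unfolding power_mult_distrib s2 by simp
  also have "exp (- \<theta> * a) * exp (real n * (s * \<theta> + 2 * \<theta>\<^sup>2)) = exp (- \<theta> * a + real n * (s * \<theta> + 2 * \<theta>\<^sup>2))"
    by (simp only: exp_add)
  finally show ?thesis .
qed

lemma first_clock_tail:
  "measure clock_seq {\<omega> \<in> space clock_seq. a \<le> gap 0 \<omega>} \<le> 2 * exp (- a / 2)"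
proof -
  have "(\<integral>\<^sup>+ \<omega>. ennreal (exp (1 / 2 * gap 0 \<omega>)) \<partial>clock_seq)
    = (\<integral>\<^sup>+ \<omega>. (\<Prod>i<Suc 0. ennreal (exp (1 / 2 * gap i \<omega>))) \<partial>clock_seq)"
    by simp
  also have "\<dots> = path_expectation S p (Suc 0) (\<lambda>i w t y. ennreal (exp (1 / 2 * t))) \<nu>"
    by (rule expectation_prod[of "\<lambda>i w t y. ennreal (exp (1 / 2 * t))"]) simp
  also have "\<dots> \<le> ennreal (2 ^ Suc 0)"
    using nn_integral_expo_exp[of "1 / 2"] by (intro path_expectation_le_power[OF S p] \<nu>) auto
  finally have "measure clock_seq {\<omega> \<in> space clock_seq. a \<le> gap 0 \<omega>} \<le> exp (- (1 / 2) * a) * 2"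
    by (intro chernoff measurable_gap) auto
  then show ?thesis by simp
qed

text \<open>The Chernoff parameter is \<open>\<kappa> / real l\<close>, because the separation into
  residue classes multiplies it by \<open>l\<close> and the moment bound is then needed at
  \<open>\<kappa>\<close>. Replacing the \<open>l\<close>-step transition by \<open>\<pi>\<close>
  costs the factor \<open>1 + \<delta>\<close> per block. The sign \<open>s\<close> selects the
  upper or the lower tail.\<close>

lemma chain_tail:
  fixes s \<kappa> \<delta> B v :: real and l :: nat
  assumes \<pi>: "invariant_dist S p \<pi>" and z: "z \<in> S"
    and B: "\<And>x. x \<in> S \<Longrightarrow> p x z \<le> B"
    and v: "v = (\<Sum>x\<in>S. \<pi> x * (p x z - \<pi> z)\<^sup>2)"
    and s: "\<bar>s\<bar> = 1" and \<kappa>: "0 \<le> \<kappa>" "\<kappa> * B \<le> 1 / 8" and l: "0 < l" "(\<pi> z)\<^sup>2 \<le> real l * v"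
    and \<delta>: "0 \<le> \<delta>" "\<And>x y. x \<in> S \<Longrightarrow> y \<in> S \<Longrightarrow> mpow S p l x y \<le> (1 + \<delta>) * \<pi> y"
  shows "measure clock_seq {\<omega> \<in> space clock_seq. a \<le> s * (\<Sum>i<n. gap (Suc i) \<omega> * rate (Suc i) \<omega> z - \<pi> z)}
    \<le> exp (- (\<kappa> / real l) * a + 1 + (8 * \<kappa>\<^sup>2 * v + \<delta>) * (real n / real l))"
proof -
  define \<theta> where "\<theta> = \<kappa> / real l"
  have pz: "0 \<le> p x z" if "x \<in> S" for x using p_nonneg[OF S p that z] .
  have \<pi>': "prob_dist S \<pi>" "\<pi> z = (\<Sum>x\<in>S. \<pi> x * p x z)"
    using \<pi> z by (auto simp: invariant_dist_def)
  have v0: "0 \<le> v" unfolding v using \<pi>' by (intro sum_nonneg) (auto simp: prob_dist_def)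
  have \<theta>: "0 \<le> \<theta>" "\<theta> \<le> \<kappa>" "\<kappa> = real l * \<theta>"
    using \<kappa> l by (auto simp: \<theta>_def pos_divide_le_eq mult_le_cancel_left1)
  have \<theta>p: "\<bar>s * \<theta> * p x z\<bar> \<le> 1 / 2" if "x \<in> S" for x
  proof -
    have "\<theta> * p x z \<le> \<kappa> * B" using \<theta> \<kappa> B[OF that] pz[OF that] by (intro mult_mono) auto
    then show ?thesis using s \<kappa> \<theta> pz[OF that] by (simp add: abs_mult)
  qed
  define g where "g x = s * \<theta> * (p x z - \<pi> z) + 2 * \<theta>\<^sup>2 * (p x z)\<^sup>2" for x
  \<comment> \<open>The factor of step 0 is 1: the sum leaves out the first step, whose rates are
    \<open>\<nu>\<close>.\<close>
  define \<psi> where "\<psi> i w t y = (if i = 0 then 1 else ennreal (exp (s * \<theta> * (t * w z - \<pi> z))))"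
    for i :: nat and w t and y :: 'a
  have lg: "real l * g y = s * \<kappa> * (p y z - \<pi> z) + 2 * \<kappa>\<^sup>2 * (p y z)\<^sup>2 / real l" for y
    using l unfolding g_def \<theta>(3) by (simp add: field_simps power2_eq_square)
  note mom = exp_moment[OF S \<pi>'(1) pz B \<pi>'(2) v s \<kappa> _ l(2), folded lg]
  have s2: "s\<^sup>2 = 1" using s power2_abs[of s] by simp
  have m1: "(\<Sum>y\<in>S. mpow S p l x y * exp (real l * g y)) \<le> exp (8 * \<kappa>\<^sup>2 * v + \<delta>)" if x: "x \<in> S" for x
  proof -
    have "(\<Sum>y\<in>S. mpow S p l x y * exp (real l * g y)) \<le> (\<Sum>y\<in>S. (1 + \<delta>) * \<pi> y * exp (real l * g y))"
      using \<delta>(2)[OF x] by (intro sum_mono mult_right_mono) auto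
    also have "\<dots> = (1 + \<delta>) * (\<Sum>y\<in>S. \<pi> y * exp (real l * g y))"
      by (simp add: sum_distrib_left mult_ac)
    also have "\<dots> \<le> (1 + \<delta>) * (1 + 8 * \<kappa>\<^sup>2 * v)"
      using \<delta> l by (intro mult_left_mono mom) auto
    also have "\<dots> \<le> exp \<delta> * exp (8 * \<kappa>\<^sup>2 * v)"
      using \<delta> v0 by (intro mult_mono exp_ge_add_one_self) auto
    finally show ?thesis by (simp add: exp_add mult.commute)
  qed
  have "(\<integral>\<^sup>+ \<omega>. ennreal (exp (\<theta> * (s * (\<Sum>i<n. gap (Suc i) \<omega> * rate (Suc i) \<omega> z - \<pi> z)))) \<partial>clock_seq)
    = (\<integral>\<^sup>+ \<omega>. (\<Prod>i<Suc n. \<psi> i (rate i \<omega>) (gap i \<omega>) (state i \<omega>)) \<partial>clock_seq)"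
  proof (intro nn_integral_cong)
    fix \<omega>
    have "exp (\<theta> * (s * (\<Sum>i<n. gap (Suc i) \<omega> * rate (Suc i) \<omega> z - \<pi> z)))
      = (\<Prod>i<n. exp (s * \<theta> * (gap (Suc i) \<omega> * rate (Suc i) \<omega> z - \<pi> z)))"
      by (simp add: sum_distrib_left mult_ac flip: exp_sum)
    then show "ennreal (exp (\<theta> * (s * (\<Sum>i<n. gap (Suc i) \<omega> * rate (Suc i) \<omega> z - \<pi> z))))
       = (\<Prod>i<Suc n. \<psi> i (rate i \<omega>) (gap i \<omega>) (state i \<omega>))"
      unfolding prod.lessThan_Suc_shift by (simp add: \<psi>_def prod_ennreal)
  qed
  also have "\<dots> = path_expectation S p (Suc n) \<psi> \<nu>"
    by (rule expectation_prod) (simp add: \<psi>_def)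
  also have "\<dots> \<le> ennreal (1 * chain_expectation S p n (\<lambda>i y. exp (g y)) \<nu>)"
  proof (rule path_expectation_le_chain_expectation[OF S p])
    fix i x and y :: 'a assume x: "x \<in> S"
    have "(\<integral>\<^sup>+ t. \<psi> (Suc i) (p x) t y \<partial>expo)
      = (\<integral>\<^sup>+ t. ennreal (exp (- (s * \<theta> * \<pi> z))) * ennreal (exp (s * \<theta> * p x z * t)) \<partial>expo)"
      by (intro nn_integral_cong) (simp add: \<psi>_def algebra_simps flip: ennreal_mult'' exp_add)
    also have "\<dots> = ennreal (exp (- (s * \<theta> * \<pi> z))) * (\<integral>\<^sup>+ t. ennreal (exp (s * \<theta> * p x z * t)) \<partial>expo)"
      by (rule nn_integral_cmult) simp
    also have "\<dots> \<le> ennreal (exp (- (s * \<theta> * \<pi> z))) * ennreal (exp (s * \<theta> * p x z + 2 * (s * \<theta> * p x z)\<^sup>2))"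
      by (intro mult_left_mono nn_integral_expo_exp_le \<theta>p x) simp
    also have "\<dots> = ennreal (exp (g x))"
      by (simp add: g_def power_mult_distrib s2 algebra_simps flip: ennreal_mult'' exp_add)
    finally show "(\<integral>\<^sup>+ t. \<psi> (Suc i) (p x) t y \<partial>expo) \<le> ennreal (exp (g x))" .
  next
    show "(\<integral>\<^sup>+ t. \<psi> 0 \<nu> t y \<partial>expo) \<le> ennreal 1" for y
      using expo.emeasure_space_1 by (simp add: \<psi>_def)
  qed (use \<nu> in auto)
  finally have E: "(\<integral>\<^sup>+ \<omega>. ennreal (exp (\<theta> * (s * (\<Sum>i<n. gap (Suc i) \<omega> * rate (Suc i) \<omega> z - \<pi> z)))) \<partial>clock_seq)
    \<le> ennreal (chain_expectation S p n (\<lambda>i y. exp (g y)) \<nu>)" by simp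
  have Q: "chain_expectation S p n (\<lambda>i y. exp (g y)) \<nu> \<le> exp 1 * exp (8 * \<kappa>\<^sup>2 * v + \<delta>) ^ (n div l)"
    using l v0 \<delta> mom(1) by (intro chain_expectation_exp_le[OF S p] m1 \<nu>) (auto simp: abs_le_iff)
  have "measure clock_seq {\<omega> \<in> space clock_seq. a \<le> s * (\<Sum>i<n. gap (Suc i) \<omega> * rate (Suc i) \<omega> z - \<pi> z)}
     \<le> exp (- \<theta> * a) * (exp 1 * exp (8 * \<kappa>\<^sup>2 * v + \<delta>) ^ (n div l))"
    by (rule chernoff[OF _ \<theta>(1) order_trans[OF E ennreal_leI[OF Q]]])
      (intro borel_measurable_times borel_measurable_const borel_measurable_sum borel_measurable_diff measurable_load, simp)
  also have "\<dots> = exp (- \<theta> * a + 1 + real (n div l) * (8 * \<kappa>\<^sup>2 * v + \<delta>))"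
    unfolding exp_of_nat_mult[symmetric] exp_add[symmetric] by (simp only: add.assoc)
  also have "\<dots> \<le> exp (- (\<kappa> / real l) * a + 1 + (8 * \<kappa>\<^sup>2 * v + \<delta>) * (real n / real l))"
  proof -
    have "(8 * \<kappa>\<^sup>2 * v + \<delta>) * real (n div l) \<le> (8 * \<kappa>\<^sup>2 * v + \<delta>) * (real n / real l)"
      using v0 \<delta>(1) by (intro mult_left_mono of_nat_div_le_of_nat) auto
    then show ?thesis
      unfolding \<theta>_def by (simp only: exp_le_cancel_iff add_left_mono mult.commute[of "real (n div l)"])
  qed
  finally show ?thesis .
qed

end

section \<open>Choice of the spacing and of the Chernoff parameter\<close>

context clock_chain
begin

lemma gap_nonneg: "\<forall>i. 0 \<le> \<omega> i \<Longrightarrow> 0 \<le> gap i \<omega>"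
  unfolding gap_def by (rule chain_gap_nonneg[OF S p \<nu>]) (auto simp: initial_clocks_def fresh_clocks_def)

text \<open>The spacing \<open>l\<close> has to be long enough for mixing and at least
  \<open>q\<close>, the squared mean over the variance. Taking a sum of the two requirements leaves
  an exponent proportional to \<open>x * real n / real l\<close>; the two terms of the bound
  correspond to which summand dominates.\<close>

lemma chain_deviation:
  fixes s \<epsilon> B v k pst :: real
  assumes \<pi>: "invariant_dist S p \<pi>" and T: "mixes_at S p \<pi> T" "1 \<le> T" and z: "z \<in> S"
    and B: "\<And>x. x \<in> S \<Longrightarrow> p x z \<le> B" "0 < B"
    and v: "v = (\<Sum>x\<in>S. \<pi> x * (p x z - \<pi> z)\<^sup>2)" "0 < v"
    and s: "\<bar>s\<bar> = 1"
    and \<epsilon>: "0 < \<epsilon>" "\<epsilon> \<le> 1 / 2" "\<epsilon> * (2 * B * \<pi> z) \<le> v"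
    and pst: "0 < pst" "pst \<le> 1" "\<And>y. y \<in> S \<Longrightarrow> pst \<le> \<pi> y"
    and k: "2 powr (- k) \<le> pst * (\<epsilon>\<^sup>2 * (\<pi> z)\<^sup>2 / v) / 6"
  shows "measure clock_seq {\<omega> \<in> space clock_seq. real n * \<epsilon> * \<pi> z / 4 \<le> s * (\<Sum>i<n. gap (Suc i) \<omega> * rate (Suc i) \<omega> z - \<pi> z)}
    \<le> 3 * (exp (- (real n * \<epsilon>\<^sup>2 / 2048)) + exp (- (\<epsilon>\<^sup>2 * (\<pi> z)\<^sup>2 / v / 14336) * (real n / (k * real T))))"
proof -
  define q where "q = (\<pi> z)\<^sup>2 / v"
  define x where "x = \<epsilon>\<^sup>2 * (\<pi> z)\<^sup>2 / v"
  have xq: "x = \<epsilon>\<^sup>2 * q" by (simp add: x_def q_def)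
  have \<pi>z: "0 < \<pi> z" using pst(1) pst(3)[OF z] by simp
  have q0: "0 < q" and x0: "0 < x" using \<pi>z v \<epsilon> by (auto simp: q_def x_def)
  have \<pi>': "prob_dist S \<pi>" "\<pi> z = (\<Sum>x\<in>S. \<pi> x * p x z)"
    using \<pi> z by (auto simp: invariant_dist_def)
  have "\<pi> z \<le> (\<Sum>x\<in>S. \<pi> x * B)"
    unfolding \<pi>'(2) using \<pi>'(1) B by (intro sum_mono mult_left_mono) (auto simp: prob_dist_def)
  then have \<pi>B: "\<pi> z \<le> B" using \<pi>'(1) by (simp add: prob_dist_def flip: sum_distrib_right)
  \<comment> \<open>This uses the upper bound on \<open>\<epsilon>\<close> together with
    \<open>\<pi> z \<le> B\<close>. It forces \<open>k\<close> to be at least 1, which later absorbs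
    the rounding of \<open>k\<close> and of \<open>q\<close>.\<close>
  have x4: "x \<le> 1 / 4"
  proof -
    have "\<epsilon>\<^sup>2 * (\<pi> z)\<^sup>2 \<le> (\<epsilon> * \<pi> z) * (\<epsilon> * B)"
      using \<epsilon> \<pi>z \<pi>B by (simp add: power2_eq_square mult_ac)
    also have "\<dots> = \<epsilon> / 2 * (\<epsilon> * (2 * B * \<pi> z))" by simp
    also have "\<dots> \<le> 1 / 4 * v" using \<epsilon> B \<pi>z by (intro mult_mono) auto
    finally show ?thesis unfolding x_def using v by (simp add: pos_divide_le_eq)
  qed
  have kx: "2 powr (- k) \<le> pst * x / 6" using k by (simp add: x_def)
  also have "\<dots> \<le> 1 * (1 / 4) / 6" using x4 pst x0 by (intro divide_right_mono mult_mono) auto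
  finally have k24: "2 powr (- k) \<le> 1 / 24" by simp
  have k1: "1 \<le> k"
  proof (rule ccontr)
    assume "\<not> 1 \<le> k"
    then have "2 powr (- 1) \<le> 2 powr (- k)" by (intro powr_mono) auto
    then show False using k24 by (simp add: powr_minus)
  qed
  define ck where "ck = nat \<lceil>k\<rceil>"
  have ck: "k \<le> real ck" "real ck \<le> k + 1"
    using k1 by (auto simp: ck_def)
  have half: "(1 / 2) ^ ck \<le> 2 powr (- k)"
  proof -
    have "(1 / 2 :: real) ^ ck = 2 powr (- real ck)"
      by (simp add: powr_minus powr_realpow power_one_over inverse_eq_divide)
    also have "\<dots> \<le> 2 powr (- k)" using ck by (intro powr_mono) auto
    finally show ?thesis .
  qed
  \<comment> \<open>The factor 3 provides three copies of the decay 2^(-k): one becomes the relative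
    error \<open>x\<close> up to a constant, and the other two make that constant small.\<close>
  define l where "l = 3 * ck * T + nat \<lceil>q\<rceil>"
  have ql: "q \<le> real l" unfolding l_def by linarith
  have l0: "0 < l" using ql q0 by (cases l) auto
  have lq: "(\<pi> z)\<^sup>2 \<le> real l * v" using ql v by (simp add: q_def pos_divide_le_eq)
  \<comment> \<open>The 7 arises as 3 + 3 + 1: three for \<open>k\<close>, three for rounding
    \<open>k\<close> up, one for rounding \<open>q\<close> up, using that \<open>real T\<close> and
    1 are at most \<open>k * real T\<close>.\<close>
  have lle: "real l \<le> 7 * (k * real T) + q"
  proof -
    have qc: "real (nat \<lceil>q\<rceil>) \<le> q + 1" using q0 by linarith
    have "real l = 3 * (real ck * real T) + real (nat \<lceil>q\<rceil>)" by (simp add: l_def)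
    also have "\<dots> \<le> 3 * ((k + 1) * real T) + (q + 1)"
      using ck qc by (intro add_mono mult_left_mono mult_right_mono) auto
    also have "\<dots> \<le> 7 * (k * real T) + q"
    proof -
      have "real T \<le> k * real T" "1 \<le> real T" using k1 T(2) by (auto simp: mult_le_cancel_right1)
      moreover have "3 * ((k + 1) * real T) = 3 * (k * real T) + 3 * real T" by (simp add: algebra_simps)
      ultimately show ?thesis by linarith
    qed
    finally show ?thesis .
  qed
  have mp: "mpow S p l x' y \<le> (1 + x / 1024) * \<pi> y" if "x' \<in> S" "y \<in> S" for x' y
  proof -
    have "mpow S p l x' y \<le> \<pi> y + (1 / 2) ^ (3 * ck)"
      by (rule mpow_near_invariant[OF S p T(1) \<pi> that]) (simp add: l_def)
    \<comment> \<open>One power is at most \<open>pst * x / 6\<close> and the other two are at most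
      1/24 each, so the product is at most \<open>pst * x / 3456\<close>.\<close>
    moreover have "(1 / 2 :: real) ^ (3 * ck) \<le> x / 1024 * \<pi> y"
    proof -
      have "(1 / 2 :: real) ^ (3 * ck) = (1 / 2) ^ ck * ((1 / 2) ^ ck * (1 / 2) ^ ck)"
        by (simp only: mult.commute[of 3] power_mult power3_eq_cube mult.assoc)
      also have "\<dots> \<le> (pst * x / 6) * (1 / 24 * (1 / 24))"
        using half kx k24 by (intro mult_mono) (auto intro: order_trans simp: pst(1) x0 less_imp_le)
      also have "\<dots> \<le> x / 1024 * pst" using pst(1) x0 by simp
      also have "\<dots> \<le> x / 1024 * \<pi> y" using pst(3)[OF that(2)] x0 by (intro mult_left_mono) auto
      finally show ?thesis .
    qed
    ultimately show ?thesis by (simp add: algebra_simps)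
  qed
  \<comment> \<open>This minimises \<open>8 * \<kappa>\<^sup>2 * v - \<kappa> * \<epsilon> * \<pi> z
    / 4\<close>, with minimum \<open>- x / 512\<close>. The mixing error \<open>x / 1024\<close>
    uses up half of this gain.\<close>
  define \<kappa> where "\<kappa> = \<epsilon> * \<pi> z / (64 * v)"
  have \<kappa>: "0 \<le> \<kappa>" "\<kappa> * B \<le> 1 / 8"
    using \<epsilon> \<pi>z v(2) by (auto simp: \<kappa>_def field_simps)
  have "measure clock_seq {\<omega> \<in> space clock_seq. real n * \<epsilon> * \<pi> z / 4 \<le> s * (\<Sum>i<n. gap (Suc i) \<omega> * rate (Suc i) \<omega> z - \<pi> z)}
    \<le> exp (- (\<kappa> / real l) * (real n * \<epsilon> * \<pi> z / 4) + 1 + (8 * \<kappa>\<^sup>2 * v + x / 1024) * (real n / real l))"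
    using x0 by (intro chain_tail[OF \<pi> z B(1) v(1) s \<kappa> l0 lq _ mp]) auto
  also have "- (\<kappa> / real l) * (real n * \<epsilon> * \<pi> z / 4) + 1 + (8 * \<kappa>\<^sup>2 * v + x / 1024) * (real n / real l)
     = 1 + - (x / 1024 * (real n / real l))"
  proof -
    have "\<kappa> * \<epsilon> * \<pi> z / 4 = x / 256" by (simp add: \<kappa>_def x_def power2_eq_square mult_ac)
    moreover have "8 * \<kappa>\<^sup>2 * v = x / 512"
      using v(2) by (simp add: \<kappa>_def x_def power2_eq_square mult_ac)
    moreover have "- (\<kappa> / real l) * (real n * \<epsilon> * \<pi> z / 4) = - (\<kappa> * \<epsilon> * \<pi> z / 4) * (real n / real l)"
      by (simp add: mult_ac)
    ultimately show ?thesis by (simp only:) (simp add: algebra_simps)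
  qed
  also have "exp (1 + - (x / 1024 * (real n / real l))) \<le> 3 * exp (- (x / 1024 * (real n / real l)))"
    unfolding exp_add by (intro mult_right_mono exp_le) simp
  \<comment> \<open>Either \<open>l\<close> is at most 14 times \<open>k * real T\<close>, and 14336
    is 14 times 1024, or \<open>l\<close> is at most \<open>2 * q\<close>, where
    \<open>x / q\<close> equals \<open>\<epsilon>\<^sup>2\<close>.\<close>
  also have "exp (- (x / 1024 * (real n / real l))) \<le> exp (- (real n * \<epsilon>\<^sup>2 / 2048)) + exp (- (x / 14336) * (real n / (k * real T)))"
  proof (cases "q \<le> 7 * (k * real T)")
    case True
    have kT: "0 < k * real T" using k1 T(2) by simp
    have "real n / (14 * (k * real T)) \<le> real n / real l"
      using lle True l0 by (intro divide_left_mono) auto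
    then have "x / 1024 * (real n / (14 * (k * real T))) \<le> x / 1024 * (real n / real l)"
      using x0 by (intro mult_left_mono) auto
    then have "exp (- (x / 1024 * (real n / real l))) \<le> exp (- (x / 14336) * (real n / (k * real T)))"
      by simp
    then show ?thesis by (simp add: add_increasing)
  next
    case False
    have "real n / (2 * q) \<le> real n / real l"
      using lle False l0 q0 by (intro divide_left_mono) auto
    then have "x / 1024 * (real n / (2 * q)) \<le> x / 1024 * (real n / real l)"
      using x0 by (intro mult_left_mono) auto
    then have "exp (- (x / 1024 * (real n / real l))) \<le> exp (- (real n * \<epsilon>\<^sup>2 / 2048))"
      using q0 by (simp add: xq mult.commute)
    then show ?thesis by (simp add: add_increasing2)
  qed
  finally show ?thesis by (simp add: x_def)
qed

end

section \<open>Gap sums of the i.i.d. sequence\<close>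

lemma clock_sum_upper:
  assumes "clock_chain S (\<lambda>_. \<pi>) \<pi> h N" and \<epsilon>: "0 < \<epsilon>" "\<epsilon> \<le> 1 / 2"
  shows "measure clock_seq {\<omega> \<in> space clock_seq. real n * (1 - \<epsilon> / 2) \<le> (\<Sum>i\<le>nat \<lfloor>real n * (1 - \<epsilon>)\<rfloor>. clock_chain.gap S (\<lambda>_. \<pi>) \<pi> h N b i \<omega>)}
    \<le> 3 * exp (- (real n * \<epsilon>\<^sup>2 / 64))"
proof -
  interpret U: clock_chain S "\<lambda>_. \<pi>" \<pi> h N b by fact
  \<comment> \<open>Indices from 0 to the integer part make one gap more than the integer part. This
    surplus gap accounts for the summand 1 in the exponent, and so for the factor 3.\<close>
  define m where "m = Suc (nat \<lfloor>real n * (1 - \<epsilon>)\<rfloor>)"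
  have m: "real m \<le> real n * (1 - \<epsilon>) + 1"
    using \<epsilon> by (simp add: m_def)
  \<comment> \<open>The parameter \<open>\<epsilon> / 16\<close> gains n \<epsilon>^2 / 32 from the
    deviation and loses at most n \<epsilon>^2 / 128 to the quadratic term, apart from the surplus
    gap.\<close>
  have "measure clock_seq {\<omega> \<in> space clock_seq. real n * (1 - \<epsilon> / 2) \<le> 1 * (\<Sum>i<m. U.gap i \<omega>)}
    \<le> exp (- (\<epsilon> / 16) * (real n * (1 - \<epsilon> / 2)) + real m * (1 * (\<epsilon> / 16) + 2 * (\<epsilon> / 16)\<^sup>2))"
    using \<epsilon> by (intro U.clock_sum_tail) auto
  also have "\<dots> \<le> exp (1 + - (real n * \<epsilon>\<^sup>2 / 64))"
  proof -
    have "real m * (1 * (\<epsilon> / 16) + 2 * (\<epsilon> / 16)\<^sup>2) \<le> (real n * (1 - \<epsilon>) + 1) * (1 * (\<epsilon> / 16) + 2 * (\<epsilon> / 16)\<^sup>2)"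
      using m \<epsilon> by (intro mult_right_mono) auto
    moreover have "(real n * (1 - \<epsilon>) + 1) * (1 * (\<epsilon> / 16) + 2 * (\<epsilon> / 16)\<^sup>2)
      = \<epsilon> / 16 * (real n * (1 - \<epsilon> / 2)) - real n * \<epsilon>\<^sup>2 / 32 + real n * \<epsilon>\<^sup>2 / 128 - \<epsilon> * (real n * \<epsilon>\<^sup>2) / 128 + (\<epsilon> / 16 + \<epsilon>\<^sup>2 / 128)"
      by (simp add: field_simps power2_eq_square)
    moreover have "0 \<le> real n * \<epsilon>\<^sup>2" "0 \<le> \<epsilon> * (real n * \<epsilon>\<^sup>2)" using \<epsilon> by auto
    moreover have "\<epsilon>\<^sup>2 \<le> 1" using \<epsilon> by (intro power_le_one) auto
    ultimately show ?thesis using \<epsilon> unfolding exp_le_cancel_iff mult_minus_left by linarith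
  qed
  also have "\<dots> \<le> 3 * exp (- (real n * \<epsilon>\<^sup>2 / 64))"
    unfolding exp_add by (intro mult_right_mono exp_le) simp
  finally show ?thesis by (simp add: m_def lessThan_Suc_atMost)
qed

lemma clock_sum_lower:
  assumes "clock_chain S (\<lambda>_. \<pi>) \<pi> h N" and \<epsilon>: "0 < \<epsilon>" "\<epsilon> \<le> 1 / 2"
  shows "measure clock_seq {\<omega> \<in> space clock_seq. (\<Sum>i\<le>nat \<lfloor>real n * (1 + \<epsilon>)\<rfloor>. clock_chain.gap S (\<lambda>_. \<pi>) \<pi> h N b i \<omega>) \<le> real n * (1 + \<epsilon> / 2)}
    \<le> exp (- (real n * \<epsilon>\<^sup>2 / 64))"
proof -
  interpret U: clock_chain S "\<lambda>_. \<pi>" \<pi> h N b by fact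
  \<comment> \<open>For the lower tail the surplus gap helps: it compensates the rounding down, and
    no constant factor appears.\<close>
  define m where "m = Suc (nat \<lfloor>real n * (1 + \<epsilon>)\<rfloor>)"
  have m: "real n * (1 + \<epsilon>) \<le> real m"
    using \<epsilon> by (simp add: m_def) linarith
  have "measure clock_seq {\<omega> \<in> space clock_seq. - (real n * (1 + \<epsilon> / 2)) \<le> - 1 * (\<Sum>i<m. U.gap i \<omega>)}
    \<le> exp (- (\<epsilon> / 16) * - (real n * (1 + \<epsilon> / 2)) + real m * (- 1 * (\<epsilon> / 16) + 2 * (\<epsilon> / 16)\<^sup>2))"
    using \<epsilon> by (intro U.clock_sum_tail) auto
  also have "\<dots> \<le> exp (- (real n * \<epsilon>\<^sup>2 / 64))"
  proof -
    have "\<epsilon> * \<epsilon> \<le> \<epsilon> * 1" using \<epsilon> by (intro mult_left_mono) auto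
    then have "- 1 * (\<epsilon> / 16) + 2 * (\<epsilon> / 16)\<^sup>2 \<le> 0" using \<epsilon> by (simp add: power2_eq_square)
    then have "real m * (- 1 * (\<epsilon> / 16) + 2 * (\<epsilon> / 16)\<^sup>2) \<le> (real n * (1 + \<epsilon>)) * (- 1 * (\<epsilon> / 16) + 2 * (\<epsilon> / 16)\<^sup>2)"
      using m by (intro mult_right_mono_neg) auto
    moreover have "(real n * (1 + \<epsilon>)) * (- 1 * (\<epsilon> / 16) + 2 * (\<epsilon> / 16)\<^sup>2)
      = - (\<epsilon> / 16) * (real n * (1 + \<epsilon> / 2)) - real n * \<epsilon>\<^sup>2 / 32 + real n * \<epsilon>\<^sup>2 / 128 + \<epsilon> * (real n * \<epsilon>\<^sup>2) / 128"
      by (simp add: field_simps power2_eq_square)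
    moreover have "\<epsilon> * (real n * \<epsilon>\<^sup>2) \<le> 1 / 2 * (real n * \<epsilon>\<^sup>2)" using \<epsilon> by (intro mult_right_mono) auto
    moreover have "0 \<le> real n * \<epsilon>\<^sup>2" by simp
    ultimately show ?thesis unfolding exp_le_cancel_iff mult_minus_left mult_minus_right minus_minus by linarith
  qed
  finally show ?thesis by (simp add: m_def lessThan_Suc_atMost)
qed

section \<open>The coupling\<close>

text \<open>This part is deterministic. Both ranges are decided by the same thresholds, so they are
  nested once the loads are separated by n (1 - \<epsilon>/2) \<pi>(z) and n (1 + \<epsilon>/2)
  \<pi>(z). Thresholds and visits are linked by weak inequalities only; the strict bounds on the
  load of the chain exclude ties.\<close>

lemma bad_event_subset:
  fixes \<epsilon> :: real
  assumes C: "clock_chain S p \<nu> h N" and U: "clock_chain S (\<lambda>_. \<pi>) \<pi> h N"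
    and \<pi>: "\<And>z. z \<in> S \<Longrightarrow> 0 < \<pi> z" and \<epsilon>: "0 < \<epsilon>" "\<epsilon> \<le> 1 / 2" and \<omega>: "\<forall>i. 0 \<le> \<omega> i"
    and bad: "\<not> good_event n \<epsilon> (clock_chain.state S p \<nu> h N 0) (clock_chain.state S (\<lambda>_. \<pi>) \<pi> h N (Suc 0)) \<omega>"
    and B1: "(\<Sum>i\<le>nat \<lfloor>real n * (1 - \<epsilon>)\<rfloor>. clock_chain.gap S (\<lambda>_. \<pi>) \<pi> h N (Suc 0) i \<omega>) < real n * (1 - \<epsilon> / 2)"
    and B2: "real n * (1 + \<epsilon> / 2) < (\<Sum>i\<le>nat \<lfloor>real n * (1 + \<epsilon>)\<rfloor>. clock_chain.gap S (\<lambda>_. \<pi>) \<pi> h N (Suc 0) i \<omega>)"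
    and B3: "\<And>z. z \<in> S \<Longrightarrow> 0 < \<nu> z \<Longrightarrow> clock_chain.gap S p \<nu> h N 0 0 \<omega> < real n * \<epsilon> * \<pi> z / (4 * \<nu> z)"
  shows "\<exists>z\<in>S. \<exists>s\<in>{1, -1}. real n * \<epsilon> * \<pi> z / 4 \<le> s * (\<Sum>i<n. clock_chain.gap S p \<nu> h N 0 (Suc i) \<omega>
      * clock_chain.rate S p \<nu> h N 0 (Suc i) \<omega> z - \<pi> z)"
proof (rule ccontr)
  interpret Z: clock_chain S p \<nu> h N 0 by fact
  interpret U: clock_chain S "\<lambda>_. \<pi>" \<pi> h N "Suc 0" by fact
  assume "\<not> ?thesis"
  then have dev: "s * (\<Sum>i<n. Z.gap (Suc i) \<omega> * Z.rate (Suc i) \<omega> z - \<pi> z) < real n * \<epsilon> * \<pi> z / 4"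
    if "z \<in> S" "s \<in> {1, -1}" for z s
    using that by (meson not_le)
  \<comment> \<open>With a constant kernel the rates never change, so the loads of all states are
    multiples of one and the same gap sum.\<close>
  have UV: "U.rate i \<omega> = \<pi>" for i
    by (cases i) (simp_all only: U.rate_0 U.rate_Suc)
  have Usum: "(\<Sum>i\<le>m. U.gap i \<omega> * U.rate i \<omega> z) = (\<Sum>i\<le>m. U.gap i \<omega>) * \<pi> z" for m z
    by (simp add: UV sum_distrib_right)
  define L where "L z = (\<Sum>i\<le>n. Z.gap i \<omega> * Z.rate i \<omega> z)" for z
  define Q where "Q z = (\<Sum>i<n. Z.gap (Suc i) \<omega> * Z.rate (Suc i) \<omega> z)" for z
  have L: "L z = Z.gap 0 \<omega> * \<nu> z + Q z" for z
    by (cases n) (simp_all add: L_def Q_def Z.rate_0 sum.atMost_Suc_shift lessThan_Suc_atMost del: sum.atMost_Suc)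
  have low: "real n * (1 - \<epsilon> / 2) * \<pi> z < L z" and up: "L z < real n * (1 + \<epsilon> / 2) * \<pi> z" if z: "z \<in> S" for z
  proof -
    have a: "\<bar>Q z - real n * \<pi> z\<bar> < real n * \<epsilon> * \<pi> z / 4"
    proof -
      have "(\<Sum>i<n. Z.gap (Suc i) \<omega> * Z.rate (Suc i) \<omega> z - \<pi> z) = Q z - real n * \<pi> z"
        by (simp add: sum_subtractf Q_def)
      then show ?thesis using dev[OF z, of 1] dev[OF z, of "-1"] by (simp only: abs_less_iff) simp
    qed
    have b: "0 \<le> Z.gap 0 \<omega> * \<nu> z"
      using Z.gap_nonneg[OF \<omega>] Z.\<nu> z by (intro mult_nonneg_nonneg) (auto simp: prob_dist_def)
    have ne: "0 \<le> real n * \<epsilon> * \<pi> z" using \<epsilon> \<pi>[OF z] by simp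
    \<comment> \<open>If \<open>\<nu> z = 0\<close>, the first step adds nothing to the load of
      \<open>z\<close>, and the condition on the first gap is void.\<close>
    have c: "Z.gap 0 \<omega> * \<nu> z \<le> real n * \<epsilon> * \<pi> z / 4"
    proof (cases "0 < \<nu> z")
      case True
      then show ?thesis using B3[OF z True] by (simp add: pos_less_divide_eq)
    next
      case False
      then have "\<nu> z = 0" using Z.\<nu> z by (auto simp: prob_dist_def antisym)
      then show ?thesis using ne by simp
    qed
    have e: "real n * (1 - \<epsilon> / 2) * \<pi> z = real n * \<pi> z - real n * \<epsilon> * \<pi> z / 2"
      "real n * (1 + \<epsilon> / 2) * \<pi> z = real n * \<pi> z + real n * \<epsilon> * \<pi> z / 2"
      by (simp_all add: algebra_simps)
    show "real n * (1 - \<epsilon> / 2) * \<pi> z < L z" "L z < real n * (1 + \<epsilon> / 2) * \<pi> z"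
      using a b c ne unfolding e L by linarith+
  qed
  have "z \<in> (\<lambda>i. Z.state i \<omega>) ` {0..n}" if "z \<in> (\<lambda>i. U.state i \<omega>) ` {0..nat \<lfloor>real n * (1 - \<epsilon>)\<rfloor>}" for z
  proof (rule ccontr)
    assume c: "z \<notin> (\<lambda>i. Z.state i \<omega>) ` {0..n}"
    have z: "z \<in> S" using that U.state_in by auto
    have "L z \<le> \<omega> (h z)" using Z.visited_threshold(2)[OF \<omega> z c] by (simp add: L_def)
    also have "\<dots> \<le> (\<Sum>i\<le>nat \<lfloor>real n * (1 - \<epsilon>)\<rfloor>. U.gap i \<omega>) * \<pi> z"
      using U.visited_threshold(1)[OF \<omega> z that] by (simp only: Usum)
    also have "\<dots> \<le> real n * (1 - \<epsilon> / 2) * \<pi> z"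
      using B1 \<pi>[OF z] by (intro mult_right_mono) auto
    finally show False using low[OF z] by simp
  qed
  moreover have "z \<in> (\<lambda>i. U.state i \<omega>) ` {0..nat \<lfloor>real n * (1 + \<epsilon>)\<rfloor>}" if "z \<in> (\<lambda>i. Z.state i \<omega>) ` {0..n}" for z
  proof (rule ccontr)
    assume c: "z \<notin> (\<lambda>i. U.state i \<omega>) ` {0..nat \<lfloor>real n * (1 + \<epsilon>)\<rfloor>}"
    have z: "z \<in> S" using that Z.state_in by auto
    have "real n * (1 + \<epsilon> / 2) * \<pi> z \<le> (\<Sum>i\<le>nat \<lfloor>real n * (1 + \<epsilon>)\<rfloor>. U.gap i \<omega>) * \<pi> z"
      using B2 \<pi>[OF z] by (intro mult_right_mono) auto
    also have "\<dots> \<le> \<omega> (h z)" using U.visited_threshold(2)[OF \<omega> z c] by (simp only: Usum)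
    also have "\<dots> \<le> L z" using Z.visited_threshold(1)[OF \<omega> z that] by (simp add: L_def)
    finally show False using up[OF z] by simp
  qed
  ultimately show False using bad unfolding good_event_def by blast
qed

text \<open>A union bound over the states. The constants add up the exceptional events: 10 = 3 + 1 +
  3 + 3 for the two gap sums and both tails of the load, 2 for the first gap, and 6 = 3 + 3 for both
  tails.\<close>

lemma bad_event_bound:
  fixes \<epsilon> k pst :: real and B v :: "'a \<Rightarrow> real"
  assumes C: "clock_chain S p \<nu> h N" and U: "clock_chain S (\<lambda>_. \<pi>) \<pi> h N"
    and inv: "invariant_dist S p \<pi>" and T: "mixes_at S p \<pi> T" "1 \<le> T"
    and B: "\<And>x z. x \<in> S \<Longrightarrow> z \<in> S \<Longrightarrow> p x z \<le> B z" "\<And>z. z \<in> S \<Longrightarrow> 0 < B z"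
    and v: "\<And>z. z \<in> S \<Longrightarrow> v z = (\<Sum>x\<in>S. \<pi> x * (p x z - \<pi> z)\<^sup>2)" "\<And>z. z \<in> S \<Longrightarrow> 0 < v z"
    and \<epsilon>: "0 < \<epsilon>" "\<epsilon> \<le> 1 / 2" "\<And>z. z \<in> S \<Longrightarrow> \<epsilon> * (2 * B z * \<pi> z) \<le> v z"
    and pst: "0 < pst" "pst \<le> 1" "\<And>y. y \<in> S \<Longrightarrow> pst \<le> \<pi> y"
    and k: "\<And>z. z \<in> S \<Longrightarrow> 2 powr (- k) \<le> pst * (\<epsilon>\<^sup>2 * (\<pi> z)\<^sup>2 / v z) / 6"
  shows "measure clock_seq {\<omega> \<in> space clock_seq. \<not> good_event n \<epsilon> (clock_chain.state S p \<nu> h N 0) (clock_chain.state S (\<lambda>_. \<pi>) \<pi> h N (Suc 0)) \<omega>}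
    \<le> (\<Sum>z\<in>S. 10 * exp (- (real n * \<epsilon>\<^sup>2 / 2048))
        + 2 * (if \<nu> z = 0 then 0 else exp (- (real n * \<epsilon> * (\<pi> z / \<nu> z) / 8)))
        + 6 * exp (- (\<epsilon>\<^sup>2 * (\<pi> z)\<^sup>2 / v z / 14336) * (real n / (k * real T))))"
proof -
  interpret Z: clock_chain S p \<nu> h N 0 by fact
  interpret U: clock_chain S "\<lambda>_. \<pi>" \<pi> h N "Suc 0" by fact
  have \<pi>0: "0 < \<pi> z" if "z \<in> S" for z using pst(1) pst(3)[OF that] by simp
  note [measurable] = Z.measurable_gap U.measurable_gap Z.measurable_rate
  define A1 where "A1 = {\<omega> \<in> space clock_seq. real n * (1 - \<epsilon> / 2) \<le> (\<Sum>i\<le>nat \<lfloor>real n * (1 - \<epsilon>)\<rfloor>. U.gap i \<omega>)}"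
  define A2 where "A2 = {\<omega> \<in> space clock_seq. (\<Sum>i\<le>nat \<lfloor>real n * (1 + \<epsilon>)\<rfloor>. U.gap i \<omega>) \<le> real n * (1 + \<epsilon> / 2)}"
  \<comment> \<open>The guard matters: for \<open>\<nu> z = 0\<close> the quotient would be 0 and
    the event would hold almost surely.\<close>
  define A3 where "A3 z = {\<omega> \<in> space clock_seq. 0 < \<nu> z \<and> real n * \<epsilon> * \<pi> z / (4 * \<nu> z) \<le> Z.gap 0 \<omega>}" for z
  define A4 where "A4 s z = {\<omega> \<in> space clock_seq. real n * \<epsilon> * \<pi> z / 4 \<le> s * (\<Sum>i<n. Z.gap (Suc i) \<omega> * Z.rate (Suc i) \<omega> z - \<pi> z)}"
    for s :: real and z
  have meas [measurable]: "A1 \<in> sets clock_seq" "A2 \<in> sets clock_seq" "A3 z \<in> sets clock_seq" "A4 s z \<in> sets clock_seq" for s z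
    unfolding A1_def A2_def A3_def A4_def by measurable
  \<comment> \<open>The events \<open>A1\<close> and \<open>A2\<close> do not depend on
    \<open>z\<close>, but are counted for each state so that the bound is a single sum over the
    nonempty set \<open>S\<close>.\<close>
  define A where "A z = A1 \<union> A2 \<union> A3 z \<union> A4 1 z \<union> A4 (-1) z" for z
  have Am [measurable]: "A z \<in> sets clock_seq" for z unfolding A_def by measurable
  obtain z0 where z0: "z0 \<in> S" using prob_dist_pos[OF Z.\<nu>] by auto
  let ?bad = "{\<omega> \<in> space clock_seq. \<not> good_event n \<epsilon> Z.state U.state \<omega>}"
  have "measure clock_seq ?bad \<le> measure clock_seq (\<Union>z\<in>S. A z)"
  \<comment> \<open>The inclusion holds only almost surely, since the comparison of loads and clocks
    needs all coordinates to be nonnegative.\<close>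
  proof (rule seq.P.finite_measure_mono_AE)
    show "AE \<omega> in clock_seq. \<omega> \<in> ?bad \<longrightarrow> \<omega> \<in> (\<Union>z\<in>S. A z)"
      using AE_seq_nonneg AE_space
    proof eventually_elim
      case (elim \<omega>)
      show ?case
      proof (intro impI, rule ccontr)
        assume b: "\<omega> \<in> ?bad" and c: "\<omega> \<notin> (\<Union>z\<in>S. A z)"
        have "\<exists>z\<in>S. \<exists>s\<in>{1, -1}. real n * \<epsilon> * \<pi> z / 4 \<le> s * (\<Sum>i<n. Z.gap (Suc i) \<omega> * Z.rate (Suc i) \<omega> z - \<pi> z)"
        proof (rule bad_event_subset[OF C U \<pi>0 \<epsilon>(1,2) elim(1)])
          show "\<not> good_event n \<epsilon> Z.state U.state \<omega>" using b by simp
          show "(\<Sum>i\<le>nat \<lfloor>real n * (1 - \<epsilon>)\<rfloor>. U.gap i \<omega>) < real n * (1 - \<epsilon> / 2)"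
            using c z0 elim(2) by (auto simp: A_def A1_def)
          show "real n * (1 + \<epsilon> / 2) < (\<Sum>i\<le>nat \<lfloor>real n * (1 + \<epsilon>)\<rfloor>. U.gap i \<omega>)"
            using c z0 elim(2) by (auto simp: A_def A2_def)
          show "Z.gap 0 \<omega> < real n * \<epsilon> * \<pi> z / (4 * \<nu> z)" if "z \<in> S" "0 < \<nu> z" for z
            using c that elim(2) by (auto simp: A_def A3_def)
        qed
        then show False using c elim(2) by (auto simp: A_def A4_def)
      qed
    qed
    show "(\<Union>z\<in>S. A z) \<in> sets clock_seq" using Z.S Am by (intro sets.finite_UN) auto
  qed
  also have "\<dots> \<le> (\<Sum>z\<in>S. measure clock_seq (A z))"
    using Z.S by (intro seq.P.finite_measure_subadditive_finite) auto
  also have "\<dots> \<le> (\<Sum>z\<in>S. 10 * exp (- (real n * \<epsilon>\<^sup>2 / 2048))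
        + 2 * (if \<nu> z = 0 then 0 else exp (- (real n * \<epsilon> * (\<pi> z / \<nu> z) / 8)))
        + 6 * exp (- (\<epsilon>\<^sup>2 * (\<pi> z)\<^sup>2 / v z / 14336) * (real n / (k * real T))))"
  proof (rule sum_mono)
    fix z assume z: "z \<in> S"
    let ?e = "exp (- (real n * \<epsilon>\<^sup>2 / 2048))"
    let ?f = "exp (- (\<epsilon>\<^sup>2 * (\<pi> z)\<^sup>2 / v z / 14336) * (real n / (k * real T)))"
    have e64: "exp (- (real n * \<epsilon>\<^sup>2 / 64)) \<le> ?e" by simp
    have 1: "measure clock_seq A1 \<le> 3 * ?e"
      using clock_sum_upper[where n = n and b = "Suc 0", OF U \<epsilon>(1,2)] e64 unfolding A1_def by linarith
    have 2: "measure clock_seq A2 \<le> ?e"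
      using clock_sum_lower[where n = n and b = "Suc 0", OF U \<epsilon>(1,2)] e64 unfolding A2_def by linarith
    have 3: "measure clock_seq (A3 z) \<le> 2 * (if \<nu> z = 0 then 0 else exp (- (real n * \<epsilon> * (\<pi> z / \<nu> z) / 8)))"
    proof (cases "\<nu> z = 0")
      case True
      then show ?thesis by (simp add: A3_def)
    next
      case False
      then have "0 < \<nu> z" using Z.\<nu> z by (auto simp: prob_dist_def less_le)
      then show ?thesis
        using Z.first_clock_tail[of "real n * \<epsilon> * \<pi> z / (4 * \<nu> z)"] by (simp add: A3_def mult.commute)
    qed
    have 4: "measure clock_seq (A4 s z) \<le> 3 * (?e + ?f)" if "\<bar>s\<bar> = 1" for s
      unfolding A4_def using z that
      by (intro Z.chain_deviation[OF inv T z B(1)[OF _ z] B(2)[OF z] v(1)[OF z] v(2)[OF z] that \<epsilon>(1,2) \<epsilon>(3)[OF z] pst k[OF z]]) auto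
    have 41: "measure clock_seq (A4 1 z) \<le> 3 * (?e + ?f)" and 42: "measure clock_seq (A4 (-1) z) \<le> 3 * (?e + ?f)"
      by (rule 4, simp)+
    have "measure clock_seq (A z) \<le> measure clock_seq A1 + measure clock_seq A2 + measure clock_seq (A3 z) + measure clock_seq (A4 1 z) + measure clock_seq (A4 (-1) z)"
      unfolding A_def
      by (intro order_trans[OF measure_Un_le] add_mono order_refl) (use meas in auto)
    then show "measure clock_seq (A z) \<le> 10 * ?e
        + 2 * (if \<nu> z = 0 then 0 else exp (- (real n * \<epsilon> * (\<pi> z / \<nu> z) / 8))) + 6 * ?f"
      using 1 2 3 41 42 by argo
  qed
  finally show ?thesis .
qed

theorem theorem3p1:
  shows "\<exists>c C :: real. 0 < c \<and> 0 < C \<and>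
    (\<forall>(S :: 'a set) p \<pi> \<nu> \<mu>.
       finite S \<and> stochastic S p \<and> irreducible_chain S p \<and> invariant_dist S p \<pi> \<and>
       prob_dist S \<nu> \<and> (\<forall>x\<in>S. \<mu> x > 0) \<longrightarrow>
       (\<exists>(M :: (nat \<Rightarrow> real) measure) Z U.
          prob_space M \<and> markov_chain M S p \<nu> Z \<and> iid_marginal M S \<pi> U \<and>
          (\<forall>\<epsilon> n.
             0 < \<epsilon> \<and> \<epsilon> \<le> 1/2 \<and>
             \<epsilon> \<le> Min ((\<lambda>z. var_pi S \<pi> (rho p \<mu> z)
                          / (2 * sup_norm S (rho p \<mu> z) * gfun \<pi> \<mu> z)) ` S) \<and>
             (\<exists>m. mixes_at S p \<pi> m) \<and>
             real n \<ge> 2 * k_eps S p \<pi> \<mu> \<epsilon> * real (mixing_time S p \<pi>) \<longrightarrow>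
             measure M {\<omega>\<in>space M. \<not> good_event n \<epsilon> Z U \<omega>}
               \<le> C * (\<Sum>z\<in>S.
                    exp (- c * real n * \<epsilon>^2)
                  + (if \<nu> z = 0 then 0 else exp (- c * real n * \<epsilon> * (\<pi> z / \<nu> z)))
                  + exp (- (c * \<epsilon>^2 * (gfun \<pi> \<mu> z)^2 / var_pi S \<pi> (rho p \<mu> z))
                         * (real n / (k_eps S p \<pi> \<mu> \<epsilon> * real (mixing_time S p \<pi>))))))))"
proof (rule exI[of _ "1 / 14336"], rule exI[of _ 10], intro conjI allI impI)
  fix S :: "'a set" and p and \<pi> \<nu> \<mu> :: "'a \<Rightarrow> real"
  assume "finite S \<and> stochastic S p \<and> irreducible_chain S p \<and> invariant_dist S p \<pi> \<and>
       prob_dist S \<nu> \<and> (\<forall>x\<in>S. \<mu> x > 0)"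
  then have S: "finite S" and p: "stochastic S p" and inv: "invariant_dist S p \<pi>"
    and \<nu>: "prob_dist S \<nu>" and \<mu>: "\<And>x. x \<in> S \<Longrightarrow> 0 < \<mu> x" by auto
  have \<pi>: "prob_dist S \<pi>" using inv by (simp add: invariant_dist_def)
  obtain h :: "'a \<Rightarrow> nat" and N where h: "h ` S = {i. i < N}" "inj_on h S"
    using finite_imp_inj_to_nat_seg[OF S] by auto
  have C: "clock_chain S p \<nu> h N"
    using S p \<nu> h by unfold_locales auto
  have U: "clock_chain S (\<lambda>_. \<pi>) \<pi> h N"
    using S \<pi> h by unfold_locales (auto simp: stochastic_def prob_dist_def)
  interpret Z: clock_chain S p \<nu> h N 0 by fact
  interpret U: clock_chain S "\<lambda>_. \<pi>" \<pi> h N "Suc 0" by fact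
  show "\<exists>(M :: (nat \<Rightarrow> real) measure) Z U.
          prob_space M \<and> markov_chain M S p \<nu> Z \<and> iid_marginal M S \<pi> U \<and>
          (\<forall>\<epsilon> n.
             0 < \<epsilon> \<and> \<epsilon> \<le> 1/2 \<and>
             \<epsilon> \<le> Min ((\<lambda>z. var_pi S \<pi> (rho p \<mu> z)
                          / (2 * sup_norm S (rho p \<mu> z) * gfun \<pi> \<mu> z)) ` S) \<and>
             (\<exists>m. mixes_at S p \<pi> m) \<and>
             real n \<ge> 2 * k_eps S p \<pi> \<mu> \<epsilon> * real (mixing_time S p \<pi>) \<longrightarrow>
             measure M {\<omega>\<in>space M. \<not> good_event n \<epsilon> Z U \<omega>}
               \<le> 10 * (\<Sum>z\<in>S.
                    exp (- (1 / 14336) * real n * \<epsilon>^2)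
                  + (if \<nu> z = 0 then 0 else exp (- (1 / 14336) * real n * \<epsilon> * (\<pi> z / \<nu> z)))
                  + exp (- (1 / 14336 * \<epsilon>^2 * (gfun \<pi> \<mu> z)^2 / var_pi S \<pi> (rho p \<mu> z))
                         * (real n / (k_eps S p \<pi> \<mu> \<epsilon> * real (mixing_time S p \<pi>))))))"
  proof (rule exI[of _ clock_seq], rule exI[of _ Z.state], rule exI[of _ U.state], intro conjI allI impI)
    show "prob_space clock_seq" by (intro prob_space_PiM prob_space_expo)
    show "markov_chain clock_seq S p \<nu> Z.state" by (rule Z.markov_chain_state)
    show "iid_marginal clock_seq S \<pi> U.state" by (rule iid_marginal_state[OF U])
  next
    fix \<epsilon> :: real and n :: nat
    assume "0 < \<epsilon> \<and> \<epsilon> \<le> 1/2 \<and>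
             \<epsilon> \<le> Min ((\<lambda>z. var_pi S \<pi> (rho p \<mu> z)
                          / (2 * sup_norm S (rho p \<mu> z) * gfun \<pi> \<mu> z)) ` S) \<and>
             (\<exists>m. mixes_at S p \<pi> m) \<and>
             real n \<ge> 2 * k_eps S p \<pi> \<mu> \<epsilon> * real (mixing_time S p \<pi>)"
    then have \<epsilon>: "0 < \<epsilon>" "\<epsilon> \<le> 1 / 2"
      and \<epsilon>min: "\<epsilon> \<le> Min ((\<lambda>z. var_pi S \<pi> (rho p \<mu> z) / (2 * sup_norm S (rho p \<mu> z) * gfun \<pi> \<mu> z)) ` S)"
      and ex: "\<exists>m. mixes_at S p \<pi> m" by auto
    define T where "T = mixing_time S p \<pi>"
    define k where "k = k_eps S p \<pi> \<mu> \<epsilon>"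
    define pst where "pst = pi_star S \<pi>"
    define B where "B z = \<mu> z * sup_norm S (rho p \<mu> z)" for z
    define v where "v z = (\<Sum>x\<in>S. \<pi> x * (p x z - \<pi> z)\<^sup>2)" for z
    define x where "x z = \<epsilon>\<^sup>2 * (\<pi> z)\<^sup>2 / v z" for z
    have mix: "mixes_at S p \<pi> T"
      unfolding T_def mixing_time_def using ex by (rule LeastI_ex)
    obtain z0 where z0: "z0 \<in> S" using prob_dist_pos[OF \<nu>] by auto
    \<comment> \<open>Together with \<open>gfun\<close> and the rescaled supremum \<open>B\<close>,
      this removes \<open>\<mu>\<close> from every quantity in the bound.\<close>
    have var: "var_pi S \<pi> (rho p \<mu> z) = v z / (\<mu> z)\<^sup>2" if z: "z \<in> S" for z
    proof -
      have "pi_exp S \<pi> (rho p \<mu> z) = \<pi> z / \<mu> z"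
        using inv z by (simp add: pi_exp_def rho_def invariant_dist_def flip: sum_divide_distrib)
      then have "var_pi S \<pi> (rho p \<mu> z) = (\<Sum>x\<in>S. \<pi> x * (p x z / \<mu> z - \<pi> z / \<mu> z)\<^sup>2)"
        by (simp add: var_pi_def pi_exp_def rho_def)
      also have "\<dots> = v z / (\<mu> z)\<^sup>2"
        by (simp add: v_def power_divide sum_divide_distrib flip: diff_divide_distrib)
      finally show ?thesis .
    qed
    have pB: "p x z \<le> B z" if "x \<in> S" "z \<in> S" for x z
    proof -
      have "\<bar>rho p \<mu> z x\<bar> \<le> sup_norm S (rho p \<mu> z)"
        unfolding sup_norm_def using S that by (intro Max_ge) auto
      then have "\<mu> z * (p x z / \<mu> z) \<le> B z"
        unfolding B_def using \<mu>[OF that(2)] abs_ge_self[of "rho p \<mu> z x"]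
        by (intro mult_left_mono) (auto simp: rho_def[of p \<mu> z x])
      then show ?thesis using \<mu>[OF that(2)] by simp
    qed
    have B0: "0 \<le> B z" if "z \<in> S" for z
      using pB[OF z0 that] p_nonneg[OF S p z0 that] by simp
    have \<pi>0: "0 \<le> \<pi> z" if "z \<in> S" for z using \<pi> that by (simp add: prob_dist_def)
    have v0: "0 \<le> v z" for z unfolding v_def using \<pi>0 by (intro sum_nonneg) auto
    have eps: "\<epsilon> \<le> v z / (2 * B z * \<pi> z)" if z: "z \<in> S" for z
    proof -
      have "\<epsilon> \<le> var_pi S \<pi> (rho p \<mu> z) / (2 * sup_norm S (rho p \<mu> z) * gfun \<pi> \<mu> z)"
        using \<epsilon>min S z by (subst (asm) Min_ge_iff) auto
      also have "\<dots> = v z / (2 * B z * \<pi> z)"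
        using \<mu>[OF z] by (simp add: var[OF z] B_def gfun_def power2_eq_square)
      finally show ?thesis .
    qed
    \<comment> \<open>Division by zero gives 0, so a positive \<open>\<epsilon>\<close> below the
      quotient excludes that its numerator or any factor of its denominator vanishes. In particular
      \<open>\<pi>\<close> has full support.\<close>
    have ne: "v z \<noteq> 0 \<and> B z \<noteq> 0 \<and> \<pi> z \<noteq> 0" if z: "z \<in> S" for z
      using eps[OF z] \<epsilon>(1) by auto
    then have pos: "0 < v z" "0 < B z" "0 < \<pi> z" if z: "z \<in> S" for z
      using that v0[of z] B0[OF z] \<pi>0[OF z] by (auto simp: less_le)
    have eps': "\<epsilon> * (2 * B z * \<pi> z) \<le> v z" if z: "z \<in> S" for z
      using eps[OF z] pos[OF z] by (simp add: pos_le_divide_eq)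
    have "0 < Min (\<pi> ` S)"
      using S z0 pos by (subst Min_gr_iff) auto
    then have pst: "0 < pst" "\<And>y. y \<in> S \<Longrightarrow> pst \<le> \<pi> y"
      using S by (auto simp: pst_def pi_star_def)
    have "pst \<le> \<pi> z0" by (rule pst(2)[OF z0])
    also have "\<dots> \<le> 1"
      using member_le_sum[of z0 S \<pi>] z0 \<pi>0 S \<pi> by (simp add: prob_dist_def)
    finally have pst1: "pst \<le> 1" .
    have gx: "\<epsilon>\<^sup>2 * (gfun \<pi> \<mu> z)\<^sup>2 / var_pi S \<pi> (rho p \<mu> z) = x z" if z: "z \<in> S" for z
      using \<mu>[OF z] by (simp add: var[OF z] gfun_def x_def power_divide)
    have x0: "0 < x z" if z: "z \<in> S" for z
      using pos[OF z] \<epsilon> by (simp add: x_def)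
    have k: "2 powr (- k) \<le> pst * x z / 6" if z: "z \<in> S" for z
    proof -
      have "- k \<le> log 2 (pi_star S \<pi> * \<epsilon>^2 * (gfun \<pi> \<mu> z)^2 / (6 * var_pi S \<pi> (rho p \<mu> z)))"
        unfolding k_def k_eps_def using S z by auto
      also have "pi_star S \<pi> * \<epsilon>^2 * (gfun \<pi> \<mu> z)^2 / (6 * var_pi S \<pi> (rho p \<mu> z)) = pst * x z / 6"
        unfolding pst_def gx[OF z, symmetric] by simp
      finally have "2 powr (- k) \<le> 2 powr (log 2 (pst * x z / 6))" by (intro powr_mono) auto
      then show ?thesis using pst(1) x0[OF z] by (simp add: powr_log_cancel)
    qed
    let ?t = "\<lambda>z. exp (- (1 / 14336) * real n * \<epsilon>^2)
                  + (if \<nu> z = 0 then 0 else exp (- (1 / 14336) * real n * \<epsilon> * (\<pi> z / \<nu> z)))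
                  + exp (- (1 / 14336 * \<epsilon>^2 * (gfun \<pi> \<mu> z)^2 / var_pi S \<pi> (rho p \<mu> z)) * (real n / (k * real T)))"
    have third: "exp (- (1 / 14336 * \<epsilon>^2 * (gfun \<pi> \<mu> z)^2 / var_pi S \<pi> (rho p \<mu> z)) * (real n / (k * real T)))
        = exp (- (x z / 14336) * (real n / (k * real T)))" if z: "z \<in> S" for z
      unfolding gx[OF z, symmetric] by simp
    have "measure clock_seq {\<omega>\<in>space clock_seq. \<not> good_event n \<epsilon> Z.state U.state \<omega>} \<le> 10 * (\<Sum>z\<in>S. ?t z)"
    proof (cases "T = 0") \<comment> \<open>for T = 0 the quotient n / (k T) is 0 and the third term is 1\<close>
      case True
      have "?t z0 \<le> (\<Sum>z\<in>S. ?t z)"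
        using z0 S by (intro member_le_sum[where f = ?t]) auto
      moreover have "1 \<le> ?t z0" using True by simp
      ultimately have "1 \<le> 10 * (\<Sum>z\<in>S. ?t z)" by linarith
      then show ?thesis using seq.P.prob_le_1 by (rule order_trans[rotated])
    next
      case False
      have "measure clock_seq {\<omega>\<in>space clock_seq. \<not> good_event n \<epsilon> Z.state U.state \<omega>}
        \<le> (\<Sum>z\<in>S. 10 * exp (- (real n * \<epsilon>\<^sup>2 / 2048))
        + 2 * (if \<nu> z = 0 then 0 else exp (- (real n * \<epsilon> * (\<pi> z / \<nu> z) / 8)))
        + 6 * exp (- (x z / 14336) * (real n / (k * real T))))"
        unfolding x_def
        using False k[unfolded x_def] pos pB eps' \<epsilon> pst pst1
        by (intro bad_event_bound[OF C U inv mix, where B = B and pst = pst]) (auto simp: v_def)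
      also have "\<dots> \<le> (\<Sum>z\<in>S. 10 * ?t z)"
      proof (rule sum_mono)
        fix z assume z: "z \<in> S"
        \<comment> \<open>The absolute constants are the smallest of the rates 1/2048, 1/8, 1/14336
          and the largest of the factors 10, 2, 6.\<close>
        have "exp (- (real n * \<epsilon>\<^sup>2 / 2048)) \<le> exp (- (1 / 14336) * real n * \<epsilon>^2)" by simp
        moreover have "(if \<nu> z = 0 then 0 else exp (- (real n * \<epsilon> * (\<pi> z / \<nu> z) / 8)))
          \<le> (if \<nu> z = 0 then 0 else exp (- (1 / 14336) * real n * \<epsilon> * (\<pi> z / \<nu> z)))"
        proof -
          have "0 \<le> real n * \<epsilon> * (\<pi> z / \<nu> z)"
            using \<epsilon> \<pi>0[OF z] \<nu> z by (auto simp: prob_dist_def)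
          then show ?thesis by simp
        qed
        moreover have "0 \<le> (if \<nu> z = 0 then 0 else exp (- (1 / 14336) * real n * \<epsilon> * (\<pi> z / \<nu> z)))" by simp
        moreover have "0 \<le> exp (- (x z / 14336) * (real n / (k * real T)))" by simp
        ultimately show "10 * exp (- (real n * \<epsilon>\<^sup>2 / 2048))
          + 2 * (if \<nu> z = 0 then 0 else exp (- (real n * \<epsilon> * (\<pi> z / \<nu> z) / 8)))
          + 6 * exp (- (x z / 14336) * (real n / (k * real T))) \<le> 10 * ?t z"
          unfolding third[OF z] by argo
      qed
      finally show ?thesis by (simp only: sum_distrib_left)
    qed
    then show "measure clock_seq {\<omega>\<in>space clock_seq. \<not> good_event n \<epsilon> Z.state U.state \<omega>}
               \<le> 10 * (\<Sum>z\<in>S.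
                    exp (- (1 / 14336) * real n * \<epsilon>^2)
                  + (if \<nu> z = 0 then 0 else exp (- (1 / 14336) * real n * \<epsilon> * (\<pi> z / \<nu> z)))
                  + exp (- (1 / 14336 * \<epsilon>^2 * (gfun \<pi> \<mu> z)^2 / var_pi S \<pi> (rho p \<mu> z))
                         * (real n / (k_eps S p \<pi> \<mu> \<epsilon> * real (mixing_time S p \<pi>)))))"
      unfolding k_def T_def .
  qed
qed simp_all

end
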